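(* Let $\Omega\subset\mathbb{R}^n$ be open, let $F\in\mathcal{DM}^p(\Omega)$ for $1\le p\le\infty$, and let $E\subset\Omega$ be a bounded Borel set. Then $$\langle F\cdot\nu,\cdot\rangle_{\partial E}=\chi_E\,\mathrm{div}F-\mathrm{div}(\chi_EF)$$ in the sense of distributions on $\Omega$. Thus, $\langle F\cdot\nu,\cdot\rangle_{\partial E}\in\mathcal{M}(\partial E)$ if and only if $\mathrm{div}(\chi_EF)\in\mathcal{M}(\Omega)$; that is, $\chi_EF\in\mathcal{DM}^p(\Omega)$. In addition, if $\langle F\cdot\nu,\cdot\rangle_{\partial E}$ is a measure, then (i) $|\langle F\cdot\nu,\cdot\rangle_{\partial E}|\ll\mathcal{H}^{n-1}\llcorner\partial E$, if $p=\infty$; (ii) $|\langle F\cdot\nu,\cdot\rangle_{\partial E}|(B)=0$ for any Borel set $B\subset\partial E$ with $\sigma$-finite $\mathcal{H}^{n-p'}$ measure, if $\frac{n}{n-1}\le p<\infty$.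
   Context: $p'=p/(p-1)$ is the conjugate exponent. $\mathcal{DM}^p(\Omega)$ is the space of vector fields $F\in L^p(\Omega;\mathbb{R}^n)$ whose distributional divergence $\mathrm{div}F$ is a real finite Radon measure on $\Omega$. $\mathcal{M}(\Omega)$ denotes the (real, finite) Radon measures on $\Omega$. The normal trace of $F$ on the boundary of a bounded Borel set $E\subset\Omega$ is the distribution $\langle F\cdot\nu,\phi\rangle_{\partial E}:=\int_E\phi\,d\,\mathrm{div}F+\int_EF\cdot\nabla\phi\,dx$, which is supported on $\partial E$. In this statement it is regarded as a distribution on $\Omega$ (tested against $\phi\in\mathrm{Lip}_c(\Omega)$, the Lipschitz functions with compact support in $\Omega$), and $\langle F\cdot\nu,\cdot\rangle_{\partial E}\in\mathcal{M}(\partial E)$ means that it is represented by a finite Radon measure on $\Omega$ concentrated on $\partial E\cap\Omega$. *)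

theory Defs
  imports "HOL-Analysis.Analysis"
begin

section \<open>Test functions\<close>

text \<open>Test functions on an open set \<open>\<Omega>\<close> are total functions on the whole space whose support is a
  compact subset of \<open>\<Omega>\<close>, i.e. they are already extended by zero.\<close>

definition compact_support_in :: "'a::euclidean_space set \<Rightarrow> ('a \<Rightarrow> real) \<Rightarrow> bool" where
  "compact_support_in \<Omega> \<phi> \<longleftrightarrow>
     compact (closure {x. \<phi> x \<noteq> 0}) \<and> closure {x. \<phi> x \<noteq> 0} \<subseteq> \<Omega>"

definition Lip_c :: "'a::euclidean_space set \<Rightarrow> ('a \<Rightarrow> real) set" where
  "Lip_c \<Omega> = {\<phi>. (\<exists>L. L-lipschitz_on UNIV \<phi>) \<and> compact_support_in \<Omega> \<phi>}"

primrec Ck :: "nat \<Rightarrow> ('a::euclidean_space \<Rightarrow> real) \<Rightarrow> bool" where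
  "Ck 0 f \<longleftrightarrow> continuous_on UNIV f"
| "Ck (Suc k) f \<longleftrightarrow>
     (\<forall>x. f differentiable (at x)) \<and> (\<forall>v. Ck k (\<lambda>x. frechet_derivative f (at x) v))"

definition Cinf_c :: "'a::euclidean_space set \<Rightarrow> ('a \<Rightarrow> real) set" where
  "Cinf_c \<Omega> = {\<phi>. (\<forall>k. Ck k \<phi>) \<and> compact_support_in \<Omega> \<phi>}"

text \<open>The value 0 at points of non-differentiability is immaterial: for Lipschitz functions they
  form a Lebesgue null set (Rademacher).\<close>

definition grad :: "('a::euclidean_space \<Rightarrow> real) \<Rightarrow> 'a \<Rightarrow> 'a" where
  "grad f x = (if \<exists>D. GDERIV f x :> D then THE D. GDERIV f x :> D else 0)"


section \<open>Real finite Radon measures\<close>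

definition borel_subsets :: "'a::topological_space set \<Rightarrow> 'a set set" where
  "borel_subsets \<Omega> = {B \<in> sets borel. B \<subseteq> \<Omega>}"

text \<open>Only the values on Borel subsets of \<open>\<Omega>\<close> matter. For open \<open>\<Omega>\<close>, a real-valued countably
  additive function on the Borel subsets of \<open>\<Omega>\<close> is automatically of finite total variation and
  regular, so these are exactly the real finite Radon measures on \<open>\<Omega>\<close>.\<close>

definition real_measure :: "'a::euclidean_space set \<Rightarrow> ('a set \<Rightarrow> real) \<Rightarrow> bool" where
  "real_measure \<Omega> \<mu> \<longleftrightarrow>
     (\<forall>A :: nat \<Rightarrow> 'a set. range A \<subseteq> borel_subsets \<Omega> \<longrightarrow> disjoint_family A \<longrightarrow>
        (\<lambda>i. \<mu> (A i)) sums \<mu> (\<Union>i. A i))"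

definition total_variation :: "('a::euclidean_space set \<Rightarrow> real) \<Rightarrow> 'a set \<Rightarrow> ennreal" where
  "total_variation \<mu> B =
     (SUP A \<in> {A :: nat \<Rightarrow> 'a set. range A \<subseteq> sets borel \<and> disjoint_family A \<and> (\<Union>i. A i) = B}.
        \<Sum>i. ennreal \<bar>\<mu> (A i)\<bar>)"

text \<open>Jordan decomposition: the positive part is \<open>(\<bar>\<mu>\<bar> + \<mu>) / 2\<close>, the negative part
  \<open>(\<bar>\<mu>\<bar> - \<mu>) / 2\<close>.\<close>

definition positive_part :: "'a::euclidean_space set \<Rightarrow> ('a set \<Rightarrow> real) \<Rightarrow> 'a measure" where
  "positive_part \<Omega> \<mu> = measure_of \<Omega> (borel_subsets \<Omega>)
     (\<lambda>B. ennreal ((enn2real (total_variation \<mu> B) + \<mu> B) / 2))"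

definition negative_part :: "'a::euclidean_space set \<Rightarrow> ('a set \<Rightarrow> real) \<Rightarrow> 'a measure" where
  "negative_part \<Omega> \<mu> = measure_of \<Omega> (borel_subsets \<Omega>)
     (\<lambda>B. ennreal ((enn2real (total_variation \<mu> B) - \<mu> B) / 2))"

definition real_integral ::
  "'a::euclidean_space set \<Rightarrow> ('a set \<Rightarrow> real) \<Rightarrow> ('a \<Rightarrow> real) \<Rightarrow> real" where
  "real_integral \<Omega> \<mu> f = (LINT x|positive_part \<Omega> \<mu>. f x) - (LINT x|negative_part \<Omega> \<mu>. f x)"

definition restrict_real_measure :: "'a set \<Rightarrow> ('a set \<Rightarrow> real) \<Rightarrow> 'a set \<Rightarrow> real" where
  "restrict_real_measure E \<mu> = (\<lambda>B. \<mu> (B \<inter> E))"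

definition concentrated_on ::
  "'a::euclidean_space set \<Rightarrow> ('a set \<Rightarrow> real) \<Rightarrow> 'a set \<Rightarrow> bool" where
  "concentrated_on \<Omega> \<mu> S \<longleftrightarrow> total_variation \<mu> (\<Omega> - S) = 0"


section \<open>Divergence-measure fields\<close>

text \<open>Vector fields are total functions; only their values on \<open>\<Omega>\<close> matter.\<close>

definition Lp_field :: "ennreal \<Rightarrow> 'a::euclidean_space set \<Rightarrow> ('a \<Rightarrow> 'a) \<Rightarrow> bool" where
  "Lp_field p \<Omega> F \<longleftrightarrow> F \<in> borel_measurable (lebesgue_on \<Omega>) \<and>
     (if p = \<infinity> then \<exists>C. AE x in lebesgue_on \<Omega>. norm (F x) \<le> C
      else integrable (lebesgue_on \<Omega>) (\<lambda>x. norm (F x) powr enn2real p))"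

definition distr_div :: "'a::euclidean_space set \<Rightarrow> ('a \<Rightarrow> 'a) \<Rightarrow> ('a \<Rightarrow> real) \<Rightarrow> real" where
  "distr_div \<Omega> F \<phi> = - (LINT x:\<Omega>|lebesgue. F x \<bullet> grad \<phi> x)"

definition div_represented_by ::
  "'a::euclidean_space set \<Rightarrow> ('a \<Rightarrow> 'a) \<Rightarrow> ('a set \<Rightarrow> real) \<Rightarrow> bool" where
  "div_represented_by \<Omega> F \<mu> \<longleftrightarrow>
     real_measure \<Omega> \<mu> \<and> (\<forall>\<phi> \<in> Cinf_c \<Omega>. distr_div \<Omega> F \<phi> = real_integral \<Omega> \<mu> \<phi>)"

definition div_is_measure :: "'a::euclidean_space set \<Rightarrow> ('a \<Rightarrow> 'a) \<Rightarrow> bool" where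
  "div_is_measure \<Omega> F \<longleftrightarrow> (\<exists>\<mu>. div_represented_by \<Omega> F \<mu>)"

definition DM :: "ennreal \<Rightarrow> 'a::euclidean_space set \<Rightarrow> ('a \<Rightarrow> 'a) set" where
  "DM p \<Omega> = {F. Lp_field p \<Omega> F \<and> div_is_measure \<Omega> F}"

text \<open>The representing measure is unique on the Borel subsets of \<open>\<Omega>\<close>, so the choice only affects
  irrelevant values.\<close>

definition div_measure :: "'a::euclidean_space set \<Rightarrow> ('a \<Rightarrow> 'a) \<Rightarrow> 'a set \<Rightarrow> real" where
  "div_measure \<Omega> F = (SOME \<mu>. div_represented_by \<Omega> F \<mu>)"

definition normal_trace ::
  "'a::euclidean_space set \<Rightarrow> ('a \<Rightarrow> 'a) \<Rightarrow> 'a set \<Rightarrow> ('a \<Rightarrow> real) \<Rightarrow> real" where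
  "normal_trace \<Omega> F E \<phi> =
     real_integral \<Omega> (div_measure \<Omega> F) (\<lambda>x. indicator E x * \<phi> x)
     + (LINT x:E|lebesgue. F x \<bullet> grad \<phi> x)"

definition trace_represented_by ::
  "'a::euclidean_space set \<Rightarrow> ('a \<Rightarrow> 'a) \<Rightarrow> 'a set \<Rightarrow> ('a set \<Rightarrow> real) \<Rightarrow> bool" where
  "trace_represented_by \<Omega> F E \<sigma> \<longleftrightarrow>
     real_measure \<Omega> \<sigma> \<and> concentrated_on \<Omega> \<sigma> (frontier E \<inter> \<Omega>) \<and>
     (\<forall>\<phi> \<in> Lip_c \<Omega>. normal_trace \<Omega> F E \<phi> = real_integral \<Omega> \<sigma> \<phi>)"


section \<open>Hausdorff measure\<close>

text \<open>For \<open>s = 0\<close> every nonempty set has weight 1 (counting measure); this needs a separate case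
  because \<open>0 powr 0 = 0\<close>.\<close>

definition hausdorff_weight :: "real \<Rightarrow> 'a::euclidean_space set \<Rightarrow> real" where
  "hausdorff_weight s C =
     (if C = {} then 0 else if s = 0 then 1 else unit_ball_vol s * (diameter C / 2) powr s)"

text \<open>Covers are required to be bounded because \<open>diameter\<close> is unspecified on unbounded sets.\<close>

definition hausdorff_content :: "real \<Rightarrow> real \<Rightarrow> 'a::euclidean_space set \<Rightarrow> ennreal" where
  "hausdorff_content \<delta> s A =
     (INF C \<in> {C :: nat \<Rightarrow> 'a set. A \<subseteq> (\<Union>i. C i) \<and> (\<forall>i. bounded (C i) \<and> diameter (C i) \<le> \<delta>)}.
        \<Sum>i. ennreal (hausdorff_weight s (C i)))"

definition hausdorff :: "real \<Rightarrow> 'a::euclidean_space set \<Rightarrow> ennreal" where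
  "hausdorff s A = (SUP \<delta> \<in> {0<..}. hausdorff_content \<delta> s A)"

definition sigma_finite_hausdorff :: "real \<Rightarrow> 'a::euclidean_space set \<Rightarrow> bool" where
  "sigma_finite_hausdorff s B \<longleftrightarrow>
     (\<exists>A :: nat \<Rightarrow> 'a set. range A \<subseteq> sets borel \<and> B = (\<Union>i. A i) \<and> (\<forall>i. hausdorff s (A i) < \<infinity>))"

definition conjugate_exponent :: "real \<Rightarrow> real" where
  "conjugate_exponent p = p / (p - 1)"

end

(* The identity is a rearrangement of definitions. The substance lies in two facts about a
   divergence-measure field G with divergence \<lambda>.

   First, the pairing with \<lambda> extends from smooth to Lipschitz test functions. This is proved by
   mollification; Rademacher's theorem makes the pointwise gradient of a Lipschitz function agree
   with its weak gradient, and continuity of translations in L^1 passes to the limit. It shows that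
   \<chi>_E div F - div (\<chi>_E F) represents the trace on Lip_c, and that the trace kills every \<phi> whose
   support misses the boundary of E, because then \<chi>_E \<phi> is again an admissible test function.

   Second, \<lambda> does not charge a compact set K that is small for Hausdorff measure. Covering K by balls
   of radii r_i, the maximum \<phi> of the ball cutoffs satisfies |grad \<phi>|^q \<le> \<Sum> r_i^(-q), summed over
   the doubled balls containing the point, so the integral of |grad \<phi>|^q is bounded by a multiple of \<Sum> r_i^(n-q), i.e. by the Hausdorff
   measure of dimension n - q. For p = \<infinity>, q = 1, this is arbitrarily small; for q = p' it is merely
   bounded, but grad \<phi> vanishes on K, and |G|^p has small integral on a small neighbourhood of K
   with K removed. Both F and \<chi>_E F are divergence-measure fields, so the trace inherits this. *)

theory Submission
  imports Defs
begin

section \<open>Finite signed measures\<close>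

text \<open>The vanishing results need the Lipschitz extension as much as the trace formula does,
  since a maximum of ball cutoffs is not smooth. The dimension n - q arises because a cutoff at
  radius r has gradient of size 1/r on a set of volume of order r^n.

  Smallness is proved for compact sets, where finite ball covers exist; inner regularity of the
  Jordan parts carries it to Borel sets. The trace measure is \<open>\<mu>\<close> restricted to
  \<open>E\<close> minus the divergence of \<chi>F. On a compact K its first term is the mass of
  \<open>K \<inter> E\<close>, which need not be compact, so the total variation of
  \<open>\<mu>\<close> must be shown to vanish.

  For finite p, a weighted Young inequality separates |F|^p from |grad|^q. Its weight is fixed
  before the neighbourhood of K shrinks; this works because the bound on the gradient term does not
  depend on the scale of the cover.

  Integrals are defined through Jordan parts, but restrictions and differences of measures do not
  come in Jordan form, so the integral must first be freed from the choice of decomposition.\<close>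

lemma disjoint_family_natI:
  assumes "\<And>m n :: nat. m < n \<Longrightarrow> A m \<inter> A n = {}"
  shows "disjoint_family A"
  unfolding disjoint_family_on_def using assms by (metis inf_commute linorder_neqE_nat)

lemma borel_subsets_eq_sets:
  assumes "\<Omega> \<in> sets borel"
  shows "borel_subsets \<Omega> = sets (restrict_space borel \<Omega>)"
  using assms by (auto simp: borel_subsets_def sets_restrict_space_iff)

lemma sigma_algebra_borel_subsets:
  assumes "\<Omega> \<in> sets borel"
  shows "sigma_algebra \<Omega> (borel_subsets \<Omega>)"
  using sets.sigma_algebra_axioms[of "restrict_space borel \<Omega>"] assms
  by (simp add: borel_subsets_eq_sets space_restrict_space)

locale signed_measure =
  fixes \<Omega> :: "'a::euclidean_space set" and \<mu> :: "'a set \<Rightarrow> real"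
  assumes borel_domain: "\<Omega> \<in> sets borel"
    and real_measure: "real_measure \<Omega> \<mu>"
begin

sublocale sigma_algebra \<Omega> "borel_subsets \<Omega>"
  by (rule sigma_algebra_borel_subsets[OF borel_domain])

lemma sums_disjoint:
  "range A \<subseteq> borel_subsets \<Omega> \<Longrightarrow> disjoint_family A \<Longrightarrow> (\<lambda>i. \<mu> (A i)) sums \<mu> (\<Union>i. A i)"
  using real_measure by (auto simp: real_measure_def)

lemma empty [simp]: "\<mu> {} = 0"
proof -
  have "(\<lambda>i::nat. \<mu> {}) sums \<mu> (\<Union>i::nat. {})"
    by (rule sums_disjoint) (auto simp: disjoint_family_on_def)
  then have "(\<lambda>i::nat. \<mu> {}) \<longlonglongrightarrow> 0"
    by (intro summable_LIMSEQ_zero) (auto simp: sums_iff)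
  then show ?thesis
    by (simp add: LIMSEQ_const_iff)
qed

lemma union:
  assumes "A \<in> borel_subsets \<Omega>" "B \<in> borel_subsets \<Omega>" "A \<inter> B = {}"
  shows "\<mu> (A \<union> B) = \<mu> A + \<mu> B"
proof -
  have "(\<lambda>i. \<mu> (binaryset A B i)) sums \<mu> (\<Union>i. binaryset A B i)"
    using assms by (intro sums_disjoint) (auto simp: range_binaryset_eq disjoint_family_on_def binaryset_def)
  moreover have "(\<lambda>i. \<mu> (binaryset A B i)) sums (\<mu> A + \<mu> B)"
    by (rule binaryset_sums) simp
  ultimately show ?thesis
    by (metis UN_binaryset_eq sums_unique2)
qed

lemma diff:
  assumes "A \<in> borel_subsets \<Omega>" "B \<in> borel_subsets \<Omega>" "B \<subseteq> A"
  shows "\<mu> (A - B) = \<mu> A - \<mu> B"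
proof -
  have "(A - B) \<union> B = A" "(A - B) \<inter> B = {}" "A - B \<in> borel_subsets \<Omega>"
    using assms by auto
  then show ?thesis
    using union[of "A - B" B] assms(2) by simp
qed

lemma split:
  assumes "A \<in> borel_subsets \<Omega>" "B \<in> borel_subsets \<Omega>"
  shows "\<mu> A = \<mu> (A \<inter> B) + \<mu> (A - B)"
proof -
  have "(A \<inter> B) \<union> (A - B) = A" "(A \<inter> B) \<inter> (A - B) = {}"
    "A \<inter> B \<in> borel_subsets \<Omega>" "A - B \<in> borel_subsets \<Omega>"
    using assms by auto
  then show ?thesis
    using union[of "A \<inter> B" "A - B"] by simp
qed

section \<open>Hahn decomposition of a real-valued countably additive set function\<close>

text \<open>Otherwise a piece of mass at most \<open>- e\<close> can be cut out again and again;
  each cut raises the mass of the remainder, so the remainder stays a candidate. The removed pieces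
  are disjoint, so their masses form a convergent series whose terms stay below \<open>- e\<close>,
  which is absurd.\<close>

lemma exists_subset_above:
  assumes E: "E \<in> borel_subsets \<Omega>" and "e > 0"
  shows "\<exists>A\<in>borel_subsets \<Omega>. A \<subseteq> E \<and> \<mu> E \<le> \<mu> A \<and> (\<forall>B\<in>borel_subsets \<Omega>. B \<subseteq> A \<longrightarrow> - e < \<mu> B)"
proof (rule ccontr)
  assume "\<not> ?thesis"
  then have "\<forall>A. \<exists>B. A \<in> borel_subsets \<Omega> \<and> A \<subseteq> E \<and> \<mu> E \<le> \<mu> A \<longrightarrow>
      B \<in> borel_subsets \<Omega> \<and> B \<subseteq> A \<and> \<mu> B \<le> - e"
    by (meson not_less)
  then obtain b where b: "\<And>A. \<lbrakk>A \<in> borel_subsets \<Omega>; A \<subseteq> E; \<mu> E \<le> \<mu> A\<rbrakk> \<Longrightarrow>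
      b A \<in> borel_subsets \<Omega> \<and> b A \<subseteq> A \<and> \<mu> (b A) \<le> - e"
    by metis
  define R where "R n = ((\<lambda>A. A - b A) ^^ n) E" for n
  have RS: "R (Suc n) = R n - b (R n)" for n
    by (simp add: R_def)
  have R: "R n \<in> borel_subsets \<Omega> \<and> R n \<subseteq> E \<and> \<mu> E \<le> \<mu> (R n)" for n
  proof (induction n)
    case (Suc n)
    then have B: "b (R n) \<in> borel_subsets \<Omega> \<and> b (R n) \<subseteq> R n \<and> \<mu> (b (R n)) \<le> - e"
      using b by blast
    then show ?case
      using Suc diff[of "R n" "b (R n)"] \<open>e > 0\<close> by (auto simp: RS)
  qed (simp add: R_def E)
  have bR: "b (R n) \<in> borel_subsets \<Omega>" "b (R n) \<subseteq> R n" "\<mu> (b (R n)) \<le> - e" for n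
    using b R by blast+
  have dec: "R n \<subseteq> R m" if "m \<le> n" for m n
    using that by (induction n rule: dec_induct) (auto simp: RS)
  have disj: "b (R m) \<inter> b (R n) = {}" if "m < n" for m n
    using dec[of "Suc m" n] that bR(2)[of n] by (auto simp: RS)
  have "(\<lambda>n. \<mu> (b (R n))) sums \<mu> (\<Union>n. b (R n))"
  proof (rule sums_disjoint)
    show "disjoint_family (\<lambda>n. b (R n))"
      using disj by (rule disjoint_family_natI)
  qed (use bR in auto)
  then have "(\<lambda>n. \<mu> (b (R n))) \<longlonglongrightarrow> 0"
    by (intro summable_LIMSEQ_zero) (auto simp: sums_iff)
  then have "0 \<le> - e"
    by (rule LIMSEQ_le_const2) (use bR in auto)
  then show False
    using \<open>e > 0\<close> by simp
qed

text \<open>\<open>exists_subset_above\<close> with tolerance 1/(n+1) is applied inside the set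
  found before, and the chain is intersected. Mass grows along the chain, so every removed shell has
  mass at most 0; summing the shells shows that passing to the intersection loses nothing.\<close>

lemma exists_positive_subset:
  assumes E: "E \<in> borel_subsets \<Omega>"
  shows "\<exists>A\<in>borel_subsets \<Omega>. A \<subseteq> E \<and> \<mu> E \<le> \<mu> A \<and> (\<forall>B\<in>borel_subsets \<Omega>. B \<subseteq> A \<longrightarrow> 0 \<le> \<mu> B)"
proof -
  let ?P = "\<lambda>n A. A \<in> borel_subsets \<Omega> \<and> A \<subseteq> E \<and> \<mu> E \<le> \<mu> A \<and>
      (\<forall>B\<in>borel_subsets \<Omega>. B \<subseteq> A \<longrightarrow> - inverse (real (Suc n)) < \<mu> B)"
  have "\<exists>A. \<forall>n. ?P n (A n) \<and> (A (Suc n) \<subseteq> A n \<and> \<mu> (A n) \<le> \<mu> (A (Suc n)))"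
  proof (rule dependent_nat_choice)
    show "\<exists>A. ?P 0 A"
      using exists_subset_above[OF E, of "inverse (real (Suc 0))"] by auto
  next
    fix A n assume A: "?P n A"
    then show "\<exists>B. ?P (Suc n) B \<and> B \<subseteq> A \<and> \<mu> A \<le> \<mu> B"
      using exists_subset_above[of A "inverse (real (Suc (Suc n)))"]
      by (meson inverse_positive_iff_positive of_nat_0_less_iff order_trans zero_less_Suc)
  qed
  then obtain A where A: "\<And>n. ?P n (A n)" and dec: "\<And>n. A (Suc n) \<subseteq> A n"
    and inc: "\<And>n. \<mu> (A n) \<le> \<mu> (A (Suc n))"
    by blast
  define I where "I = (\<Inter>n. A n)"
  have I: "I \<in> borel_subsets \<Omega>"
    unfolding I_def using A by (intro countable_INT) auto
  have decm: "A n \<subseteq> A m" if "m \<le> n" for m n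
    using that dec by (rule lift_Suc_antimono_le[rotated])
  have sums: "(\<lambda>n. \<mu> (A n - A (Suc n))) sums \<mu> (\<Union>n. A n - A (Suc n))"
  proof (rule sums_disjoint)
    have "(A m - A (Suc m)) \<inter> (A n - A (Suc n)) = {}" if "m < n" for m n
      using decm[of "Suc m" n] that by auto
    then show "disjoint_family (\<lambda>n. A n - A (Suc n))"
      by (rule disjoint_family_natI)
  qed (use A in auto)
  have union: "(\<Union>n. A n - A (Suc n)) = A 0 - I"
  proof -
    have ex: "\<exists>n. x \<in> A n - A (Suc n)" if "x \<in> A 0" "x \<notin> A m" for x m
      using that by (induction m) auto
    have sub: "x \<in> A 0" if "x \<in> A n" for x n
      using decm[of 0 n] that by blast
    show ?thesis
    proof (intro equalityI subsetI)
      fix x assume "x \<in> (\<Union>n. A n - A (Suc n))"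
      then show "x \<in> A 0 - I"
        using sub by (auto simp: I_def)
    next
      fix x assume "x \<in> A 0 - I"
      then obtain m where "x \<in> A 0" "x \<notin> A m"
        by (auto simp: I_def)
      then show "x \<in> (\<Union>n. A n - A (Suc n))"
        using ex by blast
    qed
  qed
  have "\<mu> (A n - A (Suc n)) \<le> 0" for n
    using diff[of "A n" "A (Suc n)"] A dec inc[of n] by simp
  then have "\<mu> (A 0 - I) \<le> 0"
    by (rule sums_le[OF _ sums[unfolded union] sums_zero])
  moreover have "I \<subseteq> A 0"
    by (auto simp: I_def)
  ultimately have "\<mu> E \<le> \<mu> I"
    using diff[of "A 0" I] A[of 0] I by auto
  moreover have "0 \<le> \<mu> B" if "B \<in> borel_subsets \<Omega>" "B \<subseteq> I" for B
  proof (rule LIMSEQ_le_const2)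
    show "(\<lambda>n. - inverse (real (Suc n))) \<longlonglongrightarrow> 0"
      using tendsto_minus[OF LIMSEQ_inverse_real_of_nat] by simp
    have "- inverse (real (Suc n)) < \<mu> B" for n
    proof -
      have "B \<subseteq> A n"
        using that by (auto simp: I_def)
      then show ?thesis
        using A[of n] that by blast
    qed
    then show "\<exists>N. \<forall>n\<ge>N. - inverse (real (Suc n)) \<le> \<mu> B"
      by (intro exI[of _ 0] allI impI less_imp_le)
  qed
  moreover have "I \<subseteq> E"
    using \<open>I \<subseteq> A 0\<close> A[of 0] by (meson order_trans)
  ultimately show ?thesis
    using I by (intro bexI[of _ I] conjI ballI impI)
qed

text \<open>A countable union of positive sets whose masses approach the supremum is positive and
  attains it. A set of positive mass outside would contain a positive subset of positive mass, and
  adding that to the union would exceed the supremum.\<close>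

lemma Hahn_decomposition:
  "\<exists>D\<in>borel_subsets \<Omega>. (\<forall>B\<in>borel_subsets \<Omega>. B \<subseteq> D \<longrightarrow> 0 \<le> \<mu> B)
     \<and> (\<forall>B\<in>borel_subsets \<Omega>. B \<inter> D = {} \<longrightarrow> \<mu> B \<le> 0)"
proof -
  define PP where "PP = {P\<in>borel_subsets \<Omega>. \<forall>B\<in>borel_subsets \<Omega>. B \<subseteq> P \<longrightarrow> 0 \<le> \<mu> B}"
  have "{} \<in> PP"
    by (auto simp: PP_def)
  then have ne: "(\<lambda>P. ereal (\<mu> P)) ` PP \<noteq> {}"
    by blast
  \<comment> \<open>The supremum is taken in \<open>ereal\<close> because its finiteness becomes
    known only when \<open>D\<close> attains it.\<close>
  obtain f where f: "range f \<subseteq> (\<lambda>P. ereal (\<mu> P)) ` PP"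
      "Sup ((\<lambda>P. ereal (\<mu> P)) ` PP) = (SUP i::nat. f i)"
    using Sup_countable_SUP[OF ne] by blast
  then have "\<forall>i. \<exists>P. P \<in> PP \<and> f i = ereal (\<mu> P)"
    by auto
  then obtain P where P: "\<And>i. P i \<in> PP" "\<And>i. f i = ereal (\<mu> (P i))"
    by metis
  have Pb: "P i \<in> borel_subsets \<Omega>" for i
    using P by (auto simp: PP_def)
  define D where "D = (\<Union>i. P i)"
  have D: "D \<in> borel_subsets \<Omega>"
    unfolding D_def using Pb by auto
  have Dpos: "0 \<le> \<mu> B" if B: "B \<in> borel_subsets \<Omega>" "B \<subseteq> D" for B
  proof -
    have dP: "disjointed P i \<in> borel_subsets \<Omega>" "disjointed P i \<subseteq> P i" for i
      using range_disjointed_sets[of P] Pb disjointed_subset[of P i] by auto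
    have sums: "(\<lambda>i. \<mu> (B \<inter> disjointed P i)) sums \<mu> (\<Union>i. B \<inter> disjointed P i)"
    proof (rule sums_disjoint)
      show "disjoint_family (\<lambda>i. B \<inter> disjointed P i)"
        using disjoint_family_disjointed[of P] by (auto simp: disjoint_family_on_def)
    qed (use B dP in auto)
    have union: "(\<Union>i. B \<inter> disjointed P i) = B"
      using B by (simp add: D_def UN_disjointed_eq flip: Int_UN_distrib) blast
    have "0 \<le> \<mu> (B \<inter> disjointed P i)" for i
    proof -
      have "B \<inter> disjointed P i \<in> borel_subsets \<Omega>" "B \<inter> disjointed P i \<subseteq> P i"
        using B dP by auto
      then show ?thesis
        using P(1)[of i] by (auto simp: PP_def)
    qed
    then show ?thesis
      by (rule sums_le[OF _ sums_zero sums[unfolded union]])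
  qed
  have DP: "D \<in> PP"
    using D Dpos by (auto simp: PP_def)
  have max: "\<mu> Q \<le> \<mu> D" if "Q \<in> PP" for Q
  proof -
    have "\<mu> (P i) \<le> \<mu> D" for i
    proof -
      have "P i \<subseteq> D"
        by (auto simp: D_def)
      then show ?thesis
        using diff[OF D Pb[of i]] Dpos[of "D - P i"] D Pb[of i] by auto
    qed
    then have "Sup ((\<lambda>P. ereal (\<mu> P)) ` PP) \<le> ereal (\<mu> D)"
      unfolding f(2) P(2) by (intro SUP_least) auto
    then show ?thesis
      by (metis SUP_le_iff ereal_less_eq(3) that)
  qed
  have "\<mu> B \<le> 0" if B: "B \<in> borel_subsets \<Omega>" "B \<inter> D = {}" for B
  proof -
    obtain A where A: "A \<in> borel_subsets \<Omega>" "A \<subseteq> B" "\<mu> B \<le> \<mu> A"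
        "\<And>C. C \<in> borel_subsets \<Omega> \<Longrightarrow> C \<subseteq> A \<Longrightarrow> 0 \<le> \<mu> C"
      using exists_positive_subset[OF B(1)] by blast
    have "A \<union> D \<in> PP"
    proof -
      have "0 \<le> \<mu> C" if "C \<in> borel_subsets \<Omega>" "C \<subseteq> A \<union> D" for C
      proof -
        have "C - A \<subseteq> D" "C - A \<in> borel_subsets \<Omega>" "C \<inter> A \<in> borel_subsets \<Omega>"
          using that A(1) by auto
        then show ?thesis
          using split[OF that(1) A(1)] A(4)[of "C \<inter> A"] Dpos[of "C - A"] by simp
      qed
      then show ?thesis
        using A(1) D by (auto simp: PP_def)
    qed
    then have "\<mu> A + \<mu> D \<le> \<mu> D"
      using max[of "A \<union> D"] union[OF A(1) D] A(2) B(2) by (simp add: disjoint_iff subset_iff)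
    then show ?thesis
      using A(3) by simp
  qed
  then show ?thesis
    using D Dpos by blast
qed

definition pos_set :: "'a set" where
  "pos_set = (SOME D. D \<in> borel_subsets \<Omega> \<and> (\<forall>B\<in>borel_subsets \<Omega>. B \<subseteq> D \<longrightarrow> 0 \<le> \<mu> B)
     \<and> (\<forall>B\<in>borel_subsets \<Omega>. B \<inter> D = {} \<longrightarrow> \<mu> B \<le> 0))"

lemma pos_set: "pos_set \<in> borel_subsets \<Omega>"
    "B \<in> borel_subsets \<Omega> \<Longrightarrow> B \<subseteq> pos_set \<Longrightarrow> 0 \<le> \<mu> B"
    "B \<in> borel_subsets \<Omega> \<Longrightarrow> B \<inter> pos_set = {} \<Longrightarrow> \<mu> B \<le> 0"
proof -
  have "\<exists>D. D \<in> borel_subsets \<Omega> \<and> (\<forall>B\<in>borel_subsets \<Omega>. B \<subseteq> D \<longrightarrow> 0 \<le> \<mu> B)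
     \<and> (\<forall>B\<in>borel_subsets \<Omega>. B \<inter> D = {} \<longrightarrow> \<mu> B \<le> 0)"
    using Hahn_decomposition by blast
  from someI_ex[OF this]
  show "pos_set \<in> borel_subsets \<Omega>"
    "B \<in> borel_subsets \<Omega> \<Longrightarrow> B \<subseteq> pos_set \<Longrightarrow> 0 \<le> \<mu> B"
    "B \<in> borel_subsets \<Omega> \<Longrightarrow> B \<inter> pos_set = {} \<Longrightarrow> \<mu> B \<le> 0"
    unfolding pos_set_def by blast+
qed

lemma split_pos_set:
  "B \<in> borel_subsets \<Omega> \<Longrightarrow> \<mu> B = \<mu> (B \<inter> pos_set) + \<mu> (B - pos_set)"
  using split pos_set(1) by blast

lemma Int_pos_set_nonneg: "B \<in> borel_subsets \<Omega> \<Longrightarrow> 0 \<le> \<mu> (B \<inter> pos_set)"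
  using pos_set(1,2) by auto

lemma Diff_pos_set_nonpos: "B \<in> borel_subsets \<Omega> \<Longrightarrow> \<mu> (B - pos_set) \<le> 0"
  using pos_set(1,3) by auto

section \<open>Total variation and the Jordan parts\<close>

text \<open>Splitting \<open>B\<close> along \<open>pos_set\<close> (padded with empty sets by
  \<open>binaryset\<close>) attains the supremum; for any other partition, the triangle inequality
  on each piece gives the upper bound.\<close>

lemma total_variation_eq:
  assumes B: "B \<in> borel_subsets \<Omega>"
  shows "total_variation \<mu> B = ennreal (\<mu> (B \<inter> pos_set) - \<mu> (B - pos_set))"
proof (rule antisym)
  show "total_variation \<mu> B \<le> ennreal (\<mu> (B \<inter> pos_set) - \<mu> (B - pos_set))"
    unfolding total_variation_def
  proof (rule SUP_least)
    fix A :: "nat \<Rightarrow> 'a set"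
    assume "A \<in> {A. range A \<subseteq> sets borel \<and> disjoint_family A \<and> (\<Union>i. A i) = B}"
    then have A: "range A \<subseteq> borel_subsets \<Omega>" "disjoint_family A" "(\<Union>i. A i) = B"
      using B by (auto simp: borel_subsets_def)
    have Ai: "A i \<in> borel_subsets \<Omega>" for i
      using A by auto
    define t where "t i = \<mu> (A i \<inter> pos_set) - \<mu> (A i - pos_set)" for i
    have "(\<lambda>i. \<mu> (A i \<inter> pos_set)) sums \<mu> (\<Union>i. A i \<inter> pos_set)"
      using A(2) Ai pos_set(1) by (intro sums_disjoint) (auto simp: disjoint_family_on_def)
    moreover have "(\<lambda>i. \<mu> (A i - pos_set)) sums \<mu> (\<Union>i. A i - pos_set)"
      using A(2) Ai pos_set(1) by (intro sums_disjoint) (auto simp: disjoint_family_on_def)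
    moreover have "(\<Union>i. A i \<inter> pos_set) = B \<inter> pos_set" "(\<Union>i. A i - pos_set) = B - pos_set"
      using A(3) by auto
    ultimately have t: "t sums (\<mu> (B \<inter> pos_set) - \<mu> (B - pos_set))"
      unfolding t_def by (simp add: sums_diff)
    have bound: "\<bar>\<mu> (A i)\<bar> \<le> t i" for i
      using split_pos_set[OF Ai] Int_pos_set_nonneg[OF Ai] Diff_pos_set_nonpos[OF Ai]
      unfolding t_def by (smt (verit))
    then have t0: "0 \<le> t i" for i
      by (meson abs_ge_zero order_trans)
    have "(\<Sum>i. ennreal \<bar>\<mu> (A i)\<bar>) \<le> (\<Sum>i. ennreal (t i))"
      using bound by (intro suminf_le ennreal_leI) auto
    also have "\<dots> = ennreal (\<mu> (B \<inter> pos_set) - \<mu> (B - pos_set))"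
      using t t0 by (rule suminf_ennreal_eq[rotated])
    finally show "(\<Sum>i. ennreal \<bar>\<mu> (A i)\<bar>) \<le> ennreal (\<mu> (B \<inter> pos_set) - \<mu> (B - pos_set))" .
  qed
next
  let ?A = "binaryset (B \<inter> pos_set) (B - pos_set)"
  have D: "pos_set \<in> sets borel" "B \<in> sets borel"
    using pos_set(1) B by (auto simp: borel_subsets_def)
  have "(\<Sum>i. ennreal \<bar>\<mu> (?A i)\<bar>) = ennreal \<bar>\<mu> (B \<inter> pos_set)\<bar> + ennreal \<bar>\<mu> (B - pos_set)\<bar>"
    by (intro suminf_binaryset_eq) simp
  also have "\<dots> = ennreal (\<mu> (B \<inter> pos_set) - \<mu> (B - pos_set))"
    using Int_pos_set_nonneg[OF B] Diff_pos_set_nonpos[OF B] by (simp flip: ennreal_plus)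
  finally have "ennreal (\<mu> (B \<inter> pos_set) - \<mu> (B - pos_set)) = (\<Sum>i. ennreal \<bar>\<mu> (?A i)\<bar>)"
    by simp
  also have "\<dots> \<le> total_variation \<mu> B"
    unfolding total_variation_def
  proof (rule SUP_upper)
    show "?A \<in> {A. range A \<subseteq> sets borel \<and> disjoint_family A \<and> (\<Union>i. A i) = B}"
      using D by (auto simp: range_binaryset_eq UN_binaryset_eq disjoint_family_on_def binaryset_def)
  qed
  finally show "ennreal (\<mu> (B \<inter> pos_set) - \<mu> (B - pos_set)) \<le> total_variation \<mu> B" .
qed

lemma countably_additive_Int_pos_set:
  "countably_additive (borel_subsets \<Omega>) (\<lambda>B. ennreal (\<mu> (B \<inter> pos_set)))"
  unfolding countably_additive_def
proof (intro allI impI)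
  fix A :: "nat \<Rightarrow> 'a set"
  assume A: "range A \<subseteq> borel_subsets \<Omega>" "disjoint_family A"
  have "(\<lambda>i. \<mu> (A i \<inter> pos_set)) sums \<mu> (\<Union>i. A i \<inter> pos_set)"
    using A pos_set(1) by (intro sums_disjoint) (auto simp: disjoint_family_on_def)
  moreover have "0 \<le> \<mu> (A i \<inter> pos_set)" for i
    using A by (intro Int_pos_set_nonneg) auto
  ultimately have "(\<Sum>i. ennreal (\<mu> (A i \<inter> pos_set))) = ennreal (\<mu> (\<Union>i. A i \<inter> pos_set))"
    by (intro suminf_ennreal_eq) auto
  then show "(\<Sum>i. ennreal (\<mu> (A i \<inter> pos_set))) = ennreal (\<mu> ((\<Union>i. A i) \<inter> pos_set))"
    by (simp add: Int_UN_distrib2)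
qed

lemma countably_additive_Diff_pos_set:
  "countably_additive (borel_subsets \<Omega>) (\<lambda>B. ennreal (- \<mu> (B - pos_set)))"
  unfolding countably_additive_def
proof (intro allI impI)
  fix A :: "nat \<Rightarrow> 'a set"
  assume A: "range A \<subseteq> borel_subsets \<Omega>" "disjoint_family A"
  have "(\<lambda>i. \<mu> (A i - pos_set)) sums \<mu> (\<Union>i. A i - pos_set)"
    using A pos_set(1) by (intro sums_disjoint) (auto simp: disjoint_family_on_def)
  moreover have "0 \<le> - \<mu> (A i - pos_set)" for i
    using A Diff_pos_set_nonpos[of "A i"] by auto
  ultimately have "(\<Sum>i. ennreal (- \<mu> (A i - pos_set))) = ennreal (- \<mu> (\<Union>i. A i - pos_set))"
    by (intro suminf_ennreal_eq sums_minus) auto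
  then show "(\<Sum>i. ennreal (- \<mu> (A i - pos_set))) = ennreal (- \<mu> ((\<Union>i. A i) - pos_set))"
    by simp
qed

lemma
  shows space_positive_part: "space (positive_part \<Omega> \<mu>) = \<Omega>"
    and space_negative_part: "space (negative_part \<Omega> \<mu>) = \<Omega>"
    and sets_positive_part: "sets (positive_part \<Omega> \<mu>) = borel_subsets \<Omega>"
    and sets_negative_part: "sets (negative_part \<Omega> \<mu>) = borel_subsets \<Omega>"
  unfolding positive_part_def negative_part_def
  using space_closed by (simp_all add: space_measure_of sets_measure_of sigma_sets_eq)

text \<open>\<open>measure_of\<close> keeps the given set function only if it is countably additive.
  This becomes visible once the total variation formula reduces the defining expression to
  \<open>\<mu> (B \<inter> pos_set)\<close>.\<close>

lemma emeasure_positive_part: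
  assumes B: "B \<in> borel_subsets \<Omega>"
  shows "emeasure (positive_part \<Omega> \<mu>) B = ennreal (\<mu> (B \<inter> pos_set))"
proof -
  have *: "ennreal ((enn2real (total_variation \<mu> B) + \<mu> B) / 2) = ennreal (\<mu> (B \<inter> pos_set))"
    if "B \<in> borel_subsets \<Omega>" for B
    using split_pos_set[OF that] Int_pos_set_nonneg[OF that] Diff_pos_set_nonpos[OF that]
    by (simp add: total_variation_eq[OF that])
  have zero: "total_variation \<mu> {} = 0"
    by (simp add: total_variation_eq)
  have "countably_additive (borel_subsets \<Omega>)
      (\<lambda>B. ennreal ((enn2real (total_variation \<mu> B) + \<mu> B) / 2))"
    using countably_additive_Int_pos_set unfolding countably_additive_def
    by (auto simp: * image_subset_iff)
  then show ?thesis
    unfolding positive_part_def using B sigma_algebra_axioms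
    by (subst emeasure_measure_of_sigma) (auto simp: * zero positive_def)
qed

lemma emeasure_negative_part:
  assumes B: "B \<in> borel_subsets \<Omega>"
  shows "emeasure (negative_part \<Omega> \<mu>) B = ennreal (- \<mu> (B - pos_set))"
proof -
  have *: "ennreal ((enn2real (total_variation \<mu> B) - \<mu> B) / 2) = ennreal (- \<mu> (B - pos_set))"
    if "B \<in> borel_subsets \<Omega>" for B
    using split_pos_set[OF that] Int_pos_set_nonneg[OF that] Diff_pos_set_nonpos[OF that]
    by (simp add: total_variation_eq[OF that])
  have zero: "total_variation \<mu> {} = 0"
    by (simp add: total_variation_eq)
  have "countably_additive (borel_subsets \<Omega>)
      (\<lambda>B. ennreal ((enn2real (total_variation \<mu> B) - \<mu> B) / 2))"
    using countably_additive_Diff_pos_set unfolding countably_additive_def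
    by (auto simp: * image_subset_iff)
  then show ?thesis
    unfolding negative_part_def using B sigma_algebra_axioms
    by (subst emeasure_measure_of_sigma) (auto simp: * zero positive_def)
qed

lemma finite_measure_positive_part: "finite_measure (positive_part \<Omega> \<mu>)"
  by (rule finite_measureI) (simp add: space_positive_part emeasure_positive_part top)

lemma finite_measure_negative_part: "finite_measure (negative_part \<Omega> \<mu>)"
  by (rule finite_measureI) (simp add: space_negative_part emeasure_negative_part top)

lemma measure_positive_negative_part:
  assumes "B \<in> borel_subsets \<Omega>"
  shows "\<mu> B = measure (positive_part \<Omega> \<mu>) B - measure (negative_part \<Omega> \<mu>) B"
  using assms Int_pos_set_nonneg[OF assms] Diff_pos_set_nonpos[OF assms] split_pos_set[OF assms]
  by (simp add: measure_def emeasure_positive_part emeasure_negative_part)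

lemma total_variation_eq_sum:
  assumes "B \<in> borel_subsets \<Omega>"
  shows "total_variation \<mu> B = emeasure (positive_part \<Omega> \<mu>) B + emeasure (negative_part \<Omega> \<mu>) B"
  using assms Int_pos_set_nonneg[OF assms] Diff_pos_set_nonpos[OF assms]
  by (simp add: total_variation_eq emeasure_positive_part emeasure_negative_part flip: ennreal_plus)

end

section \<open>Integration against signed measures, independent of the decomposition\<close>

text \<open>Extended nonnegative integrals cannot be subtracted, so an identity between differences
  of measures is first rearranged into an identity between sums; finite families cover all cases
  that occur.\<close>

lemma nn_integral_sum_measures_cong:
  fixes M :: "'i \<Rightarrow> 'a measure" and N :: "'j \<Rightarrow> 'a measure" and f :: "'a \<Rightarrow> ennreal"
  assumes M: "\<And>i. i \<in> I \<Longrightarrow> sets (M i) = sets S" and N: "\<And>j. j \<in> J \<Longrightarrow> sets (N j) = sets S"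
    and eq: "\<And>A. A \<in> sets S \<Longrightarrow> (\<Sum>i\<in>I. emeasure (M i) A) = (\<Sum>j\<in>J. emeasure (N j) A)"
    and f: "f \<in> borel_measurable S"
  shows "(\<Sum>i\<in>I. \<integral>\<^sup>+x. f x \<partial>M i) = (\<Sum>j\<in>J. \<integral>\<^sup>+x. f x \<partial>N j)"
proof -
  have mM: "borel_measurable (M i) = (borel_measurable S :: ('a \<Rightarrow> ennreal) set)" if "i \<in> I" for i
    using M[OF that] by (intro measurable_cong_sets) auto
  have mN: "borel_measurable (N j) = (borel_measurable S :: ('a \<Rightarrow> ennreal) set)" if "j \<in> J" for j
    using N[OF that] by (intro measurable_cong_sets) auto
  have sM: "space (M i) = space S" if "i \<in> I" for i
    using M[OF that] by (rule sets_eq_imp_space_eq)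
  have sN: "space (N j) = space S" if "j \<in> J" for j
    using N[OF that] by (rule sets_eq_imp_space_eq)
  show ?thesis
    using f
  proof (induction rule: borel_measurable_induct)
    case (cong f g)
    have "(\<Sum>i\<in>I. \<integral>\<^sup>+x. f x \<partial>M i) = (\<Sum>i\<in>I. \<integral>\<^sup>+x. g x \<partial>M i)"
      and "(\<Sum>i\<in>J. \<integral>\<^sup>+x. f x \<partial>N i) = (\<Sum>i\<in>J. \<integral>\<^sup>+x. g x \<partial>N i)"
      using cong(3) by (auto intro!: sum.cong nn_integral_cong simp: sM sN)
    then show ?case
      using cong(4) by argo
  next
    case (set A)
    then show ?case
      using eq[of A] M N by (simp cong: sum.cong)
  next
    case (mult u c)
    then show ?case
      by (simp add: nn_integral_cmult mM mN flip: sum_distrib_left cong: sum.cong)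
  next
    case (add u v)
    then show ?case
      by (simp add: nn_integral_add mM mN sum.distrib cong: sum.cong)
  next
    case (seq U)
    have inc: "incseq (\<lambda>k. \<integral>\<^sup>+x. U k x \<partial>L)" for L
      using \<open>incseq U\<close> by (auto simp: incseq_def le_fun_def intro!: nn_integral_mono)
    have "(\<Sum>i\<in>I. \<integral>\<^sup>+x. (SUP k. U k) x \<partial>M i) = (\<Sum>i\<in>I. SUP k. \<integral>\<^sup>+x. U k x \<partial>M i)"
      using seq by (intro sum.cong refl) (simp add: mM image_comp nn_integral_monotone_convergence_SUP)
    also have "\<dots> = (SUP k. \<Sum>i\<in>I. \<integral>\<^sup>+x. U k x \<partial>M i)"
      using inc by (intro ennreal_SUP_sum[symmetric])
    also have "\<dots> = (SUP k. \<Sum>j\<in>J. \<integral>\<^sup>+x. U k x \<partial>N j)"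
      using seq by simp
    also have "\<dots> = (\<Sum>j\<in>J. SUP k. \<integral>\<^sup>+x. U k x \<partial>N j)"
      using inc by (intro ennreal_SUP_sum)
    also have "\<dots> = (\<Sum>j\<in>J. \<integral>\<^sup>+x. (SUP k. U k) x \<partial>N j)"
      using seq by (intro sum.cong refl) (simp add: mN image_comp nn_integral_monotone_convergence_SUP)
    finally show ?case .
  qed
qed

lemma integral_sum_measures_cong:
  fixes M :: "'i \<Rightarrow> 'a measure" and N :: "'j \<Rightarrow> 'a measure" and f :: "'a \<Rightarrow> real"
  assumes M: "\<And>i. i \<in> I \<Longrightarrow> sets (M i) = sets S" "\<And>i. i \<in> I \<Longrightarrow> finite_measure (M i)"
    and N: "\<And>j. j \<in> J \<Longrightarrow> sets (N j) = sets S" "\<And>j. j \<in> J \<Longrightarrow> finite_measure (N j)"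
    and eq: "\<And>A. A \<in> sets S \<Longrightarrow> (\<Sum>i\<in>I. measure (M i) A) = (\<Sum>j\<in>J. measure (N j) A)"
    and f: "f \<in> borel_measurable S" and bound: "\<And>x. \<bar>f x\<bar> \<le> C"
  shows "(\<Sum>i\<in>I. \<integral>x. f x \<partial>M i) = (\<Sum>j\<in>J. \<integral>x. f x \<partial>N j)"
proof -
  \<comment> \<open>Adding \<open>C\<close> makes the function nonnegative. The correction is
    \<open>C\<close> times the total masses, whose sums agree by \<open>eq\<close> on the whole
    space.\<close>
  define g where "g = (\<lambda>x. f x + C)"
  have g: "g \<in> borel_measurable S" "0 \<le> g x" "norm (g x) \<le> 2 * C" for x
    using f bound[of x] by (auto simp: g_def)
  have *: "integrable L f" "integrable L g" "(\<integral>x. g x \<partial>L) = (\<integral>x. f x \<partial>L) + C * measure L (space S)"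
      "ennreal (\<integral>x. g x \<partial>L) = (\<integral>\<^sup>+x. ennreal (g x) \<partial>L)" "0 \<le> (\<integral>x. g x \<partial>L)"
    if "sets L = sets S" "finite_measure L" for L
  proof -
    interpret finite_measure L by fact
    have m: "f \<in> borel_measurable L" "g \<in> borel_measurable L"
      using f g measurable_cong_sets[OF that(1) refl] by blast+
    show i: "integrable L f" "integrable L g"
      using m bound g(3) by (auto intro: integrable_const_bound[where B="2*C"] integrable_const_bound[where B=C])
    show "(\<integral>x. g x \<partial>L) = (\<integral>x. f x \<partial>L) + C * measure L (space S)"
      using i sets_eq_imp_space_eq[OF that(1)] by (simp add: g_def mult.commute)
    show "ennreal (\<integral>x. g x \<partial>L) = (\<integral>\<^sup>+x. ennreal (g x) \<partial>L)"
      using i g by (intro nn_integral_eq_integral[symmetric]) auto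
    show "0 \<le> (\<integral>x. g x \<partial>L)"
      using g by simp
  qed
  have "(\<Sum>i\<in>I. \<integral>\<^sup>+x. ennreal (g x) \<partial>M i) = (\<Sum>j\<in>J. \<integral>\<^sup>+x. ennreal (g x) \<partial>N j)"
  proof (rule nn_integral_sum_measures_cong[where S=S])
    fix A assume A: "A \<in> sets S"
    have "(\<Sum>i\<in>I. emeasure (M i) A) = ennreal (\<Sum>i\<in>I. measure (M i) A)"
      using M by (subst sum_ennreal[symmetric]) (auto simp: finite_measure.emeasure_eq_measure intro!: sum.cong)
    also have "\<dots> = ennreal (\<Sum>j\<in>J. measure (N j) A)"
      using eq[OF A] by simp
    also have "\<dots> = (\<Sum>j\<in>J. emeasure (N j) A)"
      using N by (subst sum_ennreal[symmetric]) (auto simp: finite_measure.emeasure_eq_measure intro!: sum.cong)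
    finally show "(\<Sum>i\<in>I. emeasure (M i) A) = (\<Sum>j\<in>J. emeasure (N j) A)" .
  qed (use M N g in auto)
  then have "ennreal (\<Sum>i\<in>I. \<integral>x. g x \<partial>M i) = ennreal (\<Sum>j\<in>J. \<integral>x. g x \<partial>N j)"
    using *(4,5) M N by (simp add: sum_ennreal[symmetric] cong: sum.cong)
  moreover have "0 \<le> (\<Sum>i\<in>I. \<integral>x. g x \<partial>M i)" "0 \<le> (\<Sum>j\<in>J. \<integral>x. g x \<partial>N j)"
    using *(5) M N by (auto intro: sum_nonneg)
  ultimately have "(\<Sum>i\<in>I. \<integral>x. g x \<partial>M i) = (\<Sum>j\<in>J. \<integral>x. g x \<partial>N j)"
    by simp
  then have "(\<Sum>i\<in>I. \<integral>x. f x \<partial>M i) + C * (\<Sum>i\<in>I. measure (M i) (space S)) =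
      (\<Sum>j\<in>J. \<integral>x. f x \<partial>N j) + C * (\<Sum>j\<in>J. measure (N j) (space S))"
    using *(3) M N by (simp add: sum.distrib sum_distrib_left cong: sum.cong)
  then show ?thesis
    using eq[OF sets.top] by simp
qed

lemma signed_measure_diff:
  assumes "signed_measure \<Omega> \<mu>" "signed_measure \<Omega> \<nu>"
  shows "signed_measure \<Omega> (\<lambda>B. \<mu> B - \<nu> B)"
  using assms unfolding signed_measure_def real_measure_def by (auto intro!: sums_diff)

lemma signed_measure_restrict:
  assumes "signed_measure \<Omega> \<mu>" "E \<in> sets borel"
  shows "signed_measure \<Omega> (restrict_real_measure E \<mu>)"
proof -
  interpret signed_measure \<Omega> \<mu> by fact
  have "(\<lambda>i. \<mu> (A i \<inter> E)) sums \<mu> ((\<Union>i. A i) \<inter> E)"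
    if "range A \<subseteq> borel_subsets \<Omega>" "disjoint_family A" for A :: "nat \<Rightarrow> _"
  proof -
    have "range (\<lambda>i. A i \<inter> E) \<subseteq> borel_subsets \<Omega>"
      using that(1) assms(2) by (auto simp: borel_subsets_def image_subset_iff)
    moreover have "disjoint_family (\<lambda>i. A i \<inter> E)"
      using that(2) by (auto simp: disjoint_family_on_def)
    ultimately have "(\<lambda>i. \<mu> (A i \<inter> E)) sums \<mu> (\<Union>i. A i \<inter> E)"
      by (rule sums_disjoint)
    then show ?thesis
      by (simp add: Int_UN_distrib2)
  qed
  then show ?thesis
    using borel_domain by unfold_locales (auto simp: real_measure_def restrict_real_measure_def)
qed

context signed_measure
begin

lemma sets_parts_eq:
  "sets (positive_part \<Omega> \<mu>) = sets (restrict_space borel \<Omega>)"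
  "sets (negative_part \<Omega> \<mu>) = sets (restrict_space borel \<Omega>)"
  by (simp_all add: sets_positive_part sets_negative_part borel_subsets_eq_sets borel_domain)

lemma measurable_parts:
  assumes "f \<in> borel_measurable borel"
  shows "f \<in> borel_measurable (positive_part \<Omega> \<mu>)" "f \<in> borel_measurable (negative_part \<Omega> \<mu>)"
  using measurable_restrict_space1[OF assms] measurable_cong_sets[OF sets_parts_eq(1) refl]
    measurable_cong_sets[OF sets_parts_eq(2) refl] by blast+

text \<open>\<open>M\<close> and \<open>N\<close> may overlap, so they need not be the Jordan parts.
  On sets, the positive part plus \<open>N\<close> equals the negative part plus \<open>M\<close>,
  and this sum identity passes to integrals. The Boolean index serves only to write the two-term
  sums.\<close>

lemma real_integral_eq:
  assumes M: "sets M = borel_subsets \<Omega>" "finite_measure M"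
    and N: "sets N = borel_subsets \<Omega>" "finite_measure N"
    and eq: "\<And>B. B \<in> borel_subsets \<Omega> \<Longrightarrow> \<mu> B = measure M B - measure N B"
    and f: "f \<in> borel_measurable borel" "\<And>x. \<bar>f x\<bar> \<le> C"
  shows "real_integral \<Omega> \<mu> f = (\<integral>x. f x \<partial>M) - (\<integral>x. f x \<partial>N)"
proof -
  have "(\<Sum>b\<in>UNIV. \<integral>x. f x \<partial>(if b then positive_part \<Omega> \<mu> else N)) =
      (\<Sum>b\<in>UNIV. \<integral>x. f x \<partial>(if b then negative_part \<Omega> \<mu> else M))"
  proof (rule integral_sum_measures_cong[where S="restrict_space borel \<Omega>" and C=C])
    fix A assume "A \<in> sets (restrict_space borel \<Omega>)"
    then have A: "A \<in> borel_subsets \<Omega>"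
      by (simp add: borel_subsets_eq_sets borel_domain)
    show "(\<Sum>b\<in>UNIV. measure (if b then positive_part \<Omega> \<mu> else N) A) =
        (\<Sum>b\<in>UNIV. measure (if b then negative_part \<Omega> \<mu> else M) A)"
      using eq[OF A] measure_positive_negative_part[OF A] by (simp add: UNIV_bool)
  qed (use f M N finite_measure_positive_part finite_measure_negative_part in
      \<open>auto simp: sets_parts_eq borel_subsets_eq_sets borel_domain intro: measurable_restrict_space1\<close>)
  then show ?thesis
    by (simp add: UNIV_bool real_integral_def)
qed

text \<open>Cutting both Jordan parts of \<open>\<mu>\<close> down to \<open>E\<close> by a density
  represents the restricted measure as a difference of finite measures, which is all that
  \<open>real_integral_eq\<close> asks for.\<close>

lemma real_integral_restrict:
  assumes E: "E \<in> sets borel" and f: "f \<in> borel_measurable borel" "\<And>x. \<bar>f x\<bar> \<le> C"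
  shows "real_integral \<Omega> (restrict_real_measure E \<mu>) f = real_integral \<Omega> \<mu> (\<lambda>x. indicator E x * f x)"
proof -
  interpret R: signed_measure \<Omega> "restrict_real_measure E \<mu>"
    by (rule signed_measure_restrict) (use E in \<open>auto intro: signed_measure_axioms\<close>)
  let ?M = "\<lambda>L. density L (\<lambda>x. ennreal (indicator E x))"
  have *: "finite_measure (?M L)" "(\<integral>x. f x \<partial>?M L) = (\<integral>x. indicator E x * f x \<partial>L)"
     "B \<in> borel_subsets \<Omega> \<Longrightarrow> measure (?M L) B = measure L (B \<inter> E)"
    if L: "sets L = sets (restrict_space borel \<Omega>)" "finite_measure L" for L B
  proof -
    have L': "sets L = borel_subsets \<Omega>" "space L = \<Omega>"
      using L borel_domain sets_eq_imp_space_eq[OF L(1)] by (simp_all add: borel_subsets_eq_sets space_restrict_space)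
    have mL: "g \<in> borel_measurable L" if "g \<in> borel_measurable borel" for g :: "'a \<Rightarrow> real"
      using measurable_restrict_space1[OF that] measurable_cong_sets[OF L(1) refl] by blast
    have iE: "(indicator E :: _ \<Rightarrow> real) \<in> borel_measurable L"
      using E by (intro mL) auto
    have e: "emeasure (?M L) B = emeasure L (B \<inter> E)" if "B \<in> borel_subsets \<Omega>" for B
    proof -
      have BE: "B \<inter> E \<in> sets L"
        using that E L' by (auto simp: borel_subsets_def)
      have "emeasure (?M L) B = (\<integral>\<^sup>+x. ennreal (indicator E x) * indicator B x \<partial>L)"
        using that iE L' by (intro emeasure_density) auto
      also have "\<dots> = (\<integral>\<^sup>+x. indicator (B \<inter> E) x \<partial>L)"
        by (intro nn_integral_cong) (auto simp: indicator_def)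
      finally show ?thesis
        using BE by simp
    qed
    show "finite_measure (?M L)"
    proof (rule finite_measureI)
      have "emeasure (?M L) \<Omega> = emeasure L (\<Omega> \<inter> E)"
        by (rule e) simp
      then show "emeasure (?M L) (space (?M L)) \<noteq> \<infinity>"
        using L(2) L' finite_measure.emeasure_finite[OF L(2)] by simp
    qed
    show "(\<integral>x. f x \<partial>?M L) = (\<integral>x. indicator E x * f x \<partial>L)"
      using mL[OF f(1)] iE by (subst integral_density) auto
    show "measure (?M L) B = measure L (B \<inter> E)" if "B \<in> borel_subsets \<Omega>"
      using e[OF that] by (simp add: measure_def)
  qed
  note P = *[OF sets_parts_eq(1) finite_measure_positive_part]
  note N = *[OF sets_parts_eq(2) finite_measure_negative_part]
  have "real_integral \<Omega> (restrict_real_measure E \<mu>) f =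
      (\<integral>x. f x \<partial>?M (positive_part \<Omega> \<mu>)) - (\<integral>x. f x \<partial>?M (negative_part \<Omega> \<mu>))"
  proof (rule R.real_integral_eq[where C=C])
    fix B assume B: "B \<in> borel_subsets \<Omega>"
    then have "B \<inter> E \<in> borel_subsets \<Omega>"
      using E by (auto simp: borel_subsets_def)
    then show "restrict_real_measure E \<mu> B =
        measure (?M (positive_part \<Omega> \<mu>)) B - measure (?M (negative_part \<Omega> \<mu>)) B"
      using P(3)[OF B] N(3)[OF B] measure_positive_negative_part
      by (simp add: restrict_real_measure_def)
  qed (use P N f in \<open>auto simp: sets_positive_part sets_negative_part\<close>)
  then show ?thesis
    using P(2) N(2) by (simp add: real_integral_def)
qed

lemma real_integral_diff_measure:
  assumes \<nu>: "signed_measure \<Omega> \<nu>" and f: "f \<in> borel_measurable borel" "\<And>x. \<bar>f x\<bar> \<le> C"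
  shows "real_integral \<Omega> (\<lambda>B. \<mu> B - \<nu> B) f = real_integral \<Omega> \<mu> f - real_integral \<Omega> \<nu> f"
proof -
  interpret N: signed_measure \<Omega> \<nu> by fact
  interpret D: signed_measure \<Omega> "\<lambda>B. \<mu> B - \<nu> B"
    using signed_measure_axioms \<nu> by (rule signed_measure_diff)
  let ?\<kappa> = "\<lambda>B. \<mu> B - \<nu> B"
  \<comment> \<open>The set identity between the three pairs of Jordan parts is sorted so that every
    part occurs with a plus sign, three on each side.\<close>
  define M where "M i = (if i = 0 then positive_part \<Omega> ?\<kappa> else if i = 1 then negative_part \<Omega> \<mu>
    else positive_part \<Omega> \<nu>)" for i :: nat
  define L where "L i = (if i = 0 then negative_part \<Omega> ?\<kappa> else if i = 1 then positive_part \<Omega> \<mu>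
    else negative_part \<Omega> \<nu>)" for i :: nat
  have "(\<Sum>i<3. \<integral>x. f x \<partial>M i) = (\<Sum>i<3. \<integral>x. f x \<partial>L i)"
  proof (rule integral_sum_measures_cong[where S="restrict_space borel \<Omega>" and C=C])
    fix A assume "A \<in> sets (restrict_space borel \<Omega>)"
    then have A: "A \<in> borel_subsets \<Omega>"
      by (simp add: borel_subsets_eq_sets borel_domain)
    show "(\<Sum>i<3. measure (M i) A) = (\<Sum>i<3. measure (L i) A)"
      using measure_positive_negative_part[OF A] N.measure_positive_negative_part[OF A]
        D.measure_positive_negative_part[OF A]
      by (simp add: M_def L_def numeral_3_eq_3)
  qed (use f finite_measure_positive_part finite_measure_negative_part
      N.finite_measure_positive_part N.finite_measure_negative_part
      D.finite_measure_positive_part D.finite_measure_negative_part in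
      \<open>auto simp: M_def L_def sets_parts_eq N.sets_parts_eq D.sets_parts_eq intro: measurable_restrict_space1\<close>)
  then show ?thesis
    by (simp add: M_def L_def numeral_3_eq_3 real_integral_def)
qed

lemma real_integral_LIMSEQ:
  assumes f: "\<And>j. f j \<in> borel_measurable borel" "\<And>j x. \<bar>f j x\<bar> \<le> C"
    and g: "g \<in> borel_measurable borel" and lim: "\<And>x. x \<in> \<Omega> \<Longrightarrow> (\<lambda>j. f j x) \<longlonglongrightarrow> g x"
  shows "(\<lambda>j::nat. real_integral \<Omega> \<mu> (f j)) \<longlonglongrightarrow> real_integral \<Omega> \<mu> g"
proof -
  interpret P: finite_measure "positive_part \<Omega> \<mu>" by (rule finite_measure_positive_part)
  interpret N: finite_measure "negative_part \<Omega> \<mu>" by (rule finite_measure_negative_part)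
  show ?thesis
    unfolding real_integral_def
  proof (rule tendsto_diff)
    show "(\<lambda>j. \<integral>x. f j x \<partial>positive_part \<Omega> \<mu>) \<longlonglongrightarrow> (\<integral>x. g x \<partial>positive_part \<Omega> \<mu>)"
    proof (rule integral_dominated_convergence[where w="\<lambda>x. C"])
      show "AE x in positive_part \<Omega> \<mu>. (\<lambda>j. f j x) \<longlonglongrightarrow> g x"
        using lim by (intro AE_I2) (simp add: space_positive_part)
    qed (simp_all add: measurable_parts f g)
    show "(\<lambda>j. \<integral>x. f j x \<partial>negative_part \<Omega> \<mu>) \<longlonglongrightarrow> (\<integral>x. g x \<partial>negative_part \<Omega> \<mu>)"
    proof (rule integral_dominated_convergence[where w="\<lambda>x. C"])
      show "AE x in negative_part \<Omega> \<mu>. (\<lambda>j. f j x) \<longlonglongrightarrow> g x"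
        using lim by (intro AE_I2) (simp add: space_negative_part)
    qed (simp_all add: measurable_parts f g)
  qed
qed

section \<open>Sets on which a signed measure vanishes\<close>

lemma real_integral_indicator:
  assumes "B \<in> borel_subsets \<Omega>"
  shows "real_integral \<Omega> \<mu> (indicator B) = \<mu> B"
  using assms measure_positive_negative_part[OF assms]
  by (simp add: real_integral_def space_positive_part space_negative_part Int_absorb2 borel_subsets_def)

text \<open>Positive and negative mass might cancel in a compact set. Hence inner regularity is
  applied separately inside and outside \<open>pos_set\<close>, where the signed mass of a compact
  set is, up to sign, its mass under one Jordan part.\<close>

lemma total_variation_zero_if_compact_zero:
  assumes B: "B \<in> borel_subsets \<Omega>"
    and zero: "\<And>K. compact K \<Longrightarrow> K \<subseteq> B \<Longrightarrow> \<mu> K = 0"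
  shows "total_variation \<mu> B = 0"
proof -
  have *: "emeasure L C = 0"
    if L: "sets L = borel_subsets \<Omega>" "finite_measure L" and C: "C \<in> borel_subsets \<Omega>" "C \<subseteq> B"
      and K0: "\<And>K. compact K \<Longrightarrow> K \<subseteq> C \<Longrightarrow> emeasure L K = 0" for L C
  proof -
    \<comment> \<open>The measure is pushed to the whole space because \<open>inner_regular\<close>
      speaks about measures on all Borel sets.\<close>
    let ?L = "distr L borel (\<lambda>x. x)"
    have space: "space L = \<Omega>"
      using sets_eq_imp_space_eq[of L "restrict_space borel \<Omega>"] L borel_domain
      by (simp add: borel_subsets_eq_sets space_restrict_space)
    have meas: "(\<lambda>x. x) \<in> measurable L borel"
      using L(1) space borel_domain by (intro measurableI) (auto simp: borel_subsets_def)
    have e: "emeasure ?L A = emeasure L A" if "A \<in> borel_subsets \<Omega>" for A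
      using that meas by (subst emeasure_distr) (auto simp: space borel_subsets_def Int_absorb2)
    have "emeasure ?L C = (SUP K \<in> {K. K \<subseteq> C \<and> compact K}. emeasure ?L K)"
    proof (rule inner_regular)
      show "emeasure ?L (space ?L) \<noteq> \<infinity>"
        using finite_measure.emeasure_finite[OF finite_measure.finite_measure_distr[OF L(2) meas]] by simp
    qed (use C in \<open>auto simp: borel_subsets_def\<close>)
    also have "\<dots> \<le> 0"
    proof (rule SUP_least)
      fix K assume "K \<in> {K. K \<subseteq> C \<and> compact K}"
      then have "compact K" "K \<subseteq> C" "K \<in> borel_subsets \<Omega>"
        using C by (auto simp: borel_subsets_def intro: borel_compact)
      then show "emeasure ?L K \<le> 0"
        using K0 e by simp
    qed
    finally show ?thesis
      using e[OF C(1)] by simp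
  qed
  have K: "K \<in> borel_subsets \<Omega>" if "compact K" "K \<subseteq> B" for K
    using that B by (auto simp: borel_subsets_def intro: borel_compact)
  have "emeasure (positive_part \<Omega> \<mu>) (B \<inter> pos_set) = 0"
  proof (rule *)
    fix K assume "compact K" "K \<subseteq> B \<inter> pos_set"
    then show "emeasure (positive_part \<Omega> \<mu>) K = 0"
      using K[of K] zero[of K] by (simp add: emeasure_positive_part Int_absorb2)
  qed (use B pos_set finite_measure_positive_part sets_positive_part in auto)
  moreover have "emeasure (negative_part \<Omega> \<mu>) (B - pos_set) = 0"
  proof (rule *)
    fix K assume *: "compact K" "K \<subseteq> B - pos_set"
    then have "K - pos_set = K"
      by auto
    moreover have "K \<subseteq> B"
      using * by auto
    ultimately show "emeasure (negative_part \<Omega> \<mu>) K = 0"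
      using * K[of K] zero[of K] by (simp add: emeasure_negative_part)
  qed (use B pos_set finite_measure_negative_part sets_negative_part in auto)
  moreover have "B \<inter> pos_set \<in> borel_subsets \<Omega>" "B - pos_set \<in> borel_subsets \<Omega>"
    "B - pos_set - pos_set = B - pos_set"
    using B pos_set(1) by auto
  ultimately show ?thesis
    using B by (simp add: total_variation_eq_sum emeasure_positive_part emeasure_negative_part)
qed

lemma total_variation_mono_zero:
  assumes "A \<in> borel_subsets \<Omega>" "B \<in> borel_subsets \<Omega>" "A \<subseteq> B" "total_variation \<mu> B = 0"
  shows "total_variation \<mu> A = 0"
proof -
  have "emeasure (positive_part \<Omega> \<mu>) A \<le> emeasure (positive_part \<Omega> \<mu>) B"
    "emeasure (negative_part \<Omega> \<mu>) A \<le> emeasure (negative_part \<Omega> \<mu>) B"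
    using assms by (auto intro!: emeasure_mono simp: sets_positive_part sets_negative_part)
  then show ?thesis
    using assms by (simp add: total_variation_eq_sum)
qed

lemma total_variation_UN_zero:
  assumes "range A \<subseteq> borel_subsets \<Omega>" "\<And>i::nat. total_variation \<mu> (A i) = 0"
  shows "total_variation \<mu> (\<Union>i. A i) = 0"
proof -
  have A: "A i \<in> borel_subsets \<Omega>" for i
    using assms by auto
  have "emeasure (positive_part \<Omega> \<mu>) (A i) = 0" "emeasure (negative_part \<Omega> \<mu>) (A i) = 0" for i
    using assms(2)[of i] A by (auto simp: total_variation_eq_sum)
  then have "emeasure (positive_part \<Omega> \<mu>) (\<Union>i. A i) = 0" "emeasure (negative_part \<Omega> \<mu>) (\<Union>i. A i) = 0"
    using assms(1) by (auto intro!: emeasure_UN_eq_0 simp: sets_positive_part sets_negative_part)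
  then show ?thesis
    using assms(1) by (subst total_variation_eq_sum) auto
qed

lemma measure_zero_if_total_variation_zero:
  assumes "B \<in> borel_subsets \<Omega>" "total_variation \<mu> B = 0"
  shows "\<mu> B = 0"
  using assms measure_positive_negative_part[OF assms(1)]
  by (simp add: total_variation_eq_sum measure_def)

end

section \<open>Rademacher's theorem\<close>

lemma gderiv_unique:
  assumes "GDERIV f x :> D" "GDERIV f x :> D'"
  shows "D = D'"
proof -
  have "(\<lambda>h. h \<bullet> D) = (\<lambda>h. h \<bullet> D')"
    using assms unfolding gderiv_def by (rule has_derivative_unique)
  then show ?thesis
    by (metis vector_eq_ldot)
qed

lemma grad_eqI: "GDERIV f x :> D \<Longrightarrow> grad f x = D"
  unfolding grad_def using gderiv_unique by (metis the_equality)

lemma null_sets_lborel_iff_negligible: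
  "A \<in> sets borel \<Longrightarrow> A \<in> null_sets lborel \<longleftrightarrow> negligible A"
  by (simp add: negligible_iff_null_sets null_sets_completion_iff)

lemma Lipschitz_right_quotients_convergent_1d:
  fixes f :: "real \<Rightarrow> real"
  assumes lip: "L-lipschitz_on UNIV f"
  shows "\<exists>N. negligible N \<and>
    (\<forall>t. t \<notin> N \<longrightarrow> convergent (\<lambda>k. real (Suc k) * (f (t + inverse (real (Suc k))) - f t)))"
proof -
  have f: "\<bar>f s - f t\<bar> \<le> L * \<bar>s - t\<bar>" for s t
    using lipschitz_onD[OF lip, of s t] by (simp add: dist_real_def)
  have "0 \<le> L"
    using lip by (rule lipschitz_on_nonneg)
  \<comment> \<open>Slope \<open>L + 1\<close> outweighs the steepest descent of \<open>f\<close> by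
    1, so \<open>\<psi>\<close> expands distances and its inverse \<open>\<eta>\<close> is
    1-Lipschitz.\<close>
  define \<psi> where "\<psi> t = f t + (L + 1) * t" for t
  have \<psi>_ge: "t - s \<le> \<psi> t - \<psi> s" if "s \<le> t" for s t
    using f[of t s] that by (simp add: \<psi>_def algebra_simps)
  have \<psi>_less: "\<psi> s < \<psi> t \<longleftrightarrow> s < t" for s t
    using \<psi>_ge[of s t] \<psi>_ge[of t s] by linarith
  have \<psi>_le: "\<psi> s \<le> \<psi> t \<longleftrightarrow> s \<le> t" for s t
    using \<psi>_less[of t s] by linarith
  have \<psi>_lip: "\<bar>\<psi> s - \<psi> t\<bar> \<le> (2 * L + 1) * \<bar>s - t\<bar>" for s t
  proof -
    have "\<psi> s - \<psi> t = (f s - f t) + (L + 1) * (s - t)"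
      by (simp add: \<psi>_def algebra_simps)
    then have "\<bar>\<psi> s - \<psi> t\<bar> \<le> \<bar>f s - f t\<bar> + (L + 1) * \<bar>s - t\<bar>"
      using \<open>0 \<le> L\<close> by (metis abs_mult abs_of_nonneg abs_triangle_ineq add_nonneg_nonneg zero_le_one)
    then show ?thesis
      using f[of s t] by (simp add: algebra_simps)
  qed
  have cont: "continuous_on S \<psi>" for S
    unfolding \<psi>_def using lipschitz_on_continuous_on[OF lip]
    by (intro continuous_intros) (auto intro: continuous_on_subset)
  have "\<exists>t. \<psi> t = y" for y
  proof -
    let ?r = "\<bar>y - \<psi> 0\<bar>"
    have "\<psi> (- ?r) \<le> y" "y \<le> \<psi> ?r"
      using \<psi>_ge[of "- ?r" 0] \<psi>_ge[of 0 ?r] by auto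
    then show ?thesis
      using IVT'[of \<psi> "- ?r" y ?r] cont by auto
  qed
  then obtain \<eta> where \<eta>: "\<psi> (\<eta> y) = y" for y
    by metis
  have \<eta>\<psi>: "\<eta> (\<psi> t) = t" for t
    using \<eta>[of "\<psi> t"] \<psi>_le[of "\<eta> (\<psi> t)" t] \<psi>_le[of t "\<eta> (\<psi> t)"] by auto
  have "\<bar>\<eta> a - \<eta> b\<bar> \<le> \<bar>a - b\<bar>" for a b
    using \<psi>_ge[of "\<eta> a" "\<eta> b"] \<psi>_ge[of "\<eta> b" "\<eta> a"] \<eta>[of a] \<eta>[of b] by linarith
  then have "1-lipschitz_on UNIV \<eta>"
    by (auto intro!: lipschitz_onI simp: dist_real_def)
  then have "continuous_on UNIV \<eta>"
    by (rule lipschitz_on_continuous_on)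
  then have \<eta>_meas [measurable]: "\<eta> \<in> borel_measurable borel"
    by (rule borel_measurable_continuous_onI)
  \<comment> \<open>Pushing Lebesgue measure forward by the inverse \<open>\<eta>\<close> measures a
    set by its image under \<open>\<psi>\<close>. Lipschitz maps preserve null sets, which gives
    absolute continuity.\<close>
  define M where "M = distr lborel borel \<eta>"
  have M: "emeasure M A = emeasure lborel (\<psi> ` A)" if "A \<in> sets borel" for A
  proof -
    have "\<eta> -` A = \<psi> ` A"
      using \<eta> \<eta>\<psi> by (auto simp: image_iff) metis
    then show ?thesis
      using that by (simp add: M_def emeasure_distr)
  qed
  have "absolutely_continuous lborel M"
    unfolding absolutely_continuous_def
  proof
    fix A :: "real set" assume A: "A \<in> null_sets lborel"
    then have Ab: "A \<in> sets borel"
      by auto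
    have "negligible (\<psi> ` A)"
    proof (rule negligible_locally_Lipschitz_image)
      show "negligible A"
        using A Ab by (simp add: null_sets_lborel_iff_negligible)
      show "\<exists>T B. open T \<and> x \<in> T \<and> (\<forall>y\<in>A \<inter> T. norm (\<psi> y - \<psi> x) \<le> B * norm (y - x))" for x
        using \<psi>_lip by (intro exI[of _ UNIV] exI[of _ "2 * L + 1"]) auto
    qed simp
    moreover have "\<psi> ` A = \<eta> -` A"
      using \<eta> \<eta>\<psi> by (auto simp: image_iff) metis
    moreover have "\<eta> -` A \<in> sets borel"
      using measurable_sets[OF \<eta>_meas Ab] by simp
    ultimately have "\<psi> ` A \<in> null_sets lborel"
      by (simp add: null_sets_lborel_iff_negligible)
    then show "A \<in> null_sets M"
      using M[OF Ab] Ab by (auto simp: null_sets_def M_def)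
  qed
  then obtain h where h [measurable]: "h \<in> borel_measurable borel" and hM: "density lborel h = M"
    using sigma_finite_measure.Radon_Nikodym[OF sigma_finite_lborel, of M] by (auto simp: M_def)
  \<comment> \<open>The density may be infinite on a null set; \<open>enn2real\<close> alters it
    only there.\<close>
  define g where "g = (\<lambda>t. enn2real (h t))"
  have g: "(g has_integral (\<psi> b - \<psi> a)) {a..b}" if "a \<le> b" for a b
  proof -
    have "\<psi> ` {a..b} = {\<psi> a..\<psi> b}"
      using \<psi>_le \<eta> by (auto simp: image_iff) (metis atLeastAtMost_iff)
    then have "(\<integral>\<^sup>+t. h t * indicator {a..b} t \<partial>lborel) = ennreal (\<psi> b - \<psi> a)"
      using M[of "{a..b}"] that \<psi>_le[of a b] by (simp add: emeasure_density flip: hM)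
    moreover have "AE t in lborel. h t * indicator {a..b} t \<noteq> \<infinity>"
      using calculation by (intro nn_integral_PInf_AE) auto
    then have "AE t in lborel. h t * indicator {a..b} t = ennreal (indicator {a..b} t * g t)"
      by eventually_elim (auto simp: g_def indicator_def less_top)
    then have "(\<integral>\<^sup>+t. h t * indicator {a..b} t \<partial>lborel) = (\<integral>\<^sup>+t. ennreal (indicator {a..b} t * g t) \<partial>lborel)"
      by (rule nn_integral_cong_AE)
    ultimately have "(\<integral>\<^sup>+t. ennreal (indicator {a..b} t * g t) \<partial>lborel) = ennreal (\<psi> b - \<psi> a)"
      by simp
    then have "((\<lambda>t. indicator {a..b} t * g t) has_integral (\<psi> b - \<psi> a)) UNIV"
      using \<psi>_le[of a b] that by (intro nn_integral_has_integral) (auto simp: g_def)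
    moreover have "(\<lambda>t. indicator {a..b} t * g t) = (\<lambda>t. if t \<in> {a..b} then g t else 0)"
      by (auto simp: indicator_def)
    ultimately show ?thesis
      by (simp only: has_integral_restrict_UNIV)
  qed
  have gi: "g integrable_on cbox a b" for a b
    using g[of a b] by (cases "a \<le> b") (auto simp: integrable_on_def)
  \<comment> \<open>This is Lebesgue differentiation over boxes with lower corner t, the reason why
    right quotients are used throughout.\<close>
  obtain N where N: "negligible N" "\<And>t e. \<lbrakk>t \<notin> N; 0 < e\<rbrakk> \<Longrightarrow> \<exists>d>0. \<forall>h. 0 < h \<and> h < d \<longrightarrow>
      norm (integral (cbox t (t + h *\<^sub>R One)) g /\<^sub>R h ^ DIM(real) - g t) < e"
    using integrable_ccontinuous_explicit[of g] gi by blast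
  have "(\<lambda>k. real (Suc k) * (f (t + inverse (real (Suc k))) - f t)) \<longlonglongrightarrow> g t - (L + 1)" if t: "t \<notin> N" for t
  proof (rule LIMSEQ_I)
    fix e :: real assume "0 < e"
    obtain d where d: "d > 0" "\<And>h. 0 < h \<Longrightarrow> h < d \<Longrightarrow> norm (integral (cbox t (t + h *\<^sub>R One)) g /\<^sub>R h ^ DIM(real) - g t) < e"
      using N(2)[OF t \<open>0 < e\<close>] by blast
    obtain k0 where k0: "inverse (real (Suc k0)) < d"
      using reals_Archimedean[OF d(1)] by blast
    have "norm (real (Suc k) * (f (t + inverse (real (Suc k))) - f t) - (g t - (L + 1))) < e" if "k0 \<le> k" for k
    proof -
      define h where "h = inverse (real (Suc k))"
      have "0 < h"
        by (simp add: h_def)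
      have "h \<le> inverse (real (Suc k0))"
        using that by (simp add: h_def)
      then have "h < d"
        using k0 by linarith
      have "integral (cbox t (t + h *\<^sub>R One)) g = \<psi> (t + h) - \<psi> t"
        using g[of t "t + h"] \<open>0 < h\<close> by (simp add: integral_unique)
      then have "\<bar>(\<psi> (t + h) - \<psi> t) / h - g t\<bar> < e"
        using d(2)[OF \<open>0 < h\<close> \<open>h < d\<close>] by (simp add: divide_inverse mult.commute)
      moreover have "(\<psi> (t + h) - \<psi> t) / h = real (Suc k) * (f (t + h) - f t) + (L + 1)"
        using \<open>0 < h\<close> by (simp add: \<psi>_def h_def field_simps)
      ultimately show ?thesis
        by (simp add: h_def)
    qed
    then show "\<exists>k0. \<forall>k\<ge>k0. norm (real (Suc k) * (f (t + inverse (real (Suc k))) - f t) - (g t - (L + 1))) < e"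
      by blast
  qed
  then show ?thesis
    using N(1) by (intro exI[of _ N]) (auto simp: convergent_def)
qed

section \<open>Directional derivatives of Lipschitz functions in several variables\<close>

text \<open>Restricting the steps to 1/(k+1) makes the limit a limit of a sequence of Borel
  functions. For Lipschitz functions nothing is lost, by \<open>LIMSEQ_imp_has_ddir\<close>.\<close>

definition dquot :: "('a::euclidean_space \<Rightarrow> real) \<Rightarrow> 'a \<Rightarrow> nat \<Rightarrow> 'a \<Rightarrow> real" where
  "dquot \<phi> v k x = real (Suc k) * (\<phi> (x + inverse (real (Suc k)) *\<^sub>R v) - \<phi> x)"

text \<open>The default value 0 keeps this, for Lipschitz \<open>\<phi>\<close>, Borel measurable
  and bounded at every point, also where the quotients diverge.\<close>

definition ddir :: "('a::euclidean_space \<Rightarrow> real) \<Rightarrow> 'a \<Rightarrow> 'a \<Rightarrow> real" where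
  "ddir \<phi> v x = (if Cauchy (\<lambda>k. dquot \<phi> v k x) then lim (\<lambda>k. dquot \<phi> v k x) else 0)"

definition has_ddir :: "('a::euclidean_space \<Rightarrow> real) \<Rightarrow> 'a \<Rightarrow> real \<Rightarrow> 'a \<Rightarrow> bool" where
  "has_ddir \<phi> v d x \<longleftrightarrow> (\<forall>e>0. \<exists>\<delta>>0. \<forall>t. 0 < t \<and> t < \<delta> \<longrightarrow> \<bar>\<phi> (x + t *\<^sub>R v) - \<phi> x - t * d\<bar> \<le> e * t)"

lemma has_ddir_scaleR:
  assumes "has_ddir \<phi> v d x" "c > 0"
  shows "has_ddir \<phi> (c *\<^sub>R v) (c * d) x"
  unfolding has_ddir_def
proof (intro allI impI)
  fix e :: real assume "0 < e"
  then have "0 < e / c"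
    using assms by simp
  then obtain \<delta> where \<delta>: "\<delta> > 0"
      "\<And>t. 0 < t \<Longrightarrow> t < \<delta> \<Longrightarrow> \<bar>\<phi> (x + t *\<^sub>R v) - \<phi> x - t * d\<bar> \<le> e / c * t"
    using assms(1) unfolding has_ddir_def by blast
  have "\<bar>\<phi> (x + t *\<^sub>R c *\<^sub>R v) - \<phi> x - t * (c * d)\<bar> \<le> e * t" if "0 < t" "t < \<delta> / c" for t
    using \<delta>(2)[of "t * c"] that assms(2) by (simp add: field_simps)
  then show "\<exists>\<delta>>0. \<forall>t. 0 < t \<and> t < \<delta> \<longrightarrow> \<bar>\<phi> (x + t *\<^sub>R c *\<^sub>R v) - \<phi> x - t * (c * d)\<bar> \<le> e * t"
    using \<delta>(1) assms(2) by (intro exI[of _ "\<delta> / c"]) auto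
qed

lemma has_ddir_zero: "has_ddir \<phi> 0 0 x"
  unfolding has_ddir_def by (auto intro!: exI[of _ 1])

lemma has_ddir_unique:
  assumes "has_ddir \<phi> v d x" "has_ddir \<phi> v d' x"
  shows "d = d'"
proof (rule ccontr)
  assume "d \<noteq> d'"
  then have e: "0 < \<bar>d - d'\<bar> / 4"
    by simp
  obtain \<delta> where \<delta>: "\<delta> > 0" "\<And>t. 0 < t \<Longrightarrow> t < \<delta> \<Longrightarrow> \<bar>\<phi> (x + t *\<^sub>R v) - \<phi> x - t * d\<bar> \<le> \<bar>d - d'\<bar> / 4 * t"
    using assms(1) e unfolding has_ddir_def by blast
  obtain \<delta>' where \<delta>': "\<delta>' > 0" "\<And>t. 0 < t \<Longrightarrow> t < \<delta>' \<Longrightarrow> \<bar>\<phi> (x + t *\<^sub>R v) - \<phi> x - t * d'\<bar> \<le> \<bar>d - d'\<bar> / 4 * t"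
    using assms(2) e unfolding has_ddir_def by blast
  define t where "t = min \<delta> \<delta>' / 2"
  have t: "0 < t" "t < \<delta>" "t < \<delta>'"
    using \<delta>(1) \<delta>'(1) by (auto simp: t_def)
  have "\<bar>t * d - t * d'\<bar> \<le> 2 * (\<bar>d - d'\<bar> / 4 * t)"
    using \<delta>(2)[OF t(1,2)] \<delta>'(2)[OF t(1,3)] by linarith
  moreover have "\<bar>t * d - t * d'\<bar> = t * \<bar>d - d'\<bar>"
    using t(1) by (simp add: abs_mult flip: right_diff_distrib)
  ultimately have "t * \<bar>d - d'\<bar> \<le> t * \<bar>d - d'\<bar> / 2"
    by (simp add: mult.commute)
  then show False
    using t(1) \<open>d \<noteq> d'\<close> by simp
qed

lemma has_ddir_imp_LIMSEQ:
  assumes "has_ddir \<phi> v d x"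
  shows "(\<lambda>k. dquot \<phi> v k x) \<longlonglongrightarrow> d"
proof (rule LIMSEQ_I)
  fix e :: real assume "0 < e"
  then have "0 < e / 2" by simp
  then obtain \<delta> where \<delta>: "\<delta> > 0" "\<And>t. 0 < t \<Longrightarrow> t < \<delta> \<Longrightarrow> \<bar>\<phi> (x + t *\<^sub>R v) - \<phi> x - t * d\<bar> \<le> e / 2 * t"
    using assms unfolding has_ddir_def by blast
  obtain k0 where k0: "inverse (real (Suc k0)) < \<delta>"
    using reals_Archimedean[OF \<delta>(1)] by blast
  have "norm (dquot \<phi> v k x - d) < e" if "k0 \<le> k" for k
  proof -
    define h where "h = inverse (real (Suc k))"
    have "0 < h"
      by (simp add: h_def)
    have "h \<le> inverse (real (Suc k0))"
      using that by (simp add: h_def)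
    then have "\<bar>\<phi> (x + h *\<^sub>R v) - \<phi> x - h * d\<bar> \<le> e / 2 * h"
      using k0 \<delta>(2)[OF \<open>0 < h\<close>] by linarith
    moreover have "dquot \<phi> v k x - d = (\<phi> (x + h *\<^sub>R v) - \<phi> x - h * d) / h"
      by (simp add: dquot_def h_def field_simps)
    ultimately have "\<bar>dquot \<phi> v k x - d\<bar> \<le> e / 2"
      using \<open>0 < h\<close> by (simp add: abs_divide pos_divide_le_eq)
    then show ?thesis
      using \<open>0 < e\<close> by simp
  qed
  then show "\<exists>k0. \<forall>k\<ge>k0. norm (dquot \<phi> v k x - d) < e"
    by blast
qed

locale Lipschitz_function =
  fixes \<phi> :: "'a::euclidean_space \<Rightarrow> real" and L :: real
  assumes lipschitz: "L-lipschitz_on UNIV \<phi>"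
begin

lemma L_nonneg: "0 \<le> L"
  using lipschitz by (rule lipschitz_on_nonneg)

lemma lip: "\<bar>\<phi> x - \<phi> y\<bar> \<le> L * norm (x - y)"
  using lipschitz_onD[OF lipschitz, of x y] by (simp add: dist_norm)

lemma continuous: "continuous_on S \<phi>"
  using lipschitz_on_continuous_on[OF lipschitz] continuous_on_subset by blast

lemma measurable [measurable]: "\<phi> \<in> borel_measurable borel"
  by (rule borel_measurable_continuous_onI[OF continuous])

lemma dquot_measurable [measurable]: "dquot \<phi> v k \<in> borel_measurable borel"
  unfolding dquot_def[abs_def] by measurable

lemma dquot_bound: "\<bar>dquot \<phi> v k x\<bar> \<le> L * norm v"
proof -
  have "\<bar>\<phi> (x + inverse (real (Suc k)) *\<^sub>R v) - \<phi> x\<bar> \<le> L * (inverse (real (Suc k)) * norm v)"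
    using lip[of "x + inverse (real (Suc k)) *\<^sub>R v" x] by simp
  then show ?thesis
    unfolding dquot_def abs_mult by (simp add: field_simps)
qed

text \<open>Let s be the least reciprocal of a positive integer with t \<le> s. Then s - t < s t is
  of second order, so the Lipschitz bound makes the change from t to s negligible compared with
  t.\<close>

lemma LIMSEQ_imp_has_ddir:
  assumes "(\<lambda>k. dquot \<phi> v k x) \<longlonglongrightarrow> d"
  shows "has_ddir \<phi> v d x"
  unfolding has_ddir_def
proof (intro allI impI)
  fix e :: real assume "0 < e"
  define C where "C = L * norm v + \<bar>d\<bar> + 1"
  have "0 < C"
    using L_nonneg by (simp add: C_def add_nonneg_pos)
  obtain k0 where k0: "\<And>k. k0 \<le> k \<Longrightarrow> \<bar>dquot \<phi> v k x - d\<bar> < e / 4"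
    using LIMSEQ_D[OF assms, of "e / 4"] \<open>0 < e\<close> by auto
  \<comment> \<open>The first bound forces the floor of 1/t to be at least \<open>k0 + 2\<close>, so
    the index \<open>k\<close> below is at least \<open>k0\<close>; the second gives t C <
    e/4.\<close>
  define \<delta> where "\<delta> = min (inverse (real (k0 + 2))) (e / (4 * C))"
  have "0 < \<delta>"
    using \<open>0 < e\<close> \<open>0 < C\<close> by (simp add: \<delta>_def)
  have "\<bar>\<phi> (x + t *\<^sub>R v) - \<phi> x - t * d\<bar> \<le> e * t" if t: "0 < t" "t < \<delta>" for t
  proof -
    have t1: "t < inverse (real (k0 + 2))" "t < e / (4 * C)"
      using t by (auto simp: \<delta>_def)
    have big: "real (k0 + 2) < 1 / t"
      using t1(1) t(1) by (simp add: field_simps)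
    define k where "k = nat \<lfloor>1 / t\<rfloor> - 1"
    have fl: "real_of_int \<lfloor>1 / t\<rfloor> \<le> 1 / t" "1 / t < real_of_int \<lfloor>1 / t\<rfloor> + 1"
      by linarith+
    have "int (k0 + 2) \<le> \<lfloor>1 / t\<rfloor>"
      using big by (simp add: le_floor_iff)
    then have k: "k0 \<le> k" "real (Suc k) = real_of_int \<lfloor>1 / t\<rfloor>"
      unfolding k_def by auto
    define s where "s = inverse (real (Suc k))"
    have s0: "0 < s"
      by (simp add: s_def)
    have "t \<le> s"
      using le_imp_inverse_le[of "real (Suc k)" "1 / t"] fl(1) k(2) t(1) by (simp add: s_def)
    have "1 / t < 1 / s + 1"
      using fl(2) k(2) by (simp add: s_def inverse_eq_divide)
    then have st: "s < t + s * t"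
      using t(1) s0 by (simp add: field_simps)
    have "s \<le> 1"
      by (simp add: s_def inverse_le_1_iff)
    then have "s * t \<le> t"
      using t(1) by simp
    then have s2: "s < 2 * t"
      using st by linarith
    have d1: "\<bar>\<phi> (x + s *\<^sub>R v) - \<phi> x - s * d\<bar> \<le> s * (e / 4)"
    proof -
      have "\<phi> (x + s *\<^sub>R v) - \<phi> x - s * d = s * (dquot \<phi> v k x - d)"
        by (simp add: dquot_def s_def field_simps)
      then show ?thesis
        using k0[OF k(1)] s0 by (simp add: abs_mult)
    qed
    have "\<bar>\<phi> (x + t *\<^sub>R v) - \<phi> (x + s *\<^sub>R v)\<bar> \<le> L * norm ((t - s) *\<^sub>R v)"
      using lip[of "x + t *\<^sub>R v" "x + s *\<^sub>R v"] by (simp add: algebra_simps)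
    then have d2: "\<bar>\<phi> (x + t *\<^sub>R v) - \<phi> (x + s *\<^sub>R v)\<bar> \<le> (s - t) * (L * norm v)"
      using \<open>t \<le> s\<close> by (simp add: mult_ac)
    have d3: "\<bar>s * d - t * d\<bar> \<le> (s - t) * \<bar>d\<bar>"
      using \<open>t \<le> s\<close> by (simp add: abs_mult flip: left_diff_distrib)
    have "(s - t) * (L * norm v) + (s - t) * \<bar>d\<bar> \<le> (s - t) * C"
      using \<open>t \<le> s\<close> by (simp add: C_def algebra_simps)
    also have "\<dots> \<le> (s * t) * C"
      using st \<open>0 < C\<close> by (intro mult_right_mono) auto
    also have "\<dots> \<le> s * (e / 4)"
      using t1(2) s0 \<open>0 < C\<close> by (simp add: field_simps)
    finally have "\<bar>\<phi> (x + t *\<^sub>R v) - \<phi> x - t * d\<bar> \<le> s * (e / 4) + s * (e / 4)"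
      using d1 d2 d3 by linarith
    also have "\<dots> = s * (e / 2)"
      by simp
    also have "\<dots> \<le> (2 * t) * (e / 2)"
      using s2 \<open>0 < e\<close> by (intro mult_right_mono) auto
    finally show ?thesis
      by (simp add: mult.commute)
  qed
  then show "\<exists>\<delta>>0. \<forall>t. 0 < t \<and> t < \<delta> \<longrightarrow> \<bar>\<phi> (x + t *\<^sub>R v) - \<phi> x - t * d\<bar> \<le> e * t"
    using \<open>0 < \<delta>\<close> by blast
qed

lemma ddir_measurable [measurable]: "ddir \<phi> v \<in> borel_measurable borel"
proof -
  have "{x \<in> space borel. Cauchy (\<lambda>k. dquot \<phi> v k x)} \<in> sets borel"
    by (rule sets_Collect_Cauchy) simp
  then have "Measurable.pred borel (\<lambda>x. Cauchy (\<lambda>k. dquot \<phi> v k x))"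
    by (simp add: pred_def)
  then show ?thesis
    unfolding ddir_def[abs_def] by (intro measurable_If borel_measurable_lim_metric) (auto simp: pred_def)
qed

lemma ddir_bound: "\<bar>ddir \<phi> v x\<bar> \<le> L * norm v"
proof (cases "Cauchy (\<lambda>k. dquot \<phi> v k x)")
  case True
  then have "(\<lambda>k. dquot \<phi> v k x) \<longlonglongrightarrow> ddir \<phi> v x"
    by (simp add: ddir_def Cauchy_convergent_iff convergent_LIMSEQ_iff)
  then have "(\<lambda>k. \<bar>dquot \<phi> v k x\<bar>) \<longlonglongrightarrow> \<bar>ddir \<phi> v x\<bar>"
    by (rule tendsto_rabs)
  then show ?thesis
    by (rule LIMSEQ_le_const2) (use dquot_bound in auto)
qed (use L_nonneg in \<open>simp add: ddir_def\<close>)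

text \<open>Every line in direction \<open>v\<close> meets the bad set in a null set of parameters,
  by the one-dimensional result. No coordinates adapted to \<open>v\<close> are introduced: the bad
  set is averaged over its translates by t v with t in [0,1], which reproduces its measure by
  translation invariance, and Fubini then gives 0.\<close>

lemma AE_has_ddir: "AE x in lborel. has_ddir \<phi> v (ddir \<phi> v x) x"
proof -
  let ?N = "{x. \<not> Cauchy (\<lambda>k. dquot \<phi> v k x)}"
  have "{x \<in> space borel. Cauchy (\<lambda>k. dquot \<phi> v k x)} \<in> sets borel"
    by (rule sets_Collect_Cauchy) simp
  then have "UNIV - {x. Cauchy (\<lambda>k. dquot \<phi> v k x)} \<in> sets borel"
    by auto
  moreover have "UNIV - {x. Cauchy (\<lambda>k. dquot \<phi> v k x)} = ?N"
    by auto
  ultimately have N [measurable]: "?N \<in> sets borel"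
    by simp
  have inner: "(\<integral>\<^sup>+t. indicator {0..1::real} t * indicator ?N (x + t *\<^sub>R v) \<partial>lborel) = 0" for x
  proof -
    define f where "f t = \<phi> (x + t *\<^sub>R v)" for t
    have "(L * norm v)-lipschitz_on UNIV f"
    proof (rule lipschitz_onI)
      show "dist (f s) (f t) \<le> L * norm v * dist s t" for s t
        using lip[of "x + s *\<^sub>R v" "x + t *\<^sub>R v"]
        by (simp add: f_def dist_real_def mult_ac flip: scaleR_diff_left)
    qed (use L_nonneg in simp)
    then obtain S where S: "negligible S"
        "\<And>t. t \<notin> S \<Longrightarrow> convergent (\<lambda>k. real (Suc k) * (f (t + inverse (real (Suc k))) - f t))"
      using Lipschitz_right_quotients_convergent_1d by blast
    have "AE t in lebesgue. t \<notin> S"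
      using S(1) by (simp add: negligible_iff_null_sets AE_not_in)
    then have "AE t in lborel. t \<notin> S"
      by (simp add: AE_completion_iff)
    then have "AE t in lborel. indicator {0..1::real} t * indicator ?N (x + t *\<^sub>R v) = (0::ennreal)"
    proof eventually_elim
      case (elim t)
      have "real (Suc k) * (f (t + inverse (real (Suc k))) - f t) = dquot \<phi> v k (x + t *\<^sub>R v)" for k
        by (simp add: f_def dquot_def algebra_simps)
      then have "Cauchy (\<lambda>k. dquot \<phi> v k (x + t *\<^sub>R v))"
        using S(2)[OF elim] by (simp add: Cauchy_convergent_iff)
      then show ?case
        by simp
    qed
    from nn_integral_cong_AE[OF this] show ?thesis
      by simp
  qed
  have shift: "(\<integral>\<^sup>+x. indicator ?N (x + t *\<^sub>R v) \<partial>lborel) = emeasure lborel ?N" for t :: real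
  proof -
    have "emeasure lborel ?N = (\<integral>\<^sup>+x. indicator ?N x \<partial>distr lborel borel ((+) (t *\<^sub>R v)))"
      by (simp add: lborel_distr_plus)
    also have "\<dots> = (\<integral>\<^sup>+x. indicator ?N (x + t *\<^sub>R v) \<partial>lborel)"
      by (subst nn_integral_distr) (auto simp: add.commute)
    finally show ?thesis ..
  qed
  have "emeasure lborel ?N = (\<integral>\<^sup>+t. indicator {0..1::real} t * emeasure lborel ?N \<partial>lborel)"
    by (simp add: nn_integral_multc)
  also have "\<dots> = (\<integral>\<^sup>+t. (\<integral>\<^sup>+x. indicator {0..1::real} t * indicator ?N (x + t *\<^sub>R v) \<partial>lborel) \<partial>lborel)"
    by (subst nn_integral_cmult) (auto simp: shift)
  also have "\<dots> = (\<integral>\<^sup>+x. (\<integral>\<^sup>+t. indicator {0..1::real} t * indicator ?N (x + t *\<^sub>R v) \<partial>lborel) \<partial>lborel)"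
    using lborel_pair.Fubini'[of "\<lambda>t x. indicator {0..1::real} t * indicator ?N (x + t *\<^sub>R v)"] by simp
  also have "\<dots> = 0"
    by (simp add: inner)
  finally have "?N \<in> null_sets lborel"
    using N by (simp add: null_sets_def)
  then have "AE x in lborel. x \<notin> ?N"
    by (rule AE_not_in)
  then show ?thesis
  proof eventually_elim
    case (elim x)
    then have "(\<lambda>k. dquot \<phi> v k x) \<longlonglongrightarrow> ddir \<phi> v x"
      by (simp add: ddir_def Cauchy_convergent_iff convergent_LIMSEQ_iff)
    then show ?case
      by (rule LIMSEQ_imp_has_ddir)
  qed
qed

text \<open>The vanishing shift \<open>w k\<close> is what the change of variables in
  \<open>ddir_add_AE\<close> leaves on the box. Indicators of shifted boxes converge off the
  frontier, a null set, and the quotients are bounded by L |v|.\<close>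

lemma integral_dquot_LIMSEQ:
  assumes w: "bounded (range w)" "w \<longlonglongrightarrow> 0"
  shows "(\<lambda>k. \<integral>x. indicator (cbox a b) (x - w k) * dquot \<phi> v k x \<partial>lborel)
    \<longlonglongrightarrow> (\<integral>x. indicator (cbox a b) x * ddir \<phi> v x \<partial>lborel)"
proof -
  obtain W where W: "\<And>k. norm (w k) \<le> W"
    using w(1) unfolding bounded_iff by auto
  obtain R where R: "cbox a b \<subseteq> cball 0 R"
    using bounded_cbox[of a b] by (auto simp: bounded_iff subset_iff)
  show ?thesis
  proof (rule integral_dominated_convergence[where w="\<lambda>x. indicator (cball 0 (R + W)) x * (L * norm v)"])
    show "integrable lborel (\<lambda>x. indicator (cball 0 (R + W)) x * (L * norm v))"
      using emeasure_lborel_cball_finite by (intro integrable_mult_left integrable_real_indicator) (auto simp: less_top)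
    have "AE x in lborel. x \<notin> frontier (cbox a b)"
    proof (rule AE_not_in)
      show "frontier (cbox a b) \<in> null_sets lborel"
        by (simp add: null_sets_lborel_iff_negligible negligible_convex_frontier)
    qed
    then show "AE x in lborel. (\<lambda>k. indicator (cbox a b) (x - w k) * dquot \<phi> v k x)
        \<longlonglongrightarrow> indicator (cbox a b) x * ddir \<phi> v x"
      using AE_has_ddir[of v]
    proof eventually_elim
      case (elim x)
      have lim: "(\<lambda>k. x - w k) \<longlonglongrightarrow> x"
        using tendsto_diff[OF tendsto_const w(2), of x] by simp
      have "\<forall>\<^sub>F k in sequentially. indicator (cbox a b) (x - w k) = (indicator (cbox a b) x :: real)"
      proof (cases "x \<in> cbox a b")
        case True
        then have "x \<in> interior (cbox a b)"
          using elim(1) by (simp add: frontier_def)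
        then have "\<forall>\<^sub>F k in sequentially. x - w k \<in> interior (cbox a b)"
          using topological_tendstoD[OF lim open_interior] by blast
        then show ?thesis
          by eventually_elim (use True box_subset_cbox[of a b] in \<open>auto simp: indicator_def\<close>)
      next
        case False
        then have "\<forall>\<^sub>F k in sequentially. x - w k \<in> - cbox a b"
          using topological_tendstoD[OF lim, of "- cbox a b"] by (simp add: open_Compl closed_cbox)
        then show ?thesis
          by eventually_elim (use False in \<open>auto simp: indicator_def\<close>)
      qed
      then have "(\<lambda>k. indicator (cbox a b) (x - w k) :: real) \<longlonglongrightarrow> indicator (cbox a b) x"
        by (rule tendsto_eventually)
      then show ?case
        using has_ddir_imp_LIMSEQ[OF elim(2)] by (rule tendsto_mult)
    qed
    show "AE x in lborel. norm (indicator (cbox a b) (x - w k) * dquot \<phi> v k x)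
        \<le> indicator (cball 0 (R + W)) x * (L * norm v)" for k
    proof (rule AE_I2)
      fix x
      show "norm (indicator (cbox a b) (x - w k) * dquot \<phi> v k x) \<le> indicator (cball 0 (R + W)) x * (L * norm v)"
      proof (cases "x - w k \<in> cbox a b")
        case True
        then have "norm (x - w k) \<le> R"
          using R by auto
        then have "norm x \<le> R + W"
          using W[of k] norm_triangle_ineq[of "x - w k" "w k"] by simp
        then show ?thesis
          using True dquot_bound by simp
      qed (use L_nonneg in \<open>simp add: indicator_def\<close>)
    qed
  qed (auto intro!: borel_measurable_times measurable_compose[OF _ borel_measurable_indicator])
qed

text \<open>The quotient for \<open>v + w\<close> at x is the quotient for \<open>w\<close> at x
  plus the quotient for \<open>v\<close> at x moved by w/(k+1). The move is not controlled
  pointwise, but after integration over a box it becomes a shift of the box. Equality of all box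
  integrals then gives equality almost everywhere by Lebesgue differentiation.\<close>

lemma ddir_add_AE: "AE x in lborel. ddir \<phi> (v + w) x = ddir \<phi> v x + ddir \<phi> w x"
proof -
  let ?w = "\<lambda>k. inverse (real (Suc k)) *\<^sub>R w"
  have w: "?w \<longlonglongrightarrow> 0"
    using tendsto_scaleR[OF LIMSEQ_inverse_real_of_nat tendsto_const, of w] by simp
  then have bw: "bounded (range ?w)"
    using convergent_imp_bounded by blast
  have z: "bounded (range (\<lambda>k::nat. 0::'a))" "(\<lambda>k::nat. 0::'a) \<longlonglongrightarrow> 0"
    by auto
  have int: "integrable lborel (\<lambda>x. indicator (cbox a b) (x - u) * f x)"
    if f: "f \<in> borel_measurable borel" "\<And>x. \<bar>f x\<bar> \<le> C" for a b u :: 'a and f :: "'a \<Rightarrow> real" and C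
  proof (rule Bochner_Integration.integrable_bound)
    show "integrable lborel (\<lambda>x. indicator (cbox (a + u) (b + u)) x * C)"
      using emeasure_lborel_cbox_finite by (intro integrable_mult_left integrable_real_indicator) (auto simp: less_top)
    have "x - u \<in> cbox a b \<longleftrightarrow> x \<in> cbox (a + u) (b + u)" for x
      by (auto simp: mem_box algebra_simps)
    then show "AE x in lborel. norm (indicator (cbox a b) (x - u) * f x) \<le> norm (indicator (cbox (a + u) (b + u)) x * C)"
      using f(2) abs_ge_self by (intro AE_I2) (auto simp: indicator_def intro: order_trans)
  qed (use f in \<open>auto intro!: borel_measurable_times measurable_compose[OF _ borel_measurable_indicator]\<close>)
  have box: "(\<integral>x. indicator (cbox a b) x * ddir \<phi> (v + w) x \<partial>lborel) =
      (\<integral>x. indicator (cbox a b) x * ddir \<phi> v x \<partial>lborel) + (\<integral>x. indicator (cbox a b) x * ddir \<phi> w x \<partial>lborel)" for a b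
  proof (rule LIMSEQ_unique)
    have "(\<integral>x. indicator (cbox a b) (x - 0) * dquot \<phi> (v + w) k x \<partial>lborel) =
        (\<integral>x. indicator (cbox a b) (x - ?w k) * dquot \<phi> v k x \<partial>lborel)
        + (\<integral>x. indicator (cbox a b) (x - 0) * dquot \<phi> w k x \<partial>lborel)" for k
    proof -
      let ?f = "\<lambda>x. indicator (cbox a b) (x - ?w k) * dquot \<phi> v k x"
      have m: "?f \<in> borel_measurable borel"
        by (auto intro!: borel_measurable_times measurable_compose[OF _ borel_measurable_indicator])
      have "(\<integral>x. ?f x \<partial>lborel) = (\<integral>x. ?f x \<partial>distr lborel borel ((+) (?w k)))"
        by (simp add: lborel_distr_plus)
      also have "\<dots> = (\<integral>x. ?f (?w k + x) \<partial>lborel)"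
        using m by (subst integral_distr) auto
      finally have 1: "(\<integral>x. ?f x \<partial>lborel) = (\<integral>x. ?f (?w k + x) \<partial>lborel)" .
      have "integrable lborel ?f"
        using dquot_bound by (intro int) auto
      then have "integrable (distr lborel borel ((+) (?w k))) ?f"
        by (simp add: lborel_distr_plus)
      then have 2: "integrable lborel (\<lambda>x. ?f (?w k + x))"
        using m by (subst (asm) integrable_distr_eq) auto
      have 3: "integrable lborel (\<lambda>x. indicator (cbox a b) (x - 0) * dquot \<phi> w k x)"
        using dquot_bound by (intro int) auto
      have "indicator (cbox a b) (x - 0) * dquot \<phi> (v + w) k x = ?f (?w k + x) + indicator (cbox a b) (x - 0) * dquot \<phi> w k x" for x
        by (simp add: dquot_def algebra_simps)
      then show ?thesis
        unfolding 1 using Bochner_Integration.integral_add[OF 2 3] by simp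
    qed
    then show "(\<lambda>k. \<integral>x. indicator (cbox a b) (x - 0) * dquot \<phi> (v + w) k x \<partial>lborel) \<longlonglongrightarrow>
      (\<integral>x. indicator (cbox a b) x * ddir \<phi> v x \<partial>lborel) + (\<integral>x. indicator (cbox a b) x * ddir \<phi> w x \<partial>lborel)"
      using tendsto_add[OF integral_dquot_LIMSEQ[OF bw w, of a b v] integral_dquot_LIMSEQ[OF z, of a b w]]
      by (simp only:)
    show "(\<lambda>k. \<integral>x. indicator (cbox a b) (x - 0) * dquot \<phi> (v + w) k x \<partial>lborel) \<longlonglongrightarrow>
      (\<integral>x. indicator (cbox a b) x * ddir \<phi> (v + w) x \<partial>lborel)"
      by (rule integral_dquot_LIMSEQ[OF z])
  qed
  define f where "f = (\<lambda>x. ddir \<phi> (v + w) x - (ddir \<phi> v x + ddir \<phi> w x))"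
  have int': "integrable lborel (\<lambda>x. indicator (cbox a b) x * ddir \<phi> u x)" for a b u
    using int[OF ddir_measurable ddir_bound, of a b 0 u] by simp
  have f: "integrable lborel (\<lambda>x. indicator (cbox a b) x * f x)"
    "(\<integral>x. indicator (cbox a b) x * f x \<partial>lborel) = 0" for a b
    using int' box[of a b] by (simp_all add: f_def right_diff_distrib distrib_left)
  have hi: "(f has_integral 0) (cbox a b)" for a b
  proof -
    have "((\<lambda>x. indicator (cbox a b) x * f x) has_integral 0) UNIV"
      using has_integral_integral_lborel[OF f(1)] f(2) by metis
    moreover have "(\<lambda>x. indicator (cbox a b) x * f x) = (\<lambda>x. if x \<in> cbox a b then f x else 0)"
      by (auto simp: indicator_def)
    ultimately show ?thesis
      by (simp only: has_integral_restrict_UNIV)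
  qed
  obtain N where N: "negligible N" "\<And>t e. \<lbrakk>t \<notin> N; 0 < e\<rbrakk> \<Longrightarrow> \<exists>d>0. \<forall>h. 0 < h \<and> h < d \<longrightarrow>
      norm (integral (cbox t (t + h *\<^sub>R One)) f /\<^sub>R h ^ DIM('a) - f t) < e"
    using integrable_ccontinuous_explicit[of f] hi by blast
  have "f x = 0" if x: "x \<notin> N" for x
  proof (rule ccontr)
    assume "f x \<noteq> 0"
    then obtain d where "d > 0" and d: "\<And>h. 0 < h \<Longrightarrow> h < d \<Longrightarrow>
        norm (integral (cbox x (x + h *\<^sub>R One)) f /\<^sub>R h ^ DIM('a) - f x) < norm (f x)"
      using N(2)[OF x, of "norm (f x)"] by auto
    then show False
      using d[of "d / 2"] integral_unique[OF hi] by simp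
  qed
  moreover have "AE x in lebesgue. x \<notin> N"
    using N(1) by (simp add: negligible_iff_null_sets AE_not_in)
  then have "AE x in lborel. x \<notin> N"
    by (simp add: AE_completion_iff)
  ultimately show ?thesis
    by (auto simp: f_def elim!: eventually_mono)
qed

end

section \<open>The gradient and total differentiability almost everywhere\<close>

context Lipschitz_function
begin

text \<open>A version of \<open>grad \<phi>\<close> that is Borel measurable and bounded at every
  point; all Fubini and limit arguments use it.\<close>

definition gradient :: "'a \<Rightarrow> 'a" where
  "gradient x = (\<Sum>i\<in>Basis. ddir \<phi> i x *\<^sub>R i)"

lemma gradient_measurable [measurable]: "gradient \<in> borel_measurable borel"
  unfolding gradient_def[abs_def] by measurable

lemma norm_gradient_le: "norm (gradient x) \<le> real DIM('a) * L"
proof -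
  have "norm (gradient x) \<le> (\<Sum>i\<in>(Basis :: 'a set). norm (ddir \<phi> i x *\<^sub>R i))"
    unfolding gradient_def by (rule norm_sum)
  also have "\<dots> \<le> (\<Sum>i\<in>(Basis :: 'a set). L)"
  proof (rule sum_mono)
    show "norm (ddir \<phi> i x *\<^sub>R i) \<le> L" if "i \<in> Basis" for i
      using ddir_bound[of i x] that by simp
  qed
  finally show ?thesis
    by simp
qed

lemma AE_has_ddir_inner_gradient: "AE x in lborel. has_ddir \<phi> v (v \<bullet> gradient x) x"
proof -
  let ?Q = "\<lambda>v. AE x in lborel. has_ddir \<phi> v (v \<bullet> gradient x) x"
  have add: "?Q (v + w)" if "?Q v" "?Q w" for v w
    using that ddir_add_AE[of v w] AE_has_ddir[of v] AE_has_ddir[of w] AE_has_ddir[of "v + w"]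
    by eventually_elim (metis has_ddir_unique inner_add_left)
  have scale: "?Q (c *\<^sub>R v)" if "?Q v" "0 < c" for c v
    using that(1) by eventually_elim (use has_ddir_scaleR[OF _ that(2)] in auto)
  have zero: "?Q 0"
    by (simp add: has_ddir_zero)
  \<comment> \<open>\<open>has_ddir\<close> is one-sided, so scaling reaches positive multiples
    only. The direction \<open>- v\<close> comes from additivity, because \<open>v + - v\<close> has
    derivative 0.\<close>
  have minus: "?Q (- v)" if "?Q v" for v
    using that ddir_add_AE[of v "- v"] AE_has_ddir[of v] AE_has_ddir[of "- v"] AE_has_ddir[of "v + - v"]
  proof eventually_elim
    case (elim x)
    have "ddir \<phi> v x = v \<bullet> gradient x"
      using has_ddir_unique elim(1,3) by blast
    moreover have "ddir \<phi> (v + - v) x = 0"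
      using has_ddir_unique[OF elim(5)] has_ddir_zero[of \<phi> x] by simp
    ultimately have "ddir \<phi> (- v) x = - v \<bullet> gradient x"
      using elim(2) by simp
    then show ?case
      using elim(4) by simp
  qed
  have basis: "?Q i" if "i \<in> Basis" for i
    using AE_has_ddir[of i] by eventually_elim (use that in \<open>simp add: gradient_def inner_sum_right inner_Basis if_distrib cong: if_cong\<close>)
  have basis_scale: "?Q (c *\<^sub>R i)" if "i \<in> Basis" for c i
  proof -
    consider "c > 0" | "c = 0" | "c < 0" by linarith
    then show ?thesis
    proof cases
      case 3
      then show ?thesis
        using minus[OF scale[OF basis[OF that], of "- c"]] by simp
    qed (use scale[OF basis[OF that]] zero in auto)
  qed
  have "?Q (\<Sum>i\<in>B. (v \<bullet> i) *\<^sub>R i)" if "finite B" "B \<subseteq> Basis" for B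
    using that
  proof (induction B rule: finite_induct)
    case empty
    show ?case
      using zero by (simp only: sum.empty)
  next
    case (insert i B)
    then have "i \<in> Basis" "?Q (\<Sum>i\<in>B. (v \<bullet> i) *\<^sub>R i)"
      by blast+
    from add[OF basis_scale[OF this(1), of "v \<bullet> i"] this(2)] show ?case
      by (simp only: sum.insert[OF insert.hyps])
  qed
  from this[of Basis] show ?thesis
    by (simp add: euclidean_representation)
qed

text \<open>Off one null set, a countable dense set of directions is good. Compactness of the unit
  sphere picks finitely many of them, so one \<open>\<delta>\<close> serves all; replacing a
  direction u by a chosen v costs at most t |u - v| (L + |gradient|) by the Lipschitz bound.\<close>

theorem Rademacher: "AE x in lborel. GDERIV \<phi> x :> gradient x"
proof -
  obtain D :: "'a set" where D: "countable D" "\<And>X. open X \<Longrightarrow> X \<noteq> {} \<Longrightarrow> \<exists>d\<in>D. d \<in> X"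
    using countable_dense_exists by metis
  have "AE x in lborel. \<forall>v\<in>D. has_ddir \<phi> v (v \<bullet> gradient x) x"
    using D(1) AE_has_ddir_inner_gradient by (simp add: AE_ball_countable)
  then show ?thesis
  proof eventually_elim
    case (elim x)
    let ?g = "gradient x"
    have "\<exists>\<delta>>0. \<forall>y. norm (y - x) < \<delta> \<longrightarrow> norm (\<phi> y - \<phi> x - (y - x) \<bullet> ?g) \<le> e * norm (y - x)"
      if "0 < e" for e
    proof -
      define C where "C = L + norm ?g + 1"
      have "0 < C"
        using L_nonneg by (simp add: C_def add_nonneg_pos)
      \<comment> \<open>With this mesh, changing the direction costs at most
        \<open>e / 2 * t\<close>, the other half being spent on the chosen direction.\<close>
      define r where "r = e / (2 * C)"
      have "0 < r"
        using that \<open>0 < C\<close> by (simp add: r_def)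
      have cover: "sphere 0 1 \<subseteq> (\<Union>v\<in>D. ball v r)"
      proof
        fix u :: 'a
        show "u \<in> (\<Union>v\<in>D. ball v r)"
          using D(2)[of "ball u r"] \<open>0 < r\<close> by (auto simp: dist_commute)
      qed
      obtain V where V: "V \<subseteq> D" "finite V" "sphere 0 1 \<subseteq> (\<Union>v\<in>V. ball v r)"
        using compactE_image[OF compact_sphere _ cover] by auto
      have "\<exists>\<delta>>0. \<forall>t. 0 < t \<and> t < \<delta> \<longrightarrow> \<bar>\<phi> (x + t *\<^sub>R v) - \<phi> x - t * (v \<bullet> ?g)\<bar> \<le> e / 2 * t" if "v \<in> V" for v
        using elim V(1) that \<open>0 < e\<close> unfolding has_ddir_def by (meson half_gt_zero subsetD)
      then obtain \<delta> where \<delta>: "\<And>v. v \<in> V \<Longrightarrow> \<delta> v > 0" "\<And>v t. v \<in> V \<Longrightarrow> 0 < t \<Longrightarrow> t < \<delta> v \<Longrightarrow>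
          \<bar>\<phi> (x + t *\<^sub>R v) - \<phi> x - t * (v \<bullet> ?g)\<bar> \<le> e / 2 * t"
        by metis
      define d where "d = Min (insert 1 (\<delta> ` V))"
      have "0 < d"
        using V(2) \<delta>(1) by (auto simp: d_def)
      have d: "d \<le> \<delta> v" if "v \<in> V" for v
        using V(2) that by (auto simp: d_def)
      have "norm (\<phi> y - \<phi> x - (y - x) \<bullet> ?g) \<le> e * norm (y - x)" if y: "norm (y - x) < d" for y
      proof (cases "y = x")
        case False
        define t where "t = norm (y - x)"
        define u where "u = (y - x) /\<^sub>R t"
        have t: "0 < t" "t < d"
          using False y by (auto simp: t_def)
        have yu: "y = x + t *\<^sub>R u" and "norm u = 1"
          using t(1) by (auto simp: u_def t_def)
        then have "u \<in> sphere 0 1"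
          by simp
        then obtain v where v: "v \<in> V" "norm (u - v) < r"
          using V(3) by (auto simp: dist_norm norm_minus_commute)
        have 1: "\<bar>\<phi> (x + t *\<^sub>R v) - \<phi> x - t * (v \<bullet> ?g)\<bar> \<le> e / 2 * t"
          using \<delta>(2)[OF v(1) t(1)] t(2) d[OF v(1)] by linarith
        have "\<bar>\<phi> y - \<phi> (x + t *\<^sub>R v)\<bar> \<le> L * norm (t *\<^sub>R (u - v))"
          using lip[of y "x + t *\<^sub>R v"] by (simp add: yu scaleR_diff_right)
        then have 2: "\<bar>\<phi> y - \<phi> (x + t *\<^sub>R v)\<bar> \<le> L * (t * norm (u - v))"
          using t(1) by simp
        have "\<bar>t * ((v - u) \<bullet> ?g)\<bar> \<le> t * (norm (v - u) * norm ?g)"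
          using t(1) Cauchy_Schwarz_ineq2[of "v - u" ?g] by (simp add: abs_mult)
        then have 3: "\<bar>t * (v \<bullet> ?g) - t * (u \<bullet> ?g)\<bar> \<le> t * norm (u - v) * norm ?g"
          by (simp add: norm_minus_commute mult.assoc inner_diff_left right_diff_distrib)
        have "\<bar>\<phi> y - \<phi> x - t * (u \<bullet> ?g)\<bar> \<le> e / 2 * t + L * (t * norm (u - v)) + t * norm (u - v) * norm ?g"
          using 1 2 3 by linarith
        also have "\<dots> = e / 2 * t + t * (norm (u - v) * (L + norm ?g))"
          by (simp add: algebra_simps)
        also have "\<dots> \<le> e / 2 * t + t * (r * C)"
          using t(1) v(2) L_nonneg \<open>0 < r\<close> by (intro add_left_mono mult_left_mono mult_mono) (auto simp: C_def)
        also have "\<dots> = e * t"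
          using \<open>0 < C\<close> by (simp add: r_def field_simps)
        finally have "\<bar>\<phi> y - \<phi> x - t * (u \<bullet> ?g)\<bar> \<le> e * t" .
        moreover have "(y - x) \<bullet> ?g = t * (u \<bullet> ?g)"
          by (simp add: yu)
        ultimately show ?thesis
          by (simp add: t_def)
      qed simp
      then show ?thesis
        using \<open>0 < d\<close> by blast
    qed
    then show ?case
      unfolding gderiv_def has_derivative_at_alt using bounded_linear_inner_left by blast
  qed
qed

lemma AE_grad_eq_gradient: "AE x in lborel. grad \<phi> x = gradient x"
  using Rademacher
proof eventually_elim
  case (elim x)
  then show ?case
    by (rule grad_eqI)
qed

end

section \<open>Translations in the space of integrable functions\<close>

lemma lborel_distr_diff: "distr lborel borel (\<lambda>x. t - x) = (lborel :: 'a::euclidean_space measure)"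
proof -
  have "(lborel :: 'a measure) = density (distr lborel borel (\<lambda>x. t + (- 1) *\<^sub>R x)) (\<lambda>_. \<bar>- 1 :: real\<bar> ^ DIM('a))"
    by (rule lborel_affine) simp
  then show ?thesis
    by (simp add: density_1)
qed

lemma integral_lborel_diff:
  fixes f :: "'a::euclidean_space \<Rightarrow> 'b::{banach, second_countable_topology}"
  assumes "f \<in> borel_measurable borel"
  shows "(\<integral>x. f (t - x) \<partial>lborel) = (\<integral>x. f x \<partial>lborel)"
  using integral_distr[of "\<lambda>x. t - x" lborel borel f] assms by (simp add: lborel_distr_diff)

lemma integral_lborel_translate:
  fixes f :: "'a::euclidean_space \<Rightarrow> 'b::{banach, second_countable_topology}"
  assumes "f \<in> borel_measurable borel"
  shows "(\<integral>x. f (x + t) \<partial>lborel) = (\<integral>x. f x \<partial>lborel)"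
  using integral_distr[of "(+) t" lborel borel f] assms by (simp add: lborel_distr_plus add.commute)

lemma integrable_lborel_translate:
  fixes f :: "'a::euclidean_space \<Rightarrow> 'b::{banach, second_countable_topology}"
  assumes "integrable lborel f"
  shows "integrable lborel (\<lambda>x. f (x + t))"
  using integrable_distr_eq[of "(+) t" lborel borel f] assms
  by (simp add: lborel_distr_plus add.commute borel_measurable_integrable)

text \<open>Open sets are settled by dominated convergence, since a point of an open set stays
  inside after a small move. Outer regularity extends this to sets of finite measure, and the
  induction for integrable functions does the rest.\<close>

lemma L1_translation_continuous:
  fixes f :: "'a::euclidean_space \<Rightarrow> 'b::{banach, second_countable_topology}"
  assumes "integrable lborel f" and y: "y \<longlonglongrightarrow> 0"
  shows "(\<lambda>n. \<integral>x. norm (f (x + y n) - f x) \<partial>lborel) \<longlonglongrightarrow> 0"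
  using assms(1)
proof (induction rule: integrable_induct)
  case (base A c)
  define T where "T B n = (\<integral>x. \<bar>indicator B (x + y n) - indicator B x :: real\<bar> \<partial>lborel)" for B n
  have A: "A \<in> sets borel" "emeasure lborel A < \<infinity>"
    using base by auto
  have int: "integrable lborel (indicator B :: 'a \<Rightarrow> real)"
      "integrable lborel (\<lambda>x. indicator B (x + t) :: real)"
    if "B \<in> sets borel" "emeasure lborel B < \<infinity>" for B t
    using that integrable_lborel_translate[of "indicator B :: 'a \<Rightarrow> real" t] by auto
  have opn: "T U \<longlonglongrightarrow> 0" if U: "open U" "emeasure lborel U < \<infinity>" for U
  proof -
    have Ub: "U \<in> sets borel"
      using U by auto
    note iU = int[OF Ub U(2)]
    have ip: "integrable lborel (\<lambda>x. indicator U (x + t) * indicator U x :: real)" for t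
      by (rule Bochner_Integration.integrable_bound[OF iU(1)])
        (use iU(2) Ub in \<open>auto simp: indicator_def borel_measurable_integrable\<close>)
    have lim: "(\<lambda>n. \<integral>x. indicator U (x + y n) * indicator U x \<partial>lborel) \<longlonglongrightarrow> (\<integral>x. (indicator U x :: real) \<partial>lborel)"
    proof (rule integral_dominated_convergence[where w="indicator U"])
      show "AE x in lborel. (\<lambda>n. indicator U (x + y n) * indicator U x) \<longlonglongrightarrow> (indicator U x :: real)"
      proof (rule AE_I2)
        fix x
        show "(\<lambda>n. indicator U (x + y n) * indicator U x) \<longlonglongrightarrow> (indicator U x :: real)"
        proof (cases "x \<in> U")
          case True
          have "(\<lambda>n. x + y n) \<longlonglongrightarrow> x"
            using tendsto_add[OF tendsto_const y, of x] by simp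
          then have "\<forall>\<^sub>F n in sequentially. x + y n \<in> U"
            using U(1) True by (rule topological_tendstoD)
          then have "\<forall>\<^sub>F n in sequentially. indicator U (x + y n) * indicator U x = (indicator U x :: real)"
            by eventually_elim (simp add: True)
          then show ?thesis
            by (rule tendsto_eventually)
        qed simp
      qed
      show "AE x in lborel. norm (indicator U (x + y n) * indicator U x :: real) \<le> indicator U x" for n
        by (auto simp: indicator_def)
    qed (use iU ip in \<open>auto simp: borel_measurable_integrable\<close>)
    \<comment> \<open>For values 0 and 1, |a - b| = a + b - 2ab. So only the overlap needs a limit,
      and points outside \<open>U\<close> that are moved into it require no separate
      treatment.\<close>
    have "T U n = 2 * (\<integral>x. (indicator U x :: real) \<partial>lborel) - 2 * (\<integral>x. indicator U (x + y n) * indicator U x \<partial>lborel)" for n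
    proof -
      have "T U n = (\<integral>x. (indicator U (x + y n) + indicator U x) - 2 * (indicator U (x + y n) * indicator U x) \<partial>lborel)"
        unfolding T_def by (intro Bochner_Integration.integral_cong) (auto simp: indicator_def)
      also have "\<dots> = (\<integral>x. indicator U (x + y n) \<partial>lborel) + (\<integral>x. indicator U x \<partial>lborel)
          - 2 * (\<integral>x. indicator U (x + y n) * indicator U x \<partial>lborel)"
        using iU ip by simp
      also have "(\<integral>x. indicator U (x + y n) \<partial>lborel) = (\<integral>x. (indicator U x :: real) \<partial>lborel)"
        using Ub by (intro integral_lborel_translate) auto
      finally show ?thesis
        by simp
    qed
    moreover have "(\<lambda>n. 2 * (\<integral>x. (indicator U x :: real) \<partial>lborel) - 2 * (\<integral>x. indicator U (x + y n) * indicator U x \<partial>lborel)) \<longlonglongrightarrow> 0"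
      using tendsto_diff[OF tendsto_const tendsto_mult_left[OF lim, of 2],
          of "2 * (\<integral>x. (indicator U x :: real) \<partial>lborel)"] by simp
    ultimately show ?thesis
      by presburger
  qed
  have T0: "T A \<longlonglongrightarrow> 0"
  proof (rule LIMSEQ_I)
    fix e :: real assume "0 < e"
    \<comment> \<open>The excess \<open>U - A\<close> enters twice, shifted and unshifted, and so
      costs \<open>e / 2\<close> in all.\<close>
    then have "0 < e / 4" by simp
    obtain U where U: "open U" "A \<subseteq> U" "emeasure lborel (U - A) < e / 4"
      using outer_regular_lborel[OF A(1) \<open>0 < e / 4\<close>] by blast
    have UA: "U - A \<in> sets borel" "emeasure lborel (U - A) < \<infinity>"
      using U A by (auto intro: order_less_trans)
    have "emeasure lborel U \<le> emeasure lborel A + emeasure lborel (U - A)"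
      using U(1) A(1) UA(1) emeasure_subadditive[of A lborel "U - A"] U(2) by (simp add: Un_absorb1)
    then have Uf: "emeasure lborel U < \<infinity>"
      using A(2) UA(2) by (metis ennreal_add_less_top infinity_ennreal_def order_le_less_trans)
    have Ub: "U \<in> sets borel"
      using U by auto
    note iU = int[OF Ub Uf] and iA = int[OF A] and iD = int[OF UA]
    have m: "(\<integral>x. (indicator (U - A) x :: real) \<partial>lborel) < e / 4"
      using U(3) UA emeasure_eq_ennreal_measure[of lborel "U - A"] \<open>0 < e / 4\<close>
      by (simp add: less_top[symmetric] ennreal_less_iff)
    have "T A n \<le> T U n + e / 2" for n
    proof -
      have "T A n \<le> (\<integral>x. \<bar>indicator U (x + y n) - indicator U x\<bar> + (indicator (U - A) (x + y n) + indicator (U - A) x) \<partial>lborel)"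
        unfolding T_def
      proof (rule integral_mono)
        show "\<bar>indicator A (x + y n) - indicator A x :: real\<bar> \<le>
            \<bar>indicator U (x + y n) - indicator U x\<bar> + (indicator (U - A) (x + y n) + indicator (U - A) x)" for x
          using U(2) by (auto simp: indicator_def)
      qed (use iU iA iD in \<open>auto intro!: Bochner_Integration.integrable_add Bochner_Integration.integrable_diff integrable_abs\<close>)
      also have "\<dots> = T U n + ((\<integral>x. indicator (U - A) (x + y n) \<partial>lborel) + (\<integral>x. indicator (U - A) x \<partial>lborel))"
        unfolding T_def using iU iD by simp
      also have "(\<integral>x. indicator (U - A) (x + y n) \<partial>lborel) = (\<integral>x. (indicator (U - A) x :: real) \<partial>lborel)"
        using UA(1) by (intro integral_lborel_translate) auto
      finally show ?thesis
        using m by simp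
    qed
    moreover obtain n0 where "\<And>n. n0 \<le> n \<Longrightarrow> norm (T U n - 0) < e / 2"
      using LIMSEQ_D[OF opn[OF U(1) Uf], of "e / 2"] \<open>0 < e\<close> by auto
    moreover have "0 \<le> T A n" for n
      unfolding T_def by simp
    ultimately have "norm (T A n - 0) < e" if "n0 \<le> n" for n
      using that by (smt (verit) field_sum_of_halves real_norm_def)
    then show "\<exists>n0. \<forall>n\<ge>n0. norm (T A n - 0) < e"
      by blast
  qed
  have "(\<integral>x. norm (indicator A (x + y n) *\<^sub>R c - indicator A x *\<^sub>R c) \<partial>lborel) = T A n * norm c" for n
    unfolding T_def by (simp flip: scaleR_diff_left)
  then show ?case
    using tendsto_mult_right[OF T0, of "norm c"] by simp
next
  case (add f g)
  note i = integrable_lborel_translate[OF add.hyps(1)] integrable_lborel_translate[OF add.hyps(2)]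
  show ?case
  proof (rule tendsto_sandwich[OF _ _ tendsto_const])
    show "(\<lambda>n. (\<integral>x. norm (f (x + y n) - f x) \<partial>lborel) + (\<integral>x. norm (g (x + y n) - g x) \<partial>lborel)) \<longlonglongrightarrow> 0"
      using tendsto_add[OF add.IH(1) add.IH(2)] by simp
    have "(\<integral>x. norm (f (x + y n) + g (x + y n) - (f x + g x)) \<partial>lborel) \<le>
        (\<integral>x. norm (f (x + y n) - f x) + norm (g (x + y n) - g x) \<partial>lborel)" for n
      using i add.hyps by (intro integral_mono) (auto simp: norm_triangle_ineq add_diff_add)
    then show "\<forall>\<^sub>F n in sequentially. (\<integral>x. norm (f (x + y n) + g (x + y n) - (f x + g x)) \<partial>lborel) \<le>
        (\<integral>x. norm (f (x + y n) - f x) \<partial>lborel) + (\<integral>x. norm (g (x + y n) - g x) \<partial>lborel)"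
      using i add.hyps by simp
  qed simp
next
  case (lim f s)
  have lim0: "(\<lambda>i. \<integral>x. norm (s i x - f x) \<partial>lborel) \<longlonglongrightarrow> (\<integral>x. 0 \<partial>(lborel :: 'a measure))"
  proof (rule integral_dominated_convergence[where w="\<lambda>x. 3 * norm (f x)"])
    show "AE x in lborel. (\<lambda>i. norm (s i x - f x)) \<longlonglongrightarrow> 0"
      using lim.hyps(2) by (auto simp: tendsto_norm_zero_iff LIM_zero_iff)
    have "norm (s i x - f x) \<le> 3 * norm (f x)" for i x
      using lim.hyps(3)[of x i] norm_triangle_ineq4[of "s i x" "f x"] by simp
    then show "AE x in lborel. norm (norm (s i x - f x)) \<le> 3 * norm (f x)" for i
      by simp
  qed (use lim.hyps(1,4) in auto)
  show ?case
  proof (rule LIMSEQ_I)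
    fix e :: real assume "0 < e"
    obtain i where i: "(\<integral>x. norm (s i x - f x) \<partial>lborel) < e / 3"
      using LIMSEQ_D[OF lim0, of "e / 3"] \<open>0 < e\<close> by auto
    obtain n0 where n0: "\<And>n. n0 \<le> n \<Longrightarrow> (\<integral>x. norm (s i (x + y n) - s i x) \<partial>lborel) < e / 3"
      using LIMSEQ_D[OF lim.IH[of i], of "e / 3"] \<open>0 < e\<close> by auto
    have "norm ((\<integral>x. norm (f (x + y n) - f x) \<partial>lborel) - 0) < e" if "n0 \<le> n" for n
    proof -
      note t = integrable_lborel_translate[OF lim.hyps(4), of "y n"] integrable_lborel_translate[OF lim.hyps(1)[of i], of "y n"]
      have "(\<integral>x. norm (f (x + y n) - f x) \<partial>lborel) \<le>
         (\<integral>x. norm (s i (x + y n) - f (x + y n)) + norm (s i (x + y n) - s i x) + norm (s i x - f x) \<partial>lborel)"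
      proof (rule integral_mono)
        fix x
        have "f (x + y n) - f x = - (s i (x + y n) - f (x + y n)) + (s i (x + y n) - s i x) + (s i x - f x)"
          by simp
        then show "norm (f (x + y n) - f x) \<le> norm (s i (x + y n) - f (x + y n)) + norm (s i (x + y n) - s i x) + norm (s i x - f x)"
          by (metis norm_minus_cancel norm_triangle_mono order_refl)
      qed (use t lim.hyps(1,4) in auto)
      also have "\<dots> = (\<integral>x. norm (s i (x + y n) - f (x + y n)) \<partial>lborel) + (\<integral>x. norm (s i (x + y n) - s i x) \<partial>lborel)
          + (\<integral>x. norm (s i x - f x) \<partial>lborel)"
        using t lim.hyps(1,4) by simp
      also have "(\<integral>x. norm (s i (x + y n) - f (x + y n)) \<partial>lborel) = (\<integral>x. norm (s i x - f x) \<partial>lborel)"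
        using lim.hyps(1,4) by (intro integral_lborel_translate) (simp add: borel_measurable_integrable)
      finally show ?thesis
        using i n0[OF that] by simp
    qed
    then show "\<exists>n0. \<forall>n\<ge>n0. norm ((\<integral>x. norm (f (x + y n) - f x) \<partial>lborel) - 0) < e"
      by blast
  qed
qed

section \<open>Smooth functions and mollifiers\<close>

lemma Ck_SucI:
  assumes "\<And>x. (f has_derivative f' x) (at x)" "\<And>v. Ck k (\<lambda>x. f' x v)"
  shows "Ck (Suc k) f"
proof -
  have "frechet_derivative f (at x) = f' x" for x
    using frechet_derivative_at[OF assms(1)[of x]] by simp
  then show ?thesis
    using assms by (auto simp: differentiable_def)
qed

lemma Ck_Suc_has_derivative:
  "Ck (Suc k) f \<Longrightarrow> (f has_derivative frechet_derivative f (at x)) (at x)"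
  by (simp add: frechet_derivative_works)

lemma Ck_SucD: "Ck (Suc k) f \<Longrightarrow> Ck k f"
proof (induction k arbitrary: f)
  case 0
  then show ?case
    by (auto intro!: continuous_at_imp_continuous_on differentiable_imp_continuous_within)
next
  case (Suc k)
  then show ?case
    by (metis Ck.simps(2))
qed

lemma Ck_continuous: "Ck k f \<Longrightarrow> continuous_on UNIV f"
proof (induction k)
  case (Suc k)
  then show ?case
    using Ck_SucD by blast
qed simp

lemma Ck_const: "Ck k (\<lambda>x. c)"
proof (induction k arbitrary: c)
  case (Suc k)
  show ?case
    by (rule Ck_SucI[where f'="\<lambda>x v. 0"]) (use Suc in auto)
qed simp

lemma Ck_add: "Ck k f \<Longrightarrow> Ck k g \<Longrightarrow> Ck k (\<lambda>x. f x + g x)"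
proof (induction k arbitrary: f g)
  case (Suc k)
  show ?case
  proof (rule Ck_SucI)
    show "((\<lambda>x. f x + g x) has_derivative
        (\<lambda>v. frechet_derivative f (at x) v + frechet_derivative g (at x) v)) (at x)" for x
      using Suc.prems by (intro has_derivative_add Ck_Suc_has_derivative)
  qed (use Suc in auto)
qed (auto intro: continuous_on_add)

lemma Ck_mult: "Ck k f \<Longrightarrow> Ck k g \<Longrightarrow> Ck k (\<lambda>x. f x * g x)"
proof (induction k arbitrary: f g)
  case (Suc k)
  show ?case
  proof (rule Ck_SucI)
    show "((\<lambda>x. f x * g x) has_derivative
        (\<lambda>v. f x * frechet_derivative g (at x) v + frechet_derivative f (at x) v * g x)) (at x)" for x
      using Suc.prems by (intro has_derivative_mult Ck_Suc_has_derivative)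
    show "Ck k (\<lambda>x. f x * frechet_derivative g (at x) v + frechet_derivative f (at x) v * g x)" for v
      using Suc.IH Suc.prems Ck_SucD[OF Suc.prems(1)] Ck_SucD[OF Suc.prems(2)] by (intro Ck_add) auto
  qed
qed (auto intro: continuous_on_mult)

lemma Ck_inner_left: "Ck k (\<lambda>x. x \<bullet> v)"
proof (cases k)
  case (Suc m)
  show ?thesis
    unfolding Suc by (rule Ck_SucI[where f'="\<lambda>x w. w \<bullet> v"])
      (auto intro!: derivative_eq_intros Ck_const)
qed (auto intro!: continuous_intros)

text \<open>The functions \<open>t\<^sup>-\<^sup>j exp (-1/t)\<close>, extended by zero, are closed under differentiation up to
  linear combinations.\<close>

definition exp_inv :: "nat \<Rightarrow> real \<Rightarrow> real" where
  "exp_inv j t = (if 0 < t then exp (- inverse t) * inverse t ^ j else 0)"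

text \<open>With s = 1/t, \<open>exp s\<close> is at least the single term s^(j+2)/(j+2)! of its
  series. The quadratic bound is what makes the difference quotient at 0 vanish in the next
  lemma.\<close>

lemma exp_inv_le: "\<bar>exp_inv j t\<bar> \<le> fact (j + 2) * t\<^sup>2"
proof (cases "0 < t")
  case True
  define s where "s = inverse t"
  have s: "0 < s" "t = inverse s"
    using True by (auto simp: s_def)
  have "s ^ m / fact m \<le> exp s" for m
  proof -
    have "(\<Sum>n\<in>{m}. s ^ n /\<^sub>R fact n) \<le> (\<Sum>n. s ^ n /\<^sub>R fact n)"
      using s(1) summable_exp_generic[of s] by (intro sum_le_suminf) auto
    then show ?thesis
      by (simp add: exp_def divide_inverse mult.commute)
  qed
  then have "exp (- s) * s ^ m \<le> fact m" for m
    by (simp add: exp_minus field_simps)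
  from this[of "j + 2"] have "exp (- s) * s ^ j * s\<^sup>2 \<le> fact (j + 2)"
    by (simp only: power_add mult.assoc)
  then have "exp (- s) * s ^ j * s\<^sup>2 * t\<^sup>2 \<le> fact (j + 2) * t\<^sup>2"
    by (rule mult_right_mono) simp
  moreover have "s\<^sup>2 * t\<^sup>2 = 1"
    using s by (simp flip: power_mult_distrib)
  ultimately have "exp (- s) * s ^ j \<le> fact (j + 2) * t\<^sup>2"
    by (simp only: mult.assoc mult_1_right)
  then show ?thesis
    using True by (simp add: exp_inv_def s_def)
qed (simp add: exp_inv_def)

lemma exp_inv_has_derivative:
  "(exp_inv j has_real_derivative exp_inv (j + 2) t - real j * exp_inv (j + 1) t) (at t)"
proof -
  consider "0 < t" | "t < 0" | "t = 0" by linarith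
  then show ?thesis
  proof cases
    case 1
    have "((\<lambda>t. exp (- inverse t) * inverse t ^ j) has_real_derivative
        exp_inv (j + 2) t - real j * exp_inv (j + 1) t) (at t)"
    proof -
      have inv: "(inverse has_real_derivative - (inverse t)\<^sup>2) (at t)"
        using DERIV_inverse[of t] 1 by (simp add: numeral_2_eq_2)
      have "((\<lambda>t. inverse t ^ j) has_real_derivative
          of_nat j * (- (inverse t)\<^sup>2 * inverse t ^ (j - Suc 0))) (at t)"
        by (rule DERIV_power[OF inv])
      moreover have "of_nat j * (- (inverse t)\<^sup>2 * inverse t ^ (j - Suc 0)) = - (real j * inverse t ^ (j + 1))"
        by (cases j) (simp_all add: power2_eq_square)
      ultimately have p: "((\<lambda>t. inverse t ^ j) has_real_derivative - (real j * inverse t ^ (j + 1))) (at t)"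
        by (simp only:)
      have e: "((\<lambda>t. exp (- inverse t)) has_real_derivative exp (- inverse t) * (inverse t)\<^sup>2) (at t)"
        using DERIV_fun_exp[OF DERIV_minus[OF inv]] by simp
      have "exp (- inverse t) * (inverse t)\<^sup>2 * inverse t ^ j + - (real j * inverse t ^ (j + 1)) * exp (- inverse t)
          = exp_inv (j + 2) t - real j * exp_inv (j + 1) t"
        using 1 by (simp add: exp_inv_def power_add power2_eq_square)
      then show ?thesis
        using DERIV_mult[OF e p] by simp
    qed
    then show ?thesis
    proof (rule DERIV_cong_ev[THEN iffD1, rotated -1])
      have "\<forall>\<^sub>F x in nhds t. 0 < x"
        using eventually_nhds_in_open[of "{0<..}" t] 1 by auto
      then show "\<forall>\<^sub>F x in nhds t. exp (- inverse x) * inverse x ^ j = exp_inv j x"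
        by eventually_elim (simp add: exp_inv_def)
    qed auto
  next
    case 2
    have "((\<lambda>t. 0) has_real_derivative exp_inv (j + 2) t - real j * exp_inv (j + 1) t) (at t)"
      using 2 by (simp add: exp_inv_def)
    then show ?thesis
    proof (rule DERIV_cong_ev[THEN iffD1, rotated -1])
      have "\<forall>\<^sub>F x in nhds t. x < 0"
        using eventually_nhds_in_open[of "{..<0}" t] 2 by auto
      then show "\<forall>\<^sub>F x in nhds t. 0 = exp_inv j x"
        by eventually_elim (simp add: exp_inv_def)
    qed auto
  next
    case 3
    have "(\<lambda>h. exp_inv j h / h) \<midarrow>0\<rightarrow> 0"
    proof (rule Lim_null_comparison)
      have "norm (exp_inv j h / h) \<le> fact (j + 2) * \<bar>h\<bar>" if "h \<noteq> 0" for h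
      proof -
        have "\<bar>exp_inv j h\<bar> \<le> fact (j + 2) * \<bar>h\<bar> * \<bar>h\<bar>"
          using exp_inv_le[of j h] by (simp only: power2_eq_square mult.assoc abs_mult_self_eq)
        then show ?thesis
          using that pos_divide_le_eq[of "\<bar>h\<bar>" "\<bar>exp_inv j h\<bar>" "fact (j + 2) * \<bar>h\<bar>"]
          by (simp only: real_norm_def abs_divide zero_less_abs_iff not_False_eq_True simp_thms)
      qed
      then show "\<forall>\<^sub>F h in at 0. norm (exp_inv j h / h) \<le> fact (j + 2) * \<bar>h\<bar>"
        by (simp add: eventually_at_filter)
      show "((\<lambda>h. fact (j + 2) * \<bar>h\<bar>) \<longlongrightarrow> (0::real)) (at 0)"
        by (auto intro!: tendsto_eq_intros)
    qed
    then show ?thesis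
      using 3 by (simp add: DERIV_def exp_inv_def)
  qed
qed

lemma Ck_exp_inv: "Ck k (\<lambda>x :: 'a::euclidean_space. exp_inv j (c - x \<bullet> x))"
proof (induction k arbitrary: j)
  case 0
  have "continuous_on UNIV (exp_inv j)"
    using exp_inv_has_derivative DERIV_isCont by (blast intro: continuous_at_imp_continuous_on)
  moreover have "continuous_on UNIV (\<lambda>x::'a. c - x \<bullet> x)"
    by (intro continuous_intros)
  ultimately show ?case
    using continuous_on_compose2[of UNIV "exp_inv j" UNIV "\<lambda>x::'a. c - x \<bullet> x"] by simp
next
  case (Suc k)
  let ?d = "\<lambda>x :: 'a. exp_inv (j + 2) (c - x \<bullet> x) + (- real j) * exp_inv (j + 1) (c - x \<bullet> x)"
  show ?case
  proof (rule Ck_SucI)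
    fix x :: 'a
    have "((\<lambda>x. c - x \<bullet> x) has_derivative (\<lambda>w. - 2 * (x \<bullet> w))) (at x)"
      by (auto intro!: derivative_eq_intros simp: inner_commute)
    from has_derivative_compose[OF this
        exp_inv_has_derivative[of j "c - x \<bullet> x", unfolded has_field_derivative_def]]
    show "((\<lambda>x. exp_inv j (c - x \<bullet> x)) has_derivative (\<lambda>w. ?d x * (- 2 * (x \<bullet> w)))) (at x)"
      by simp
  next
    show "Ck k (\<lambda>x. ?d x * (- 2 * (x \<bullet> v)))" for v
      by (intro Ck_mult Ck_add Ck_const Ck_inner_left) (rule Suc.IH)+
  qed
qed

text \<open>The standard bump exp(-1/(r^2 - |x|^2)), which is \<open>exp_inv 0\<close> of r^2 -
  |x|^2, divided by its integral.\<close>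

lemma exists_mollifier:
  assumes "0 < r"
  shows "\<exists>\<eta> :: 'a::euclidean_space \<Rightarrow> real. (\<forall>k. Ck k \<eta>) \<and> (\<forall>x. 0 \<le> \<eta> x) \<and> (\<forall>x. r \<le> norm x \<longrightarrow> \<eta> x = 0)
    \<and> integrable lborel \<eta> \<and> (\<integral>x. \<eta> x \<partial>lborel) = 1"
proof -
  define b :: "'a \<Rightarrow> real" where "b x = exp_inv 0 (r\<^sup>2 - x \<bullet> x)" for x
  have Ckb: "Ck k b" for k
    unfolding b_def[abs_def] by (rule Ck_exp_inv)
  have b0: "0 \<le> b x" for x
    by (simp add: b_def exp_inv_def)
  have iff: "0 < r\<^sup>2 - x \<bullet> x \<longleftrightarrow> norm x < r" for x :: 'a
    using assms power_strict_mono[of "norm x" r 2] power_mono[of r "norm x" 2]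
    by (auto simp: power2_norm_eq_inner not_less[symmetric])
  have b_out: "b x = 0" if "r \<le> norm x" for x
    using iff[of x] that by (simp add: b_def exp_inv_def)
  have b_in: "0 < b x" if "norm x < r" for x
    using iff[of x] that by (simp add: b_def exp_inv_def)
  have meas: "b \<in> borel_measurable borel"
    using Ck_continuous[OF Ckb[of 0]] by (rule borel_measurable_continuous_onI)
  have b1: "b x \<le> 1" for x
    using iff[of x] by (auto simp: b_def exp_inv_def)
  have int: "integrable lborel b"
  proof (rule Bochner_Integration.integrable_bound)
    show "integrable lborel (indicator (cball 0 r) :: 'a \<Rightarrow> real)"
      using emeasure_lborel_cball_finite by (intro integrable_real_indicator) (auto simp: less_top)
    show "AE x in lborel. norm (b x) \<le> norm (indicator (cball 0 r) x :: real)"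
      using b0 b1 b_out by (auto simp: indicator_def not_le)
  qed (use meas in simp)
  define I where "I = (\<integral>x. b x \<partial>lborel)"
  have "I \<noteq> 0"
  proof
    assume "I = 0"
    then have "AE x in lborel. b x = 0"
      using integral_nonneg_eq_0_iff_AE[OF int] b0 by (simp add: I_def)
    moreover have "b x = 0 \<longrightarrow> x \<notin> ball 0 r" for x
      using b_in[of x] by auto
    ultimately have "AE x in lborel. x \<notin> ball (0::'a) r"
      by (auto elim: eventually_mono)
    then have "emeasure lborel (ball (0::'a) r) = 0"
      by (subst (asm) AE_iff_measurable[where N="ball 0 r"]) auto
    then have "ball (0::'a) r \<in> null_sets lborel"
      by (simp add: null_sets_def)
    then have "negligible (ball (0::'a) r)"
      by (simp add: negligible_iff_null_sets null_sets_completion_iff)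
    then show False
      using open_not_negligible[of "ball (0::'a) r"] assms by simp
  qed
  moreover have "0 \<le> I"
    unfolding I_def using b0 by simp
  ultimately have "0 < I"
    by simp
  show ?thesis
  proof (intro exI[of _ "\<lambda>x. inverse I * b x"] conjI allI impI)
    show "Ck k (\<lambda>x. inverse I * b x)" for k
      by (intro Ck_mult Ck_const Ckb)
    show "(\<integral>x. inverse I * b x \<partial>lborel) = 1"
      using \<open>0 < I\<close> by (simp add: I_def)
  qed (use \<open>0 < I\<close> b0 b_out int in auto)
qed

lemma has_derivative_convolution:
  fixes \<phi> \<eta> :: "'a::euclidean_space \<Rightarrow> real"
  assumes \<phi>: "continuous_on UNIV \<phi>" and \<eta>: "Ck (Suc 0) \<eta>"
  shows "((\<lambda>x. integral (cbox a b) (\<lambda>y. \<phi> y * \<eta> (x - y))) has_derivative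
    (\<lambda>v. integral (cbox a b) (\<lambda>y. \<phi> y * frechet_derivative \<eta> (at (x - y)) v))) (at x)"
proof -
  \<comment> \<open>\<open>leibniz_rule\<close> wants the derivative as a continuous map into
    bounded linear maps, hence the \<open>Blinfun\<close> wrapping; continuity is then checked on
    basis vectors.\<close>
  define D where "D z = Blinfun (frechet_derivative \<eta> (at z))" for z
  have der: "(\<eta> has_derivative frechet_derivative \<eta> (at z)) (at z)" for z
    using \<eta> by (rule Ck_Suc_has_derivative)
  have D: "blinfun_apply (D z) = frechet_derivative \<eta> (at z)" for z
    unfolding D_def using has_derivative_bounded_linear[OF der] by (rule bounded_linear_Blinfun_apply)
  have contD: "continuous_on UNIV (\<lambda>z. frechet_derivative \<eta> (at z) v)" for v
    using \<eta> by simp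
  have cont\<eta>: "continuous_on UNIV \<eta>"
    using \<eta> by (rule Ck_continuous)
  have c1: "continuous_on S (\<lambda>p. \<phi> (g p))" if "continuous_on S g" for S and g :: "'c::topological_space \<Rightarrow> 'a"
    using continuous_on_compose2[OF \<phi> that] by simp
  have c2: "continuous_on S (\<lambda>p. frechet_derivative \<eta> (at (g p)) v)" if "continuous_on S g" for S v and g :: "'c::topological_space \<Rightarrow> 'a"
    using continuous_on_compose2[OF contD that] by simp
  have c3: "continuous_on S (\<lambda>p. \<eta> (g p))" if "continuous_on S g" for S and g :: "'c::topological_space \<Rightarrow> 'a"
    using continuous_on_compose2[OF cont\<eta> that] by simp
  define fx where "fx x y = \<phi> y *\<^sub>R D (x - y)" for x y
  have contfx: "continuous_on S (\<lambda>(x, y). fx x y)" for S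
    unfolding split_def fx_def
    by (rule continuous_on_blinfun_componentwise)
      (auto simp: blinfun.scaleR_left D intro!: continuous_intros c1 c2)
  have contfx': "continuous_on S (fx x)" for S x
    unfolding fx_def
    by (rule continuous_on_blinfun_componentwise)
      (auto simp: blinfun.scaleR_left D intro!: continuous_intros c1 c2)
  have "((\<lambda>x. integral (cbox a b) (\<lambda>y. \<phi> y * \<eta> (x - y))) has_derivative
      blinfun_apply (integral (cbox a b) (fx x))) (at x within UNIV)"
  proof (rule leibniz_rule)
    fix x t :: 'a
    have "((\<lambda>x. x - t) has_derivative (\<lambda>v. v)) (at x)"
      by (auto intro!: derivative_eq_intros)
    from has_derivative_compose[OF this der] 
    have "((\<lambda>x. \<phi> t * \<eta> (x - t)) has_derivative (\<lambda>v. \<phi> t * frechet_derivative \<eta> (at (x - t)) v)) (at x)"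
      by (rule has_derivative_mult_right)
    moreover have "blinfun_apply (fx x t) = (\<lambda>v. \<phi> t * frechet_derivative \<eta> (at (x - t)) v)"
      by (auto simp: fx_def blinfun.scaleR_left D)
    ultimately show "((\<lambda>x. \<phi> t * \<eta> (x - t)) has_derivative blinfun_apply (fx x t)) (at x within UNIV)"
      by simp
  next
    show "(\<lambda>y. \<phi> y * \<eta> (x - y)) integrable_on cbox a b" for x
      by (intro integrable_continuous continuous_intros c1 c3)
  qed (use contfx in auto)
  moreover have "blinfun_apply (integral (cbox a b) (fx x)) v = integral (cbox a b) (\<lambda>y. \<phi> y * frechet_derivative \<eta> (at (x - y)) v)" for v
    by (subst blinfun_apply_integral) (auto simp: fx_def blinfun.scaleR_left D intro!: integrable_continuous contfx'[unfolded fx_def])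
  then have "blinfun_apply (integral (cbox a b) (fx x)) = (\<lambda>v. integral (cbox a b) (\<lambda>y. \<phi> y * frechet_derivative \<eta> (at (x - y)) v))"
    by blast
  ultimately show ?thesis
    by simp
qed

text \<open>Derivatives fall on \<open>\<eta>\<close> alone and give again a convolution with the
  same continuous \<open>\<phi>\<close>, so the induction runs over arbitrary smooth
  \<open>\<eta>\<close>.\<close>

lemma Ck_convolution:
  fixes \<phi> \<eta> :: "'a::euclidean_space \<Rightarrow> real"
  assumes \<phi>: "continuous_on UNIV \<phi>" and \<eta>: "\<And>k. Ck k \<eta>"
  shows "Ck k (\<lambda>x. integral (cbox a b) (\<lambda>y. \<phi> y * \<eta> (x - y)))"
  using \<eta>
proof (induction k arbitrary: \<eta>)
  case 0
  then show ?case
    using has_derivative_continuous[OF has_derivative_convolution[OF \<phi> 0]]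
    by (simp add: continuous_at_imp_continuous_on)
next
  case (Suc k)
  show ?case
  proof (rule Ck_SucI[OF has_derivative_convolution[OF \<phi> Suc.prems]])
    show "Ck k (\<lambda>x. integral (cbox a b) (\<lambda>y. \<phi> y * frechet_derivative \<eta> (at (x - y)) v))" for v
      using Suc.prems by (intro Suc.IH[of "\<lambda>z. frechet_derivative \<eta> (at z) v"]) (metis Ck.simps(2))
  qed
qed

lemma compact_support_zero_outside:
  assumes "compact_support_in \<Omega> \<phi>" "x \<notin> closure {x. \<phi> x \<noteq> 0}"
  shows "\<phi> x = 0"
  using assms(2) closure_subset[of "{x. \<phi> x \<noteq> 0}"] by auto

lemma Cinf_c_subset_Lip_c: "Cinf_c \<Omega> \<subseteq> Lip_c \<Omega>"
proof
  fix \<phi> assume "\<phi> \<in> Cinf_c \<Omega>"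
  then have \<phi>: "Ck (Suc 0) \<phi>" "compact_support_in \<Omega> \<phi>"
    unfolding Cinf_c_def by blast+
  let ?K = "closure {x. \<phi> x \<noteq> 0}"
  have K: "compact ?K"
    using \<phi>(2) by (simp add: compact_support_in_def)
  have der: "(\<phi> has_derivative frechet_derivative \<phi> (at x)) (at x)" for x
    using \<phi>(1) by (rule Ck_Suc_has_derivative)
  have out: "frechet_derivative \<phi> (at x) v = 0" if "x \<notin> ?K" for x v
  proof -
    have "open (- ?K)" "x \<in> - ?K"
      using that by (auto intro: open_Compl)
    moreover have "0 = \<phi> y" if "y \<in> - ?K" for y
      using that compact_support_zero_outside[OF \<phi>(2), of y] by simp
    ultimately have "(\<phi> has_derivative (\<lambda>v. 0)) (at x)"
      by (rule has_derivative_transform_within_open[OF has_derivative_const])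
    from frechet_derivative_at[OF this] show ?thesis
      by metis
  qed
  have "\<exists>B. \<forall>x. \<bar>frechet_derivative \<phi> (at x) i\<bar> \<le> B" for i
  proof -
    have "continuous_on ?K (\<lambda>x. frechet_derivative \<phi> (at x) i)"
      using \<phi>(1) by (auto intro: continuous_on_subset)
    then have "bounded ((\<lambda>x. frechet_derivative \<phi> (at x) i) ` ?K)"
      using K by (intro compact_imp_bounded compact_continuous_image)
    then obtain B where B: "\<And>x. x \<in> ?K \<Longrightarrow> \<bar>frechet_derivative \<phi> (at x) i\<bar> \<le> B"
      by (auto simp: bounded_iff)
    have "\<bar>frechet_derivative \<phi> (at x) i\<bar> \<le> \<bar>B\<bar>" for x
      using B[of x] out[of x i] by (cases "x \<in> ?K") auto
    then show ?thesis
      by blast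
  qed
  then obtain B where B: "\<And>x i. \<bar>frechet_derivative \<phi> (at x) i\<bar> \<le> B i"
    by metis
  define C where "C = (\<Sum>i\<in>Basis. B i)"
  have "onorm (frechet_derivative \<phi> (at x)) \<le> C" for x
  proof (rule onorm_le)
    fix v :: 'a
    interpret bounded_linear "frechet_derivative \<phi> (at x)"
      using der by (rule has_derivative_bounded_linear)
    have "frechet_derivative \<phi> (at x) v = (\<Sum>i\<in>Basis. (v \<bullet> i) * frechet_derivative \<phi> (at x) i)"
      by (subst euclidean_representation[of v, symmetric]) (simp only: sum scaleR real_scaleR_def)
    also have "\<bar>\<dots>\<bar> \<le> (\<Sum>i\<in>Basis. norm v * B i)"
      using B Basis_le_norm
      by (intro order_trans[OF sum_abs] sum_mono) (auto simp: abs_mult intro!: mult_mono)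
    finally show "norm (frechet_derivative \<phi> (at x) v) \<le> C * norm v"
      by (simp add: C_def sum_distrib_left mult.commute)
  qed
  then have "norm (\<phi> x - \<phi> y) \<le> C * norm (x - y)" for x y
    using der by (intro differentiable_bound[where S=UNIV]) auto
  moreover have "0 \<le> C"
    unfolding C_def by (intro sum_nonneg) (meson B abs_ge_zero order_trans)
  ultimately have "C-lipschitz_on UNIV \<phi>"
    by (auto intro!: lipschitz_onI simp: dist_norm)
  then show "\<phi> \<in> Lip_c \<Omega>"
    using \<phi>(2) by (auto simp: Lip_c_def)
qed

section \<open>The divergence tested against Lipschitz functions\<close>

text \<open>A small step in the direction of the gradient itself changes \<open>f\<close> by about
  the norm of the gradient times the step length, which \<open>M\<close> limits. Where no derivative
  exists, \<open>grad\<close> is 0 and the bound is trivial.\<close>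

lemma norm_grad_le_local:
  assumes "open U" "x \<in> U" and M: "0 \<le> M" "\<And>y. y \<in> U \<Longrightarrow> \<bar>f y - f x\<bar> \<le> M * norm (y - x)"
  shows "norm (grad f x) \<le> M"
proof (cases "\<exists>D. GDERIV f x :> D")
  case True
  then obtain D where D: "GDERIV f x :> D"
    by blast
  obtain r where r: "0 < r" "ball x r \<subseteq> U"
    using assms(1,2) openE by blast
  have "norm D \<le> M + e" if "0 < e" for e
  proof (cases "D = 0")
    case False
    obtain d where d: "0 < d" "\<And>y. norm (y - x) < d \<Longrightarrow> \<bar>f y - f x - (y - x) \<bullet> D\<bar> \<le> e * norm (y - x)"
      using D \<open>0 < e\<close> unfolding gderiv_def has_derivative_at_alt by (metis real_norm_def)
    define t where "t = min r d / (2 * norm D)"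
    have t: "0 < t"
      using r(1) d(1) False by (simp add: t_def)
    define y where "y = x + t *\<^sub>R D"
    have n: "norm (y - x) = t * norm D"
      using t by (simp add: y_def)
    then have n2: "norm (y - x) = min r d / 2"
      using False by (simp add: t_def)
    then have y: "norm (y - x) < r" "norm (y - x) < d"
      using r(1) d(1) by linarith+
    then have "y \<in> U"
      using r(2) by (auto simp: dist_norm norm_minus_commute)
    have "(y - x) \<bullet> D = (t * norm D) * norm D"
      by (simp add: y_def power2_norm_eq_inner flip: power2_eq_square)
    then have "(t * norm D) * norm D \<le> M * norm (y - x) + e * norm (y - x)"
      using M(2)[OF \<open>y \<in> U\<close>] d(2)[OF y(2)] by linarith
    then have "(t * norm D) * norm D \<le> (t * norm D) * (M + e)"
      unfolding n by (simp add: algebra_simps)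
    then show ?thesis
      using t False by simp
  qed (use M(1) that in simp)
  then have "norm D \<le> M"
    by (rule field_le_epsilon)
  then show ?thesis
    using grad_eqI[OF D] by simp
qed (use M(1) in \<open>simp add: grad_def\<close>)

lemma grad_locally_zero:
  assumes "open U" "x \<in> U" "\<And>y. y \<in> U \<Longrightarrow> f y = 0"
  shows "grad f x = 0"
  using norm_grad_le_local[OF assms(1,2), of 0 f] assms(2,3) by simp

lemma grad_cong_local:
  assumes "open U" "x \<in> U" "\<And>y. y \<in> U \<Longrightarrow> f y = g y"
  shows "grad f x = grad g x"
proof -
  have "GDERIV f x :> D \<longleftrightarrow> GDERIV g x :> D" for D
    unfolding gderiv_def using has_derivative_transform_within_open[OF _ assms(1,2)] assms(3) by metis
  then show ?thesis
    unfolding grad_def by presburger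
qed

lemma grad_outside_support:
  assumes "x \<notin> closure {x. \<phi> x \<noteq> 0}"
  shows "grad \<phi> x = 0"
proof (rule grad_locally_zero)
  show "open (- closure {x. \<phi> x \<noteq> 0})"
    by (simp add: open_Compl)
  show "\<phi> y = 0" if "y \<in> - closure {x. \<phi> x \<noteq> 0}" for y
    using that closure_subset[of "{x. \<phi> x \<noteq> 0}"] by auto
qed (use assms in simp)

lemma Lip_cE:
  assumes "\<phi> \<in> Lip_c \<Omega>"
  obtains L where "Lipschitz_function \<phi> L"
  using assms by (auto simp: Lip_c_def Lipschitz_function_def)

lemma Lip_c_support:
  assumes "\<phi> \<in> Lip_c \<Omega>"
  shows "compact (closure {x. \<phi> x \<noteq> 0})" "closure {x. \<phi> x \<noteq> 0} \<subseteq> \<Omega>"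
  using assms by (auto simp: Lip_c_def compact_support_in_def)

lemma Lip_c_continuous:
  assumes "\<phi> \<in> Lip_c \<Omega>"
  shows "continuous_on UNIV \<phi>"
  using assms by (meson Lip_cE Lipschitz_function.continuous)

lemma Lip_c_measurable: "\<phi> \<in> Lip_c \<Omega> \<Longrightarrow> \<phi> \<in> borel_measurable borel"
  by (rule borel_measurable_continuous_onI[OF Lip_c_continuous])

lemma Lip_c_bounded:
  assumes "\<phi> \<in> Lip_c \<Omega>"
  obtains C where "0 \<le> C" "\<And>x. \<bar>\<phi> x\<bar> \<le> C"
proof -
  let ?K = "closure {x. \<phi> x \<noteq> 0}"
  have "bounded (\<phi> ` ?K)"
    using Lip_c_support[OF assms] Lip_c_continuous[OF assms]
    by (intro compact_imp_bounded compact_continuous_image) (auto intro: continuous_on_subset)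
  then obtain C where C: "\<And>x. x \<in> ?K \<Longrightarrow> \<bar>\<phi> x\<bar> \<le> C"
    by (auto simp: bounded_iff)
  have "\<bar>\<phi> x\<bar> \<le> \<bar>C\<bar>" for x
    using C[of x] closure_subset[of "{x. \<phi> x \<noteq> 0}"] by (cases "\<phi> x = 0") auto
  then show thesis
    using that[of "\<bar>C\<bar>"] by simp
qed

text \<open>Fields are only Lebesgue measurable, whereas Fubini and translation arguments are
  carried out over \<open>lborel\<close>; coordinates reduce the passage to the real case.\<close>

lemma lebesgue_measurable_AE_eq_borel:
  fixes f :: "'a::euclidean_space \<Rightarrow> 'b::euclidean_space"
  assumes "f \<in> borel_measurable lebesgue"
  shows "\<exists>g\<in>borel_measurable borel. AE x in lborel. f x = g x"
proof -
  have "\<exists>g. g \<in> borel_measurable borel \<and> (AE x in lborel. f x \<bullet> i = g x)" for i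
    using completion_ex_borel_measurable_real[of "\<lambda>x. f x \<bullet> i" lborel] assms by auto
  then obtain g where g: "\<And>i. g i \<in> borel_measurable borel" "\<And>i. AE x in lborel. f x \<bullet> i = g i x"
    by metis
  have "AE x in lborel. \<forall>i\<in>Basis. f x \<bullet> i = g i x"
    using g(2) by (simp add: AE_ball_countable countable_finite)
  then have "AE x in lborel. f x = (\<Sum>i\<in>Basis. g i x *\<^sub>R i)"
  proof eventually_elim
    case (elim x)
    have "(\<Sum>i\<in>Basis. (f x \<bullet> i) *\<^sub>R i) = (\<Sum>i\<in>Basis. g i x *\<^sub>R i)"
      using elim by (intro sum.cong) auto
    then show ?case
      by (simp add: euclidean_representation)
  qed
  moreover have "(\<lambda>x. \<Sum>i\<in>Basis. g i x *\<^sub>R i) \<in> borel_measurable borel"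
    using g(1) by auto
  ultimately show ?thesis
    by (rule bexI)
qed

text \<open>The common consequence of all exponents p \<ge> 1, and enough to pair the field with a
  bounded gradient of compact support.\<close>

definition locally_integrable_on :: "'a::euclidean_space set \<Rightarrow> ('a \<Rightarrow> 'a) \<Rightarrow> bool" where
  "locally_integrable_on \<Omega> F \<longleftrightarrow> (\<forall>K. compact K \<longrightarrow> K \<subseteq> \<Omega> \<longrightarrow> set_integrable lebesgue K F)"

text \<open>Both factors of the pairing are exchanged for Borel representatives, \<open>G\<close>
  for the field cut off to \<open>K\<close> and \<open>h\<close> for the gradient.\<close>

lemma distr_div_eq_lborel:
  assumes G: "G \<in> borel_measurable borel" "AE x in lborel. indicator K x *\<^sub>R F x = G x"
    and F: "set_integrable lebesgue K F"
    and K: "K \<subseteq> \<Omega>" "\<And>x. x \<notin> K \<Longrightarrow> grad \<psi> x = 0"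
    and h: "h \<in> borel_measurable borel" "AE x in lborel. grad \<psi> x = h x"
  shows "distr_div \<Omega> F \<psi> = - (\<integral>x. G x \<bullet> h x \<partial>lborel)"
proof -
  have F': "(\<lambda>x. indicator K x *\<^sub>R F x) \<in> borel_measurable lebesgue"
    using borel_measurable_integrable[OF F[unfolded set_integrable_def]] .
  have grad: "grad \<psi> \<in> borel_measurable lebesgue"
  proof (rule borel_measurable_AE)
    show "h \<in> borel_measurable lebesgue"
      using h(1) by (simp add: measurable_completion)
    show "AE x in lebesgue. h x = grad \<psi> x"
      using h(2) by (auto intro!: AE_completion elim: eventually_mono)
  qed
  have "(LINT x:\<Omega>|lebesgue. F x \<bullet> grad \<psi> x) = (\<integral>x. (indicator K x *\<^sub>R F x) \<bullet> grad \<psi> x \<partial>lebesgue)"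
    unfolding set_lebesgue_integral_def
    by (intro Bochner_Integration.integral_cong refl) (use K in \<open>auto simp: indicator_def\<close>)
  also have "\<dots> = (\<integral>x. G x \<bullet> h x \<partial>lebesgue)"
  proof (rule integral_cong_AE)
    have "AE x in lborel. (indicator K x *\<^sub>R F x) \<bullet> grad \<psi> x = G x \<bullet> h x"
      using G(2) h(2) by eventually_elim (simp only:)
    then show "AE x in lebesgue. (indicator K x *\<^sub>R F x) \<bullet> grad \<psi> x = G x \<bullet> h x"
      by (rule AE_completion)
    show "(\<lambda>x. (indicator K x *\<^sub>R F x) \<bullet> grad \<psi> x) \<in> borel_measurable lebesgue"
      using F' grad by (rule borel_measurable_inner)
    show "(\<lambda>x. G x \<bullet> h x) \<in> borel_measurable lebesgue"
      using G(1) h(1) by (intro measurable_completion) simp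
  qed
  also have "\<dots> = (\<integral>x. G x \<bullet> h x \<partial>lborel)"
    using G(1) h(1) by (intro integral_completion) simp
  finally show ?thesis
    by (simp add: distr_div_def)
qed

section \<open>Mollification of Lipschitz functions\<close>

text \<open>The shift sits on \<open>\<phi>\<close>, which displays the derivative as an average of
  \<open>gradient\<close>; for smoothness, \<open>Ck_mollify\<close> moves it to
  \<open>\<eta>\<close>.\<close>

definition mollify :: "('a::euclidean_space \<Rightarrow> real) \<Rightarrow> ('a \<Rightarrow> real) \<Rightarrow> 'a \<Rightarrow> real" where
  "mollify \<eta> \<phi> x = (\<integral>y. \<eta> y * \<phi> (x - y) \<partial>lborel)"

locale mollified = Lipschitz_function \<phi> L for \<phi> :: "'a::euclidean_space \<Rightarrow> real" and L +
  fixes \<eta> :: "'a \<Rightarrow> real" and r :: real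
  assumes compact_supp: "compact (closure {x. \<phi> x \<noteq> 0})"
    and Ck_\<eta>: "\<And>k. Ck k \<eta>" and \<eta>_nonneg: "\<And>x. 0 \<le> \<eta> x" and \<eta>_supp: "\<And>x. r \<le> norm x \<Longrightarrow> \<eta> x = 0"
    and \<eta>_integrable: "integrable lborel \<eta>" and \<eta>_one: "(\<integral>x. \<eta> x \<partial>lborel) = 1"
begin

lemma \<eta>_measurable [measurable]: "\<eta> \<in> borel_measurable borel"
  by (rule borel_measurable_continuous_onI[OF Ck_continuous[OF Ck_\<eta>]])

lemma integrable_bounded_mult:
  fixes f :: "'a \<Rightarrow> 'b::{banach, second_countable_topology}"
  assumes "f \<in> borel_measurable borel" "\<And>x. norm (f x) \<le> C"
  shows "integrable lborel (\<lambda>y. \<eta> y *\<^sub>R f y)"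
proof (rule Bochner_Integration.integrable_bound)
  show "integrable lborel (\<lambda>y. C * \<eta> y)"
    using \<eta>_integrable by simp
  have "norm (\<eta> y *\<^sub>R f y) \<le> norm (C * \<eta> y)" for y
    using mult_left_mono[of "norm (f y)" "\<bar>C\<bar>" "\<eta> y"] assms(2)[of y] \<eta>_nonneg[of y]
    by (simp add: abs_mult mult.commute)
  then show "AE y in lborel. norm (\<eta> y *\<^sub>R f y) \<le> norm (C * \<eta> y)"
    by simp
qed (use assms in measurable)

lemma bounded_\<phi>: "\<exists>C. \<forall>x. \<bar>\<phi> x\<bar> \<le> C"
proof -
  have "\<phi> \<in> Lip_c UNIV"
    using lipschitz compact_supp by (auto simp: Lip_c_def compact_support_in_def)
  then show ?thesis
    using Lip_c_bounded by metis
qed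

lemma integrable_mollify: "integrable lborel (\<lambda>y. \<eta> y * \<phi> (x - y))"
proof -
  obtain C where "\<And>x. \<bar>\<phi> x\<bar> \<le> C"
    using bounded_\<phi> by blast
  then show ?thesis
    using integrable_bounded_mult[of "\<lambda>y. \<phi> (x - y)" C] by simp
qed

lemma mollify_close: "\<bar>mollify \<eta> \<phi> x - \<phi> x\<bar> \<le> L * r"
proof -
  have "mollify \<eta> \<phi> x - \<phi> x = (\<integral>y. \<eta> y * \<phi> (x - y) \<partial>lborel) - (\<integral>y. \<eta> y * \<phi> x \<partial>lborel)"
    using \<eta>_one by (simp add: mollify_def)
  also have "\<dots> = (\<integral>y. \<eta> y * (\<phi> (x - y) - \<phi> x) \<partial>lborel)"
    using integrable_mollify \<eta>_integrable by (simp add: right_diff_distrib)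
  finally have eq: "mollify \<eta> \<phi> x - \<phi> x = (\<integral>y. \<eta> y * (\<phi> (x - y) - \<phi> x) \<partial>lborel)" .
  have "\<bar>\<integral>y. \<eta> y * (\<phi> (x - y) - \<phi> x) \<partial>lborel\<bar> \<le> (\<integral>y. \<eta> y * (L * r) \<partial>lborel)"
  proof (rule integral_abs_bound_integral)
    show "integrable lborel (\<lambda>y. \<eta> y * (\<phi> (x - y) - \<phi> x))"
      using integrable_mollify[of x] \<eta>_integrable by (simp add: right_diff_distrib)
    fix y
    show "\<bar>\<eta> y * (\<phi> (x - y) - \<phi> x)\<bar> \<le> \<eta> y * (L * r)"
    proof (cases "norm y < r")
      case True
      have "\<bar>\<phi> (x - y) - \<phi> x\<bar> \<le> L * norm y"
        using lip[of "x - y" x] by simp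
      also have "\<dots> \<le> L * r"
        using True L_nonneg by (intro mult_left_mono) auto
      finally show ?thesis
        using \<eta>_nonneg[of y] by (simp add: abs_mult mult_left_mono)
    qed (use \<eta>_supp[of y] in simp)
  qed (use \<eta>_integrable in simp)
  then show ?thesis
    using \<eta>_one by (simp add: eq)
qed

lemma mollify_supp:
  assumes "mollify \<eta> \<phi> x \<noteq> 0"
  shows "x \<in> (\<Union>z\<in>closure {x. \<phi> x \<noteq> 0}. cball z r)"
proof (rule ccontr)
  assume x: "\<not> ?thesis"
  have "\<eta> y * \<phi> (x - y) = 0" for y
  proof (rule ccontr)
    assume "\<eta> y * \<phi> (x - y) \<noteq> 0"
    then have "x - y \<in> closure {x. \<phi> x \<noteq> 0}" "norm y < r"
      using \<eta>_supp[of y] closure_subset[of "{x. \<phi> x \<noteq> 0}"] by (auto simp: not_le[symmetric])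
    then have "x - y \<in> closure {x. \<phi> x \<noteq> 0}" "x \<in> cball (x - y) r"
      by (auto simp: dist_norm)
    then show False
      using x by blast
  qed
  then have "(\<lambda>y. \<eta> y * \<phi> (x - y)) = (\<lambda>y. 0)"
    by (rule ext)
  then have "mollify \<eta> \<phi> x = 0"
    unfolding mollify_def by (simp only: integral_zero)
  then show False
    using assms by simp
qed

text \<open>A change of variables puts the shift on \<open>\<eta>\<close>, and the compact support
  of \<open>\<phi>\<close> confines the integral to a fixed box, where \<open>Ck_convolution\<close>
  applies.\<close>

lemma Ck_mollify: "Ck k (mollify \<eta> \<phi>)"
proof -
  obtain a b where ab: "closure {x. \<phi> x \<noteq> 0} \<subseteq> cbox a b"
    using bounded_subset_cbox_symmetric[OF compact_imp_bounded[OF compact_supp]] by metis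
  have "mollify \<eta> \<phi> x = integral (cbox a b) (\<lambda>y. \<phi> y * \<eta> (x - y))" for x
  proof -
    have m: "(\<lambda>y. \<phi> y * \<eta> (x - y)) \<in> borel_measurable borel"
      by measurable
    have "mollify \<eta> \<phi> x = (\<integral>y. \<phi> y * \<eta> (x - y) \<partial>lborel)"
      using integral_lborel_diff[OF m, of x] by (simp add: mollify_def mult.commute)
    also have "\<dots> = (LINT y:cbox a b|lborel. \<phi> y * \<eta> (x - y))"
      unfolding set_lebesgue_integral_def
      by (intro Bochner_Integration.integral_cong refl)
        (use ab closure_subset[of "{x. \<phi> x \<noteq> 0}"] in \<open>auto simp: indicator_def\<close>)
    also have "\<dots> = integral (cbox a b) (\<lambda>y. \<phi> y * \<eta> (x - y))"
    proof (rule set_borel_integral_eq_integral)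
      have "continuous_on UNIV (\<lambda>y. \<eta> (x - y))"
        using continuous_on_compose2[OF Ck_continuous[OF Ck_\<eta>[of 0]], of UNIV "\<lambda>y. x - y"]
        by (simp add: continuous_intros)
      then have "continuous_on UNIV (\<lambda>y. \<phi> y * \<eta> (x - y))"
        using continuous by (intro continuous_on_mult) auto
      then show "set_integrable lborel (cbox a b) (\<lambda>y. \<phi> y * \<eta> (x - y))"
        unfolding set_integrable_def
        by (intro borel_integrable_compact compact_cbox) (auto intro: continuous_on_subset)
    qed
    finally show ?thesis .
  qed
  then have "mollify \<eta> \<phi> = (\<lambda>x. integral (cbox a b) (\<lambda>y. \<phi> y * \<eta> (x - y)))"
    by blast
  then show ?thesis
    using Ck_convolution[OF continuous Ck_\<eta>] by simp
qed

text \<open>Smoothness already provides a derivative; only its value has to be found. Difference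
  quotients commute with the convolution, converge almost everywhere by
  \<open>AE_has_ddir_inner_gradient\<close>, and are dominated by L |v| times
  \<open>\<eta>\<close>.\<close>

lemma gderiv_mollify: "GDERIV (mollify \<eta> \<phi>) x :> (\<integral>y. \<eta> y *\<^sub>R gradient (x - y) \<partial>lborel)"
proof -
  let ?D = "frechet_derivative (mollify \<eta> \<phi>) (at x)"
  have D: "(mollify \<eta> \<phi> has_derivative ?D) (at x)"
    using Ck_Suc_has_derivative[OF Ck_mollify[of "Suc 0"]] .
  have int: "integrable lborel (\<lambda>y. \<eta> y *\<^sub>R gradient (x - y))"
    by (rule integrable_bounded_mult[where C="real DIM('a) * L"]) (use norm_gradient_le in auto)
  have "?D v = v \<bullet> (\<integral>y. \<eta> y *\<^sub>R gradient (x - y) \<partial>lborel)" for v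
  proof (rule LIMSEQ_unique)
    have "has_ddir (mollify \<eta> \<phi>) v (?D v) x"
      unfolding has_ddir_def
    proof (intro allI impI)
      fix e :: real assume "0 < e"
      \<comment> \<open>The summand 1 takes care of \<open>v = 0\<close>.\<close>
      then have e: "0 < e / (norm v + 1)"
        by (simp add: add_nonneg_pos)
      obtain d where d: "0 < d" "\<And>y. norm (y - x) < d \<Longrightarrow>
          norm (mollify \<eta> \<phi> y - mollify \<eta> \<phi> x - ?D (y - x)) \<le> e / (norm v + 1) * norm (y - x)"
        using D e unfolding has_derivative_at_alt by metis
      interpret D: bounded_linear ?D
        using D by (rule has_derivative_bounded_linear)
      have "\<bar>mollify \<eta> \<phi> (x + t *\<^sub>R v) - mollify \<eta> \<phi> x - t * ?D v\<bar> \<le> e * t"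
        if t: "0 < t" "t < d / (norm v + 1)" for t
      proof -
        have pos: "0 < norm v + 1"
          by (simp add: add_nonneg_pos)
        have "t * norm v \<le> t * (norm v + 1)"
          using t(1) by simp
        also have "\<dots> < d"
          using t(2) pos by (simp add: pos_less_divide_eq)
        finally have "norm (x + t *\<^sub>R v - x) < d"
          using t(1) by simp
        from d(2)[OF this] have "\<bar>mollify \<eta> \<phi> (x + t *\<^sub>R v) - mollify \<eta> \<phi> x - t * ?D v\<bar> \<le> e / (norm v + 1) * (t * norm v)"
          using t(1) by (simp add: D.scaleR)
        also have "\<dots> = e * t * (norm v / (norm v + 1))"
          by simp
        also have "\<dots> \<le> e * t * 1"
          using \<open>0 < e\<close> t(1) pos by (intro mult_left_mono) auto
        finally show ?thesis
          by simp
      qed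
      then show "\<exists>\<delta>>0. \<forall>t. 0 < t \<and> t < \<delta> \<longrightarrow> \<bar>mollify \<eta> \<phi> (x + t *\<^sub>R v) - mollify \<eta> \<phi> x - t * ?D v\<bar> \<le> e * t"
        using d(1) by (intro exI[of _ "d / (norm v + 1)"]) (auto simp: add_nonneg_pos)
    qed
    then show "(\<lambda>k. dquot (mollify \<eta> \<phi>) v k x) \<longlonglongrightarrow> ?D v"
      by (rule has_ddir_imp_LIMSEQ)
    have eq: "dquot (mollify \<eta> \<phi>) v k x = (\<integral>y. \<eta> y * dquot \<phi> v k (x - y) \<partial>lborel)" for k
    proof -
      have "x + inverse (real (Suc k)) *\<^sub>R v - y = x - y + inverse (real (Suc k)) *\<^sub>R v" for y
        by simp
      then have "(\<integral>y. \<eta> y * dquot \<phi> v k (x - y) \<partial>lborel)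
          = (\<integral>y. real (Suc k) * (\<eta> y * \<phi> (x + inverse (real (Suc k)) *\<^sub>R v - y) - \<eta> y * \<phi> (x - y)) \<partial>lborel)"
        by (intro Bochner_Integration.integral_cong refl) (simp only: dquot_def algebra_simps)
      also have "\<dots> = dquot (mollify \<eta> \<phi>) v k x"
        using integrable_mollify by (simp add: dquot_def mollify_def)
      finally show ?thesis ..
    qed
    have "(\<lambda>k. \<integral>y. \<eta> y * dquot \<phi> v k (x - y) \<partial>lborel) \<longlonglongrightarrow> (\<integral>y. \<eta> y * (v \<bullet> gradient (x - y)) \<partial>lborel)"
    proof (rule integral_dominated_convergence[where w="\<lambda>y. \<eta> y * (L * norm v)"])
      have "AE z in distr lborel borel (\<lambda>y. x - y). has_ddir \<phi> v (v \<bullet> gradient z) z"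
        unfolding lborel_distr_diff by (rule AE_has_ddir_inner_gradient)
      then have "AE y in lborel. has_ddir \<phi> v (v \<bullet> gradient (x - y)) (x - y)"
        by (intro AE_distrD[where M'=borel and f="\<lambda>y. x - y"]) auto
      then show "AE y in lborel. (\<lambda>k. \<eta> y * dquot \<phi> v k (x - y)) \<longlonglongrightarrow> \<eta> y * (v \<bullet> gradient (x - y))"
        by (rule eventually_mono) (auto intro!: tendsto_mult_left has_ddir_imp_LIMSEQ)
      show "AE y in lborel. norm (\<eta> y * dquot \<phi> v k (x - y)) \<le> \<eta> y * (L * norm v)" for k
        using dquot_bound[of v k] \<eta>_nonneg by (auto simp: abs_mult intro!: mult_left_mono)
    qed (use \<eta>_integrable in auto)
    moreover have "(\<integral>y. \<eta> y * (v \<bullet> gradient (x - y)) \<partial>lborel) = v \<bullet> (\<integral>y. \<eta> y *\<^sub>R gradient (x - y) \<partial>lborel)"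
      using integral_inner_right[of v lborel "\<lambda>y. \<eta> y *\<^sub>R gradient (x - y)"] int by simp
    ultimately show "(\<lambda>k. dquot (mollify \<eta> \<phi>) v k x) \<longlonglongrightarrow> v \<bullet> (\<integral>y. \<eta> y *\<^sub>R gradient (x - y) \<partial>lborel)"
      by (simp add: eq)
  qed
  then have "?D = (\<lambda>v. v \<bullet> (\<integral>y. \<eta> y *\<^sub>R gradient (x - y) \<partial>lborel))"
    by blast
  then show ?thesis
    using D by (simp add: gderiv_def)
qed

text \<open>Fubini applies because the integrand is dominated by the product of |G x|, the bound on
  \<open>gradient\<close>, and \<eta> y.\<close>

lemma integral_inner_mollified_gradient:
  assumes G: "integrable lborel G"
  shows "(\<integral>x. G x \<bullet> (\<integral>y. \<eta> y *\<^sub>R gradient (x - y) \<partial>lborel) \<partial>lborel) =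
      (\<integral>y. \<eta> y * (\<integral>x. G x \<bullet> gradient (x - y) \<partial>lborel) \<partial>lborel)"
    and "integrable lborel (\<lambda>y. \<eta> y * (\<integral>x. G x \<bullet> gradient (x - y) \<partial>lborel))"
proof -
  have [measurable]: "G \<in> borel_measurable borel"
    using G by (simp add: borel_measurable_integrable)
  let ?C = "real DIM('a) * L"
  define f where "f x y = \<eta> y * (G x \<bullet> gradient (x - y))" for x y
  have bound: "norm (f x y) \<le> (norm (G x) * ?C) * \<eta> y" for x y
  proof -
    have "\<bar>G x \<bullet> gradient (x - y)\<bar> \<le> norm (G x) * ?C"
      using Cauchy_Schwarz_ineq2[of "G x" "gradient (x - y)"] mult_left_mono[OF norm_gradient_le[of "x - y"] norm_ge_zero[of "G x"]]
      by linarith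
    then show ?thesis
      using \<eta>_nonneg[of y] by (simp add: f_def abs_mult mult.commute mult_left_mono)
  qed
  have meas: "case_prod f \<in> borel_measurable (lborel \<Otimes>\<^sub>M lborel)"
    unfolding f_def[abs_def] by measurable
  have int2: "integrable lborel (f x)" for x
  proof (rule Bochner_Integration.integrable_bound)
    show "integrable lborel (\<lambda>y. (norm (G x) * ?C) * \<eta> y)"
      using \<eta>_integrable by simp
    show "AE y in lborel. norm (f x y) \<le> norm ((norm (G x) * ?C) * \<eta> y)"
      using bound[of x] by (auto intro: order_trans[OF _ abs_ge_self])
    show "f x \<in> borel_measurable lborel"
      unfolding f_def[abs_def] by measurable
  qed
  have int: "integrable (lborel \<Otimes>\<^sub>M lborel) (case_prod f)"
  proof (rule lborel_pair.Fubini_integrable[OF meas])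
    show "integrable lborel (\<lambda>x. \<integral>y. norm (case (x, y) of (x, y) \<Rightarrow> f x y) \<partial>lborel)"
    proof (rule Bochner_Integration.integrable_bound)
      show "integrable lborel (\<lambda>x. norm (G x) * ?C)"
        using G by simp
      have "norm (\<integral>y. norm (f x y) \<partial>lborel) \<le> norm (norm (G x) * ?C)" for x
      proof -
        have "(\<integral>y. norm (f x y) \<partial>lborel) \<le> (\<integral>y. (norm (G x) * ?C) * \<eta> y \<partial>lborel)"
          using int2[of x] \<eta>_integrable bound by (intro integral_mono) auto
        also have "\<dots> = norm (G x) * ?C"
          using \<eta>_one by simp
        finally show ?thesis
          by simp
      qed
      then show "AE x in lborel. norm (\<integral>y. norm (case (x, y) of (x, y) \<Rightarrow> f x y) \<partial>lborel) \<le> norm (norm (G x) * ?C)"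
        by simp
      show "(\<lambda>x. \<integral>y. norm (case (x, y) of (x, y) \<Rightarrow> f x y) \<partial>lborel) \<in> borel_measurable lborel"
        using meas by measurable
    qed
    show "AE x in lborel. integrable lborel (\<lambda>y. case (x, y) of (x, y) \<Rightarrow> f x y)"
      using int2 by simp
  qed
  have "(\<integral>x. G x \<bullet> (\<integral>y. \<eta> y *\<^sub>R gradient (x - y) \<partial>lborel) \<partial>lborel) = (\<integral>x. (\<integral>y. f x y \<partial>lborel) \<partial>lborel)"
  proof (intro Bochner_Integration.integral_cong refl)
    fix x
    have "integrable lborel (\<lambda>y. \<eta> y *\<^sub>R gradient (x - y))"
      by (rule integrable_bounded_mult[where C="?C"]) (use norm_gradient_le in auto)
    then show "G x \<bullet> (\<integral>y. \<eta> y *\<^sub>R gradient (x - y) \<partial>lborel) = (\<integral>y. f x y \<partial>lborel)"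
      using integral_inner_right[of "G x" lborel "\<lambda>y. \<eta> y *\<^sub>R gradient (x - y)"] by (simp add: f_def)
  qed
  also have "\<dots> = (\<integral>y. (\<integral>x. f x y \<partial>lborel) \<partial>lborel)"
    using lborel_pair.Fubini_integral[OF int] by simp
  finally show "(\<integral>x. G x \<bullet> (\<integral>y. \<eta> y *\<^sub>R gradient (x - y) \<partial>lborel) \<partial>lborel) =
      (\<integral>y. \<eta> y * (\<integral>x. G x \<bullet> gradient (x - y) \<partial>lborel) \<partial>lborel)"
    by (simp add: f_def)
  show "integrable lborel (\<lambda>y. \<eta> y * (\<integral>x. G x \<bullet> gradient (x - y) \<partial>lborel))"
    using lborel_pair.integrable_snd[OF int] by (simp add: f_def)
qed

text \<open>The mollified pairing is the \<open>\<eta>\<close>-weighted mean of the pairings with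
  \<open>gradient\<close> shifted by y, and only shifts of length below \<open>r\<close> carry
  weight.\<close>

lemma mollified_pairing_close:
  assumes G: "integrable lborel G"
    and close: "\<And>y. norm y < r \<Longrightarrow>
      \<bar>(\<integral>x. G x \<bullet> gradient (x - y) \<partial>lborel) - (\<integral>x. G x \<bullet> gradient x \<partial>lborel)\<bar> \<le> e"
  shows "\<bar>(\<integral>x. G x \<bullet> (\<integral>y. \<eta> y *\<^sub>R gradient (x - y) \<partial>lborel) \<partial>lborel) - (\<integral>x. G x \<bullet> gradient x \<partial>lborel)\<bar> \<le> e"
proof -
  define H where "H y = (\<integral>x. G x \<bullet> gradient (x - y) \<partial>lborel)" for y
  have i: "integrable lborel (\<lambda>y. \<eta> y * H y)"
    using integral_inner_mollified_gradient(2)[OF G] by (simp add: H_def)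
  have "(\<integral>y. \<eta> y * H y \<partial>lborel) - H 0 = (\<integral>y. \<eta> y * H y \<partial>lborel) - (\<integral>y. \<eta> y * H 0 \<partial>lborel)"
    using \<eta>_one by simp
  also have "\<dots> = (\<integral>y. \<eta> y * (H y - H 0) \<partial>lborel)"
    using i \<eta>_integrable by (simp add: right_diff_distrib)
  also have "\<bar>\<dots>\<bar> \<le> (\<integral>y. \<eta> y * e \<partial>lborel)"
  proof (rule integral_abs_bound_integral)
    show "integrable lborel (\<lambda>y. \<eta> y * (H y - H 0))"
      using i \<eta>_integrable by (simp add: right_diff_distrib)
    show "\<bar>\<eta> y * (H y - H 0)\<bar> \<le> \<eta> y * e" for y
    proof (cases "norm y < r")
      case True
      then show ?thesis
        using close[of y] \<eta>_nonneg[of y] by (simp add: abs_mult H_def mult_left_mono)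
    qed (use \<eta>_supp[of y] in simp)
  qed (use \<eta>_integrable in simp)
  also have "\<dots> = e"
    using \<eta>_one by simp
  finally show ?thesis
    using integral_inner_mollified_gradient(1)[OF G] by (simp add: H_def)
qed

end

context Lipschitz_function
begin

text \<open>\<open>gradient\<close> is merely bounded and measurable, so nothing can be said about
  its translates pointwise. Translation invariance moves the shift to the integrable
  \<open>G\<close>, where \<open>L1_translation_continuous\<close> applies.\<close>

lemma translated_pairing_LIMSEQ:
  assumes G: "integrable lborel G" and y: "y \<longlonglongrightarrow> 0"
  shows "(\<lambda>n. \<integral>x. G x \<bullet> gradient (x - y n) \<partial>lborel) \<longlonglongrightarrow> (\<integral>x. G x \<bullet> gradient x \<partial>lborel)"
proof -
  have [measurable]: "G \<in> borel_measurable borel"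
    using G by (simp add: borel_measurable_integrable)
  let ?C = "real DIM('a) * L"
  have int: "integrable lborel (\<lambda>x. g x \<bullet> gradient x)" if "integrable lborel g" for g
  proof (rule Bochner_Integration.integrable_bound)
    show "integrable lborel (\<lambda>x. norm (g x) * ?C)"
      using that by simp
    have "\<bar>g x \<bullet> gradient x\<bar> \<le> norm (g x) * ?C" for x
      using Cauchy_Schwarz_ineq2[of "g x" "gradient x"] mult_left_mono[OF norm_gradient_le[of x] norm_ge_zero[of "g x"]]
      by linarith
    then show "AE x in lborel. norm (g x \<bullet> gradient x) \<le> norm (norm (g x) * ?C)"
      by (auto intro: order_trans[OF _ abs_ge_self])
    show "(\<lambda>x. g x \<bullet> gradient x) \<in> borel_measurable lborel"
      using that by (simp add: borel_measurable_integrable)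
  qed
  show ?thesis
  proof (rule LIM_zero_cancel, rule Lim_null_comparison)
    show "(\<lambda>n. (\<integral>x. norm (G (x + y n) - G x) \<partial>lborel) * ?C) \<longlonglongrightarrow> 0"
      using tendsto_mult_right[OF L1_translation_continuous[OF G y], of ?C] by simp
    have "norm ((\<integral>x. G x \<bullet> gradient (x - y n) \<partial>lborel) - (\<integral>x. G x \<bullet> gradient x \<partial>lborel))
      \<le> (\<integral>x. norm (G (x + y n) - G x) \<partial>lborel) * ?C" for n
    proof -
      note Gt = integrable_lborel_translate[OF G, of "y n"]
      have "(\<integral>x. G x \<bullet> gradient (x - y n) \<partial>lborel) = (\<integral>x. G (x + y n) \<bullet> gradient x \<partial>lborel)"
        using integral_lborel_translate[of "\<lambda>x. G x \<bullet> gradient (x - y n)" "y n"] by simp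
      then have "(\<integral>x. G x \<bullet> gradient (x - y n) \<partial>lborel) - (\<integral>x. G x \<bullet> gradient x \<partial>lborel)
          = (\<integral>x. (G (x + y n) - G x) \<bullet> gradient x \<partial>lborel)"
        using int[OF G] int[OF Gt] by (simp add: inner_diff_left)
      also have "norm \<dots> \<le> (\<integral>x. norm (G (x + y n) - G x) * ?C \<partial>lborel)"
        unfolding real_norm_def
      proof (rule integral_abs_bound_integral)
        show "integrable lborel (\<lambda>x. (G (x + y n) - G x) \<bullet> gradient x)"
          using G Gt by (intro int) auto
        show "\<bar>(G (x + y n) - G x) \<bullet> gradient x\<bar> \<le> norm (G (x + y n) - G x) * ?C" for x
          using Cauchy_Schwarz_ineq2[of "G (x + y n) - G x" "gradient x"]
            mult_left_mono[OF norm_gradient_le[of x] norm_ge_zero[of "G (x + y n) - G x"]] by linarith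
      qed (use G Gt in simp)
      finally show ?thesis
        by simp
    qed
    then show "\<forall>\<^sub>F n in sequentially. norm ((\<integral>x. G x \<bullet> gradient (x - y n) \<partial>lborel) - (\<integral>x. G x \<bullet> gradient x \<partial>lborel))
      \<le> (\<integral>x. norm (G (x + y n) - G x) \<partial>lborel) * ?C"
      by simp
  qed
qed

lemma translated_pairing_eventually:
  assumes G: "integrable lborel G" and "0 < e"
  shows "\<exists>d>0. \<forall>y. norm y < d \<longrightarrow>
    \<bar>(\<integral>x. G x \<bullet> gradient (x - y) \<partial>lborel) - (\<integral>x. G x \<bullet> gradient x \<partial>lborel)\<bar> \<le> e"
proof -
  let ?H = "\<lambda>y. \<integral>x. G x \<bullet> gradient (x - y) \<partial>lborel"
  have "isCont ?H 0"
    unfolding continuous_at_sequentially using translated_pairing_LIMSEQ[OF G] by (simp add: o_def)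
  then obtain d where "0 < d" "\<And>y. dist y 0 < d \<Longrightarrow> dist (?H y) (?H 0) < e"
    using \<open>0 < e\<close> unfolding continuous_at_eps_delta by blast
  then show ?thesis
    by (intro exI[of _ d]) (auto simp: dist_real_def less_imp_le)
qed

end

theorem div_represented_by_Lip_c:
  assumes \<Omega>: "open \<Omega>" and F: "locally_integrable_on \<Omega> F" and \<mu>: "div_represented_by \<Omega> F \<mu>"
    and \<phi>: "\<phi> \<in> Lip_c \<Omega>"
  shows "distr_div \<Omega> F \<phi> = real_integral \<Omega> \<mu> \<phi>"
proof -
  interpret signed_measure \<Omega> \<mu>
    using \<mu> \<Omega> by unfold_locales (auto simp: div_represented_by_def)
  obtain L where "Lipschitz_function \<phi> L"
    using \<phi> by (rule Lip_cE)
  then interpret Lipschitz_function \<phi> L .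
  let ?K = "closure {x. \<phi> x \<noteq> 0}"
  note K = Lip_c_support[OF \<phi>]
  obtain \<rho> where \<rho>: "\<rho> > 0" "(\<Union>x\<in>?K. cball x \<rho>) \<subseteq> \<Omega>"
    using compact_subset_open_imp_cball_epsilon_subset[OF K(1) \<Omega> K(2)] by blast
  \<comment> \<open>One compact neighbourhood contains the supports of all mollifications used
    below, so \<open>F\<close> enters only through its integrable restriction to
    \<open>K'\<close>.\<close>
  define K' where "K' = (\<Union>x\<in>?K. cball x \<rho>)"
  have K': "compact K'" "K' \<subseteq> \<Omega>"
    using \<rho> compact_minkowski_sum_cball[OF K(1)] by (auto simp: K'_def)
  have "?K \<subseteq> K'"
    using \<rho>(1) by (auto simp: K'_def)
  have F': "set_integrable lebesgue K' F"
    using F K' by (auto simp: locally_integrable_on_def)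
  then have "(\<lambda>x. indicator K' x *\<^sub>R F x) \<in> borel_measurable lebesgue"
    unfolding set_integrable_def by (rule borel_measurable_integrable)
  then obtain G where G: "G \<in> borel_measurable borel" "AE x in lborel. indicator K' x *\<^sub>R F x = G x"
    using lebesgue_measurable_AE_eq_borel by blast
  have Gint: "integrable lborel G"
  proof -
    have "integrable lebesgue G"
    proof (rule integrable_cong_AE_imp)
      show "integrable lebesgue (\<lambda>x. indicat_real K' x *\<^sub>R F x)"
        using F' by (simp only: set_integrable_def)
      show "G \<in> borel_measurable lebesgue"
        using G(1) by (simp add: measurable_completion)
      show "AE x in lebesgue. indicat_real K' x *\<^sub>R F x = G x"
        using G(2) by (rule AE_completion)
    qed
    then show ?thesis
      using G(1) by (simp add: integrable_completion)
  qed
  let ?I = "\<integral>x. G x \<bullet> gradient x \<partial>lborel"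
  have div_\<phi>: "distr_div \<Omega> F \<phi> = - ?I"
    using G F' K'(2)
  proof (rule distr_div_eq_lborel)
    show "grad \<phi> x = 0" if "x \<notin> K'" for x
      using that \<open>?K \<subseteq> K'\<close> by (intro grad_outside_support) auto
  qed (use AE_grad_eq_gradient in auto)
  have "\<exists>d>0. \<forall>y. norm y < d \<longrightarrow>
    \<bar>(\<integral>x. G x \<bullet> gradient (x - y) \<partial>lborel) - ?I\<bar> \<le> inverse (real (Suc n))" for n
    using Gint by (rule translated_pairing_eventually) simp
  then obtain d where d: "\<And>n. 0 < d n" "\<And>n y. norm y < d n \<Longrightarrow>
      \<bar>(\<integral>x. G x \<bullet> gradient (x - y) \<partial>lborel) - ?I\<bar> \<le> inverse (real (Suc n))"
    by metis
  \<comment> \<open>\<open>d n\<close> controls the error of the pairing with \<open>F\<close>,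
    \<open>\<rho>\<close> keeps supports inside \<open>K'\<close>, and 1/(n+1) makes the
    mollifications converge uniformly for the pairing with \<open>\<mu>\<close>.\<close>
  define r where "r n = min (d n) (min \<rho> (inverse (real (Suc n))))" for n
  have r: "0 < r n" "r n \<le> d n" "r n \<le> \<rho>" "r n \<le> inverse (real (Suc n))" for n
    using d(1) \<rho>(1) by (auto simp: r_def)
  have "\<exists>\<eta>. mollified \<phi> L \<eta> (r n)" for n
  proof -
    obtain \<eta> :: "'a \<Rightarrow> real" where "(\<forall>k. Ck k \<eta>) \<and> (\<forall>x. 0 \<le> \<eta> x) \<and> (\<forall>x. r n \<le> norm x \<longrightarrow> \<eta> x = 0)
        \<and> integrable lborel \<eta> \<and> (\<integral>x. \<eta> x \<partial>lborel) = 1"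
      using exists_mollifier[OF r(1)] by blast
    then have "mollified \<phi> L \<eta> (r n)"
      using K(1) by unfold_locales auto
    then show ?thesis by blast
  qed
  then obtain \<eta> where \<eta>: "\<And>n. mollified \<phi> L (\<eta> n) (r n)"
    by metis
  define \<phi>' where "\<phi>' n = mollify (\<eta> n) \<phi>" for n
  have supp: "closure {x. \<phi>' n x \<noteq> 0} \<subseteq> K'" for n
  proof (rule closure_minimal)
    show "{x. \<phi>' n x \<noteq> 0} \<subseteq> K'"
    proof
      fix x assume "x \<in> {x. \<phi>' n x \<noteq> 0}"
      then have "x \<in> (\<Union>z\<in>?K. cball z (r n))"
        using mollified.mollify_supp[OF \<eta>] by (simp add: \<phi>'_def)
      then show "x \<in> K'"
        using subset_cball[OF r(3)[of n]] by (auto simp: K'_def simp del: mem_cball)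
    qed
    show "closed K'"
      using K'(1) by (rule compact_imp_closed)
  qed
  have "compact (closure {x. \<phi>' n x \<noteq> 0})" for n
    using supp[of n] K'(1) by (metis closed_closure compact_Int_closed inf.absorb_iff2)
  then have \<phi>'_C: "\<phi>' n \<in> Cinf_c \<Omega>" for n
    using supp[of n] K'(2) mollified.Ck_mollify[OF \<eta>] by (auto simp: Cinf_c_def compact_support_in_def \<phi>'_def)
  let ?g = "\<lambda>n x. \<integral>y. \<eta> n y *\<^sub>R gradient (x - y) \<partial>lborel"
  have grad': "grad (\<phi>' n) x = ?g n x" for n x
    unfolding \<phi>'_def by (rule grad_eqI[OF mollified.gderiv_mollify[OF \<eta>]])
  have "distr_div \<Omega> F (\<phi>' n) = - (\<integral>x. G x \<bullet> ?g n x \<partial>lborel)" for n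
    using G F' K'(2)
  proof (rule distr_div_eq_lborel)
    show "grad (\<phi>' n) x = 0" if "x \<notin> K'" for x
      using that supp by (intro grad_outside_support) auto
    have [measurable]: "\<eta> n \<in> borel_measurable borel"
      by (rule mollified.\<eta>_measurable[OF \<eta>])
    show "?g n \<in> borel_measurable borel"
      by measurable
  qed (simp add: grad')
  then have "\<bar>distr_div \<Omega> F (\<phi>' n) - distr_div \<Omega> F \<phi>\<bar> \<le> inverse (real (Suc n))" for n
    using mollified.mollified_pairing_close[OF \<eta> Gint, of n "inverse (real (Suc n))"] d(2)[of _ n] r(2)[of n]
    by (simp add: div_\<phi> abs_minus_commute)
  then have "(\<lambda>n. distr_div \<Omega> F (\<phi>' n)) \<longlonglongrightarrow> distr_div \<Omega> F \<phi>"
    by (intro LIM_zero_cancel[OF Lim_null_comparison[OF _ LIMSEQ_inverse_real_of_nat]]) auto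
  moreover have "distr_div \<Omega> F (\<phi>' n) = real_integral \<Omega> \<mu> (\<phi>' n)" for n
    using \<mu> \<phi>'_C by (auto simp: div_represented_by_def)
  moreover have "(\<lambda>n. real_integral \<Omega> \<mu> (\<phi>' n)) \<longlonglongrightarrow> real_integral \<Omega> \<mu> \<phi>"
  proof -
    obtain C where C: "\<And>x. \<bar>\<phi> x\<bar> \<le> C"
      using \<phi> Lip_c_bounded by metis
    have close: "\<bar>\<phi>' n x - \<phi> x\<bar> \<le> L * inverse (real (Suc n))" for n x
      using mollified.mollify_close[OF \<eta>, of n x] mult_left_mono[OF r(4)[of n] L_nonneg] by (simp add: \<phi>'_def)
    show ?thesis
    proof (rule real_integral_LIMSEQ)
      show "\<phi>' n \<in> borel_measurable borel" for n
        using \<phi>'_C[of n] Cinf_c_subset_Lip_c Lip_c_measurable by blast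
      have "L * inverse (real (Suc n)) \<le> L" for n
        using L_nonneg by (simp add: mult_left_le inverse_le_1_iff)
      then show "\<bar>\<phi>' n x\<bar> \<le> C + L" for n x
        using close[of n x] C[of x] by (smt (verit))
      show "(\<lambda>n. \<phi>' n x) \<longlonglongrightarrow> \<phi> x" for x
      proof (rule LIM_zero_cancel, rule Lim_null_comparison)
        show "(\<lambda>n. L * inverse (real (Suc n))) \<longlonglongrightarrow> 0"
          using tendsto_mult_left[OF LIMSEQ_inverse_real_of_nat, of L] by simp
      qed (use close in simp)
    qed simp
  qed
  ultimately show ?thesis
    using LIMSEQ_unique by simp
qed

section \<open>Cutoffs with small gradient around compact sets\<close>

text \<open>A covering set may have diameter 0, but a ball needs a positive radius, so the radius
  slightly exceeds the diameter. For s > 0 continuity of the power keeps the extra cost below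
  \<open>e\<close>; for s = 0 every positive radius contributes 1, as in
  \<open>hausdorff_weight\<close>.\<close>

lemma exists_radius:
  fixes s d e \<delta> :: real
  assumes "0 \<le> s" "0 \<le> d" "0 < e" "0 < \<delta>"
  shows "\<exists>r>d. r < d + \<delta> \<and> r powr s \<le> (if s = 0 then 1 else d powr s) + e"
proof (cases "s = 0")
  case True
  then show ?thesis
    using assms by (intro exI[of _ "d + \<delta> / 2"]) auto
next
  case False
  have "((\<lambda>r. r powr s) \<longlongrightarrow> d powr s) (at_right d)"
  proof (rule tendsto_powr')
    have "\<forall>\<^sub>F r in at_right d. 0 \<le> r"
      using eventually_at_right_less[of d] assms(2) by (auto elim: eventually_mono)
    then show "d \<noteq> 0 \<or> 0 < s \<and> (\<forall>\<^sub>F r in at_right d. 0 \<le> r)"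
      using False assms(1) by simp
  qed (auto intro!: tendsto_intros)
  then have "\<forall>\<^sub>F r in at_right d. r powr s < d powr s + e"
    using assms(3) by (intro order_tendstoD(2)) auto
  moreover have "\<forall>\<^sub>F r in at_right d. r < d + \<delta>"
    using assms(4) by (auto simp: eventually_at_right_field intro!: exI[of _ "d + \<delta>"])
  ultimately have "\<forall>\<^sub>F r in at_right d. d < r \<and> r < d + \<delta> \<and> r powr s < d powr s + e"
    using eventually_at_right_less[of d] by eventually_elim simp
  then have "\<exists>r. d < r \<and> r < d + \<delta> \<and> r powr s < d powr s + e"
    by (rule eventually_happens'[OF trivial_limit_at_right_real])
  then obtain r where "d < r" "r < d + \<delta>" "r powr s < d powr s + e"
    by (elim exE conjE)
  then show ?thesis
    using False by (intro exI[of _ r]) auto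
qed

text \<open>Each covering set that meets \<open>K\<close> lies in an open ball centred in
  \<open>K\<close> of radius just above its diameter, and compactness selects finitely many. The
  factor \<open>2 powr s / unit_ball_vol s\<close> undoes the normalisation of
  \<open>hausdorff_weight\<close>; the summand 1 pays for enlarging the radii.\<close>

lemma hausdorff_ball_cover:
  fixes K :: "'a::euclidean_space set"
  assumes K: "compact K" and s: "0 \<le> s" and H: "hausdorff s K < ennreal M" and \<delta>: "0 < \<delta>"
  obtains J :: "nat set" and c :: "nat \<Rightarrow> 'a" and r :: "nat \<Rightarrow> real" where
    "finite J" "K \<subseteq> (\<Union>i\<in>J. ball (c i) (r i))"
    "\<And>i. i \<in> J \<Longrightarrow> c i \<in> K" "\<And>i. i \<in> J \<Longrightarrow> 0 < r i" "\<And>i. i \<in> J \<Longrightarrow> r i \<le> 2 * \<delta>"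
    "(\<Sum>i\<in>J. r i powr s) \<le> (2 powr s / unit_ball_vol s + 1) * M"
proof -
  have M: "0 < M"
    using H by (metis ennreal_less_zero_iff gr_implies_not_zero linorder_not_le zero_less_iff_neq_zero)
  have "hausdorff_content \<delta> s K \<le> hausdorff s K"
    unfolding hausdorff_def using \<delta> by (intro SUP_upper) auto
  then have "hausdorff_content \<delta> s K < ennreal M"
    using H by (rule order_le_less_trans)
  then obtain C :: "nat \<Rightarrow> 'a set" where C: "K \<subseteq> (\<Union>i. C i)" "\<And>i. bounded (C i)" "\<And>i. diameter (C i) \<le> \<delta>"
      and sum: "(\<Sum>i. ennreal (hausdorff_weight s (C i))) < ennreal M"
    unfolding hausdorff_content_def INF_less_iff by blast
  \<comment> \<open>Sets missing \<open>K\<close> are dropped so that centres can be taken in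
    \<open>K\<close>; this keeps the supports of the later cutoffs near \<open>K\<close>.\<close>
  define I where "I = {i. C i \<inter> K \<noteq> {}}"
  have "\<forall>i. \<exists>x. i \<in> I \<longrightarrow> x \<in> C i \<inter> K"
    by (auto simp: I_def)
  then obtain c where c: "\<And>i. i \<in> I \<Longrightarrow> c i \<in> C i" "\<And>i. i \<in> I \<Longrightarrow> c i \<in> K"
    by (metis IntD1 IntD2)
  \<comment> \<open>The allowances M/2^(i+1) add up to at most M over any set of indices.\<close>
  have "\<exists>r>diameter (C i). r < diameter (C i) + \<delta> \<and>
      r powr s \<le> (if s = 0 then 1 else diameter (C i) powr s) + M * (1 / 2) ^ Suc i" for i
    using s \<delta> M diameter_ge_0[OF C(2)] by (intro exists_radius) auto
  then obtain r where r: "\<And>i. diameter (C i) < r i" "\<And>i. r i < diameter (C i) + \<delta>"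
      "\<And>i. r i powr s \<le> (if s = 0 then 1 else diameter (C i) powr s) + M * (1 / 2) ^ Suc i"
    by metis
  have r0: "0 < r i" for i
    using r(1)[of i] diameter_ge_0[OF C(2)[of i]] by linarith
  have sub: "C i \<subseteq> ball (c i) (r i)" if "i \<in> I" for i
  proof
    fix x assume "x \<in> C i"
    then have "dist (c i) x \<le> diameter (C i)"
      using diameter_bounded_bound[OF C(2) c(1)[OF that]] by blast
    then show "x \<in> ball (c i) (r i)"
      using r(1)[of i] by simp
  qed
  have "K \<subseteq> (\<Union>i\<in>I. ball (c i) (r i))"
  proof
    fix x assume x: "x \<in> K"
    then obtain i where "x \<in> C i"
      using C(1) by blast
    moreover have "i \<in> I"
      using calculation x by (auto simp: I_def)
    ultimately show "x \<in> (\<Union>i\<in>I. ball (c i) (r i))"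
      using sub by blast
  qed
  then obtain J where J: "J \<subseteq> I" "finite J" "K \<subseteq> (\<Union>i\<in>J. ball (c i) (r i))"
    using compactE_image[OF K, of I "\<lambda>i. ball (c i) (r i)"] by auto
  have vol: "0 < unit_ball_vol s"
    using s by simp
  have w0: "0 \<le> hausdorff_weight s (C i)" for i
    using vol by (auto simp: hausdorff_weight_def)
  have weight: "(if s = 0 then 1 else diameter (C i) powr s) = 2 powr s / unit_ball_vol s * hausdorff_weight s (C i)"
    if "i \<in> I" for i
  proof -
    have "C i \<noteq> {}"
      using that by (auto simp: I_def)
    then show ?thesis
      using vol diameter_ge_0[OF C(2)[of i]] by (auto simp: hausdorff_weight_def powr_divide unit_ball_vol_0)
  qed
  have "ennreal (\<Sum>i\<in>J. hausdorff_weight s (C i)) = (\<Sum>i\<in>J. ennreal (hausdorff_weight s (C i)))"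
    using w0 by (simp add: sum_ennreal)
  also have "\<dots> \<le> (\<Sum>i. ennreal (hausdorff_weight s (C i)))"
    using J(2) by (intro sum_le_suminf) auto
  also have "\<dots> \<le> ennreal M"
    using sum by simp
  finally have sw: "(\<Sum>i\<in>J. hausdorff_weight s (C i)) \<le> M"
    using M by (simp add: ennreal_le_iff)
  have "(\<Sum>i\<in>J. (1 / 2) ^ Suc i) \<le> (\<Sum>i. (1 / 2 :: real) ^ Suc i)"
    using J(2) by (intro sum_le_suminf) (auto simp: power_half_series sums_summable)
  also have "\<dots> = 1"
    using power_half_series by (rule sums_unique[symmetric])
  finally have geo: "(\<Sum>i\<in>J. (1 / 2) ^ Suc i) \<le> (1 :: real)" .
  have "(\<Sum>i\<in>J. r i powr s) \<le> (\<Sum>i\<in>J. 2 powr s / unit_ball_vol s * hausdorff_weight s (C i) + M * (1 / 2) ^ Suc i)"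
  proof (rule sum_mono)
    fix i assume "i \<in> J"
    then have "i \<in> I"
      using J(1) by blast
    from r(3)[of i, unfolded weight[OF this]]
    show "r i powr s \<le> 2 powr s / unit_ball_vol s * hausdorff_weight s (C i) + M * (1 / 2) ^ Suc i" .
  qed
  also have "\<dots> = 2 powr s / unit_ball_vol s * (\<Sum>i\<in>J. hausdorff_weight s (C i)) + M * (\<Sum>i\<in>J. (1 / 2) ^ Suc i)"
    by (simp only: sum.distrib sum_distrib_left)
  also have "\<dots> \<le> 2 powr s / unit_ball_vol s * M + M * 1"
    using sw geo vol M by (intro add_mono mult_left_mono) auto
  finally have le: "(\<Sum>i\<in>J. r i powr s) \<le> (2 powr s / unit_ball_vol s + 1) * M"
    by (simp only: distrib_right mult_1_left mult_1_right)
  have "r i \<le> 2 * \<delta>" for i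
    using r(2)[of i] C(3)[of i] by simp
  then show thesis
    using J(1) by (intro that[OF J(2,3) _ _ _ le] c(2) r0) auto
qed

section \<open>Cutoffs attached to a finite ball cover\<close>

definition ball_cutoff :: "'a::metric_space \<Rightarrow> real \<Rightarrow> 'a \<Rightarrow> real" where
  "ball_cutoff c r x = max 0 (min 1 (2 - dist c x / r))"

lemma ball_cutoff_bounds: "0 \<le> ball_cutoff c r x" "ball_cutoff c r x \<le> 1"
  by (auto simp: ball_cutoff_def)

lemma ball_cutoff_one: "0 < r \<Longrightarrow> x \<in> ball c r \<Longrightarrow> ball_cutoff c r x = 1"
  by (auto simp: ball_cutoff_def field_simps min_def)

lemma ball_cutoff_zero: "0 < r \<Longrightarrow> 2 * r \<le> dist c x \<Longrightarrow> ball_cutoff c r x = 0"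
  by (auto simp: ball_cutoff_def field_simps max_def min_def)

lemma ball_cutoff_lipschitz:
  assumes "0 < r"
  shows "\<bar>ball_cutoff c r x - ball_cutoff c r y\<bar> \<le> inverse r * dist x y"
proof -
  have "\<bar>ball_cutoff c r x - ball_cutoff c r y\<bar> \<le> \<bar>dist c x / r - dist c y / r\<bar>"
    unfolding ball_cutoff_def by linarith
  also have "\<dots> = inverse r * \<bar>dist c x - dist c y\<bar>"
  proof -
    have "dist c x / r - dist c y / r = inverse r * (dist c x - dist c y)"
      by (simp add: divide_inverse algebra_simps)
    then show ?thesis
      using assms by (simp only: abs_mult) simp
  qed
  also have "\<dots> \<le> inverse r * dist x y"
    using assms abs_dist_diff_le[of x c y] by (intro mult_left_mono) (auto simp: dist_commute)
  finally show ?thesis .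
qed

text \<open>With a maximum instead of a sum, the values stay at most 1 and overlapping balls do not
  add up their gradients. The inserted 0 gives a value for empty \<open>J\<close>.\<close>

definition cover_cutoff :: "nat set \<Rightarrow> (nat \<Rightarrow> 'a::metric_space) \<Rightarrow> (nat \<Rightarrow> real) \<Rightarrow> 'a \<Rightarrow> real" where
  "cover_cutoff J c r x = Max (insert 0 ((\<lambda>i. ball_cutoff (c i) (r i) x) ` J))"

lemma cover_cutoff_bounds:
  assumes "finite J"
  shows "0 \<le> cover_cutoff J c r x" "cover_cutoff J c r x \<le> 1"
  using assms ball_cutoff_bounds(2) by (auto simp: cover_cutoff_def)

text \<open>Used twice: with the sum of all 1/r i for a global Lipschitz constant, and near a point
  with the largest 1/r i among the balls that matter there.\<close>

lemma cover_cutoff_diff_le: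
  assumes J: "finite J" and "0 \<le> B" "\<And>i. i \<in> J \<Longrightarrow> \<bar>ball_cutoff (c i) (r i) x - ball_cutoff (c i) (r i) y\<bar> \<le> B"
  shows "\<bar>cover_cutoff J c r x - cover_cutoff J c r y\<bar> \<le> B"
proof -
  have *: "cover_cutoff J c r x \<le> cover_cutoff J c r y + B"
    if "\<And>i. i \<in> J \<Longrightarrow> \<bar>ball_cutoff (c i) (r i) x - ball_cutoff (c i) (r i) y\<bar> \<le> B" for x y
  proof -
    have "ball_cutoff (c i) (r i) y \<le> cover_cutoff J c r y" if "i \<in> J" for i
      unfolding cover_cutoff_def using J that by (intro Max_ge) auto
    then have "ball_cutoff (c i) (r i) x \<le> cover_cutoff J c r y + B" if "i \<in> J" for i
      using that \<open>\<And>i. i \<in> J \<Longrightarrow> \<bar>ball_cutoff (c i) (r i) x - ball_cutoff (c i) (r i) y\<bar> \<le> B\<close>[OF that]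
      by (smt (verit))
    moreover have "0 \<le> cover_cutoff J c r y + B"
      using cover_cutoff_bounds(1)[OF J] \<open>0 \<le> B\<close> by (rule add_nonneg_nonneg)
    ultimately show ?thesis
      unfolding cover_cutoff_def[of J c r x] using J by (subst Max_le_iff) auto
  qed
  show ?thesis
    using *[of x y] *[of y x] assms(3) by (simp add: abs_minus_commute abs_le_iff)
qed

locale ball_cover =
  fixes J :: "nat set" and c :: "nat \<Rightarrow> 'a::euclidean_space" and r :: "nat \<Rightarrow> real"
  assumes finite: "finite J" and r_pos: "\<And>i. i \<in> J \<Longrightarrow> 0 < r i"
begin

abbreviation "\<phi> \<equiv> cover_cutoff J c r"

lemma lipschitz: "\<exists>L. L-lipschitz_on UNIV \<phi>"
proof -
  define L where "L = (\<Sum>i\<in>J. inverse (r i))"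
  have L: "inverse (r i) \<le> L" if "i \<in> J" for i
    unfolding L_def using finite r_pos that by (intro member_le_sum) (auto intro: less_imp_le)
  have L0: "0 \<le> L"
    unfolding L_def using r_pos by (intro sum_nonneg) (auto intro: less_imp_le)
  have "\<bar>\<phi> x - \<phi> y\<bar> \<le> L * dist x y" for x y
  proof (rule cover_cutoff_diff_le[OF finite])
    show "\<bar>ball_cutoff (c i) (r i) x - ball_cutoff (c i) (r i) y\<bar> \<le> L * dist x y" if "i \<in> J" for i
      using ball_cutoff_lipschitz[OF r_pos[OF that], of "c i" x y] mult_right_mono[OF L[OF that], of "dist x y"] by simp
  qed (use L0 in simp)
  then have "L-lipschitz_on UNIV \<phi>"
    using L0 by (intro lipschitz_onI) (auto simp: dist_real_def)
  then show ?thesis ..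
qed

lemma one_on_cover: "x \<in> (\<Union>i\<in>J. ball (c i) (r i)) \<Longrightarrow> \<phi> x = 1"
proof -
  assume "x \<in> (\<Union>i\<in>J. ball (c i) (r i))"
  then obtain i where "i \<in> J" "ball_cutoff (c i) (r i) x = 1"
    using ball_cutoff_one r_pos by blast
  then have "1 \<le> \<phi> x"
    unfolding cover_cutoff_def using finite by (intro Max_ge) (auto simp: image_iff)
  then show ?thesis
    using cover_cutoff_bounds(2)[OF finite] by (intro antisym)
qed

lemma grad_zero_on_cover: "x \<in> (\<Union>i\<in>J. ball (c i) (r i)) \<Longrightarrow> grad \<phi> x = 0"
  using norm_grad_le_local[of "\<Union>i\<in>J. ball (c i) (r i)" x 0 \<phi>] one_on_cover by auto

lemma nonzero_imp_near:
  assumes "\<phi> x \<noteq> 0"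
  shows "\<exists>i\<in>J. dist (c i) x < 2 * r i"
proof (rule ccontr)
  assume "\<not> ?thesis"
  then have "ball_cutoff (c i) (r i) x = 0" if "i \<in> J" for i
    using that r_pos ball_cutoff_zero by (meson not_less)
  then have "insert 0 ((\<lambda>i. ball_cutoff (c i) (r i) x) ` J) = {0}"
    by auto
  then show False
    using assms unfolding cover_cutoff_def by (simp only: Max_singleton)
qed

text \<open>Near x only cutoffs whose closed doubled ball contains x can vary, so the largest 1/r i
  among them bounds the gradient. The q-th power of this maximum is one term of the sum.\<close>

lemma norm_grad_powr_le:
  assumes "0 < q"
  shows "norm (grad \<phi> x) powr q \<le> (\<Sum>i\<in>J. indicator (cball (c i) (2 * r i)) x * r i powr (- q))"
proof -
  define A where "A = {i\<in>J. dist (c i) x \<le> 2 * r i}"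
  define B where "B = Max (insert 0 ((\<lambda>i. inverse (r i)) ` A))"
  \<comment> \<open>An open neighbourhood of x, since finitely many closed balls are removed; the
    cutoffs with index outside \<open>A\<close> vanish on all of it.\<close>
  define U where "U = (\<Inter>i\<in>J - A. - cball (c i) (2 * r i))"
  have A: "finite A" "A \<subseteq> J"
    using finite by (auto simp: A_def)
  have U: "open U" "x \<in> U"
    using finite by (auto simp: U_def A_def intro!: open_INT)
  have B0: "0 \<le> B"
    unfolding B_def using A by (intro Max_ge) auto
  have "norm (grad \<phi> x) \<le> B"
  proof (rule norm_grad_le_local[OF U B0])
    fix y assume y: "y \<in> U"
    show "\<bar>\<phi> y - \<phi> x\<bar> \<le> B * norm (y - x)"
    proof (rule cover_cutoff_diff_le[OF finite])
      fix i assume i: "i \<in> J"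
      show "\<bar>ball_cutoff (c i) (r i) y - ball_cutoff (c i) (r i) x\<bar> \<le> B * norm (y - x)"
      proof (cases "i \<in> A")
        case True
        then have "inverse (r i) \<le> B"
          unfolding B_def using A by (intro Max_ge) auto
        from mult_right_mono[OF this, of "norm (y - x)"] show ?thesis
          using ball_cutoff_lipschitz[OF r_pos[OF i], of "c i" y x] by (simp add: dist_norm)
      next
        case False
        then have "\<not> dist (c i) x \<le> 2 * r i"
          using i by (simp add: A_def)
        moreover have "y \<in> - cball (c i) (2 * r i)"
          using y False i unfolding U_def by blast
        ultimately have "ball_cutoff (c i) (r i) x = 0" "ball_cutoff (c i) (r i) y = 0"
          by (auto intro!: ball_cutoff_zero[OF r_pos[OF i]])
        then show ?thesis
          using B0 by simp
      qed
    qed (use B0 in simp)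
  qed
  then have "norm (grad \<phi> x) powr q \<le> B powr q"
    using assms by (intro powr_mono2) auto
  also have "\<dots> \<le> (\<Sum>i\<in>J. indicator (cball (c i) (2 * r i)) x * r i powr (- q))"
  proof (cases "B = 0")
    case False
    have "B \<in> insert 0 ((\<lambda>i. inverse (r i)) ` A)"
      unfolding B_def using A by (intro Max_in) auto
    then obtain i where i: "i \<in> A" "B = inverse (r i)"
      using False by auto
    then have "i \<in> J" "x \<in> cball (c i) (2 * r i)"
      by (auto simp: A_def)
    then have "B powr q = indicator (cball (c i) (2 * r i)) x * r i powr (- q)"
      using r_pos[of i] i(2) by (simp add: powr_minus inverse_powr)
    also have "\<dots> \<le> (\<Sum>i\<in>J. indicator (cball (c i) (2 * r i)) x * r i powr (- q))"
      using finite \<open>i \<in> J\<close> by (intro member_le_sum) auto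
    finally show ?thesis .
  qed (auto intro!: sum_nonneg)
  finally show ?thesis .
qed

text \<open>The doubled ball has volume 2^n r^n times that of the unit ball; multiplied by r^(-q)
  this leaves r^(n-q), the quantity that Hausdorff measure of dimension n - q controls.\<close>

lemma integral_powr_bound:
  shows "integrable lborel (\<lambda>x. \<Sum>i\<in>J. indicator (cball (c i) (2 * r i)) x * r i powr (- q))"
    and "(\<integral>x. (\<Sum>i\<in>J. indicator (cball (c i) (2 * r i)) x * r i powr (- q)) \<partial>lborel)
      = unit_ball_vol (real DIM('a)) * 2 ^ DIM('a) * (\<Sum>i\<in>J. r i powr (real DIM('a) - q))"
proof -
  have int: "integrable lborel (indicator (cball (c i) (2 * r i)) :: 'a \<Rightarrow> real)" for i
    using emeasure_lborel_cball_finite by (intro integrable_real_indicator) (auto simp: less_top)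
  then show "integrable lborel (\<lambda>x. \<Sum>i\<in>J. indicator (cball (c i) (2 * r i)) x * r i powr (- q))"
    by (intro Bochner_Integration.integrable_sum) auto
  have "(\<integral>x. (\<Sum>i\<in>J. indicator (cball (c i) (2 * r i)) x * r i powr (- q)) \<partial>lborel)
      = (\<Sum>i\<in>J. measure lborel (cball (c i) (2 * r i)) * r i powr (- q))"
    using int by (subst Bochner_Integration.integral_sum) auto
  also have "\<dots> = (\<Sum>i\<in>J. unit_ball_vol (real DIM('a)) * 2 ^ DIM('a) * r i powr (real DIM('a) - q))"
  proof (rule sum.cong[OF refl])
    fix i assume "i \<in> J"
    then have "r i ^ DIM('a) * r i powr (- q) = r i powr (real DIM('a) - q)" "0 < r i"
      using r_pos[of i] by (simp_all add: powr_realpow[symmetric] flip: powr_add)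
    then show "measure lborel (cball (c i) (2 * r i)) * r i powr (- q) =
        unit_ball_vol (real DIM('a)) * 2 ^ DIM('a) * r i powr (real DIM('a) - q)"
      by (simp add: content_cball power_mult_distrib)
  qed
  finally show "(\<integral>x. (\<Sum>i\<in>J. indicator (cball (c i) (2 * r i)) x * r i powr (- q)) \<partial>lborel)
      = unit_ball_vol (real DIM('a)) * 2 ^ DIM('a) * (\<Sum>i\<in>J. r i powr (real DIM('a) - q))"
    by (simp add: sum_distrib_left)
qed

end

text \<open>\<open>\<psi>\<close> is an explicit majorant, the sum over the doubled balls. Estimates
  through \<open>\<psi>\<close> never have to integrate a power of \<open>grad \<phi>\<close>
  itself. Its bound does not involve \<open>\<delta>\<close>, which is decisive for finite
  p.\<close>

lemma hausdorff_cutoff: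
  fixes K :: "'a::euclidean_space set"
  assumes K: "compact K" and q: "0 < q" "q \<le> real DIM('a)"
    and H: "hausdorff (real DIM('a) - q) K < ennreal M" and \<delta>: "0 < \<delta>"
  obtains \<phi> \<psi> :: "'a \<Rightarrow> real" where
    "\<exists>L. L-lipschitz_on UNIV \<phi>" "\<And>x. 0 \<le> \<phi> x" "\<And>x. \<phi> x \<le> 1" "\<And>x. x \<in> K \<Longrightarrow> \<phi> x = 1"
    "{x. \<phi> x \<noteq> 0} \<subseteq> (\<Union>z\<in>K. cball z \<delta>)" "\<And>x. x \<in> K \<Longrightarrow> grad \<phi> x = 0"
    "integrable lborel \<psi>" "\<And>x. norm (grad \<phi> x) powr q \<le> \<psi> x"
    "(\<integral>x. \<psi> x \<partial>lborel) \<le> unit_ball_vol (real DIM('a)) * 2 ^ DIM('a)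
        * ((2 powr (real DIM('a) - q) / unit_ball_vol (real DIM('a) - q) + 1) * M)"
proof -
  \<comment> \<open>At scale \<open>\<delta> / 4\<close> the radii are at most
    \<open>\<delta> / 2\<close>, so the doubled balls stay within distance \<open>\<delta>\<close>
    of \<open>K\<close>.\<close>
  obtain J :: "nat set" and c :: "nat \<Rightarrow> 'a" and r where J: "finite J" "K \<subseteq> (\<Union>i\<in>J. ball (c i) (r i))"
    and c: "\<And>i. i \<in> J \<Longrightarrow> c i \<in> K" and r: "\<And>i. i \<in> J \<Longrightarrow> 0 < r i" "\<And>i. i \<in> J \<Longrightarrow> r i \<le> 2 * (\<delta> / 4)"
    and sum: "(\<Sum>i\<in>J. r i powr (real DIM('a) - q)) \<le>
      (2 powr (real DIM('a) - q) / unit_ball_vol (real DIM('a) - q) + 1) * M"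
  proof (rule hausdorff_ball_cover[OF K _ H, of "\<delta> / 4"])
    show "0 \<le> real DIM('a) - q" "0 < \<delta> / 4"
      using q \<delta> by simp_all
  qed blast
  interpret ball_cover J c r
    using J(1) r(1) by unfold_locales
  show thesis
  proof (rule that[OF lipschitz])
    show "{x. \<phi> x \<noteq> 0} \<subseteq> (\<Union>z\<in>K. cball z \<delta>)"
    proof
      fix x assume "x \<in> {x. \<phi> x \<noteq> 0}"
      then obtain i where i: "i \<in> J" "dist (c i) x < 2 * r i"
        using nonzero_imp_near by blast
      then have "x \<in> cball (c i) \<delta>"
        using r(2)[OF i(1)] by simp
      then show "x \<in> (\<Union>z\<in>K. cball z \<delta>)"
        using c[OF i(1)] by blast
    qed
    show "norm (grad \<phi> x) powr q \<le> (\<Sum>i\<in>J. indicator (cball (c i) (2 * r i)) x * r i powr (- q))" for x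
      using q(1) by (rule norm_grad_powr_le)
    show "integrable lborel (\<lambda>x. \<Sum>i\<in>J. indicator (cball (c i) (2 * r i)) x * r i powr (- q))"
      by (rule integral_powr_bound)
    show "(\<integral>x. (\<Sum>i\<in>J. indicator (cball (c i) (2 * r i)) x * r i powr (- q)) \<partial>lborel)
      \<le> unit_ball_vol (real DIM('a)) * 2 ^ DIM('a)
        * ((2 powr (real DIM('a) - q) / unit_ball_vol (real DIM('a) - q) + 1) * M)"
      unfolding integral_powr_bound(2) using sum by (intro mult_left_mono) auto
    show "\<phi> x = 1" if "x \<in> K" for x
      using that J(2) by (intro one_on_cover) (rule subsetD)
    show "grad \<phi> x = 0" if "x \<in> K" for x
      using that J(2) by (intro grad_zero_on_cover) (rule subsetD)
  qed (use cover_cutoff_bounds[OF J(1)] in auto)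
qed

section \<open>Vanishing of divergence measures on small sets\<close>

lemma Lp_field_measurable:
  assumes "open \<Omega>" "Lp_field p \<Omega> F"
  shows "(\<lambda>x. indicator \<Omega> x *\<^sub>R F x) \<in> borel_measurable lebesgue"
proof -
  have "F \<in> borel_measurable (lebesgue_on \<Omega>)"
    using assms(2) by (simp add: Lp_field_def)
  moreover have "\<Omega> \<inter> space lebesgue \<in> sets lebesgue"
    using assms(1) by auto
  ultimately show ?thesis
    by (simp add: borel_measurable_restrict_space_iff)
qed

lemma Lp_field_bounded:
  assumes "open \<Omega>" "Lp_field \<infinity> \<Omega> F"
  obtains C where "0 \<le> C" "AE x in lebesgue. x \<in> \<Omega> \<longrightarrow> norm (F x) \<le> C"
proof -
  obtain C where "AE x in lebesgue_on \<Omega>. norm (F x) \<le> C"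
    using assms(2) by (auto simp: Lp_field_def)
  then have "AE x in lebesgue. x \<in> \<Omega> \<longrightarrow> norm (F x) \<le> C"
    using assms(1) by (subst (asm) AE_restrict_space_iff) auto
  then have "AE x in lebesgue. x \<in> \<Omega> \<longrightarrow> norm (F x) \<le> max 0 C"
    by (rule eventually_mono) auto
  then show thesis
    by (rule that[of "max 0 C", OF max.cobounded1])
qed

lemma Lp_field_integrable_powr:
  assumes "open \<Omega>" "Lp_field p \<Omega> F" "p \<noteq> \<infinity>"
  shows "integrable lebesgue (\<lambda>x. indicator \<Omega> x * norm (F x) powr enn2real p)"
proof -
  have "integrable (lebesgue_on \<Omega>) (\<lambda>x. norm (F x) powr enn2real p)"
    using assms(2,3) by (simp add: Lp_field_def)
  moreover have "\<Omega> \<inter> space lebesgue \<in> sets lebesgue"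
    using assms(1) by auto
  ultimately show ?thesis
    by (simp add: integrable_restrict_space)
qed

lemma enn2real_ge_one:
  fixes p :: ennreal
  assumes "1 \<le> p" "p \<noteq> \<infinity>"
  shows "1 \<le> enn2real p"
  using enn2real_mono[OF assms(1)] assms(2) by (simp add: less_top)

lemma Lp_field_locally_integrable:
  assumes \<Omega>: "open \<Omega>" and F: "Lp_field p \<Omega> F" and p: "1 \<le> p"
  shows "locally_integrable_on \<Omega> F"
  unfolding locally_integrable_on_def
proof (intro allI impI)
  fix K assume K: "compact K" "K \<subseteq> \<Omega>"
  have "K \<in> lmeasurable"
    using K(1) by (rule lmeasurable_compact)
  then have iK: "integrable lebesgue (indicator K :: 'a \<Rightarrow> real)"
    by (intro integrable_real_indicator) (auto simp: fmeasurable_def)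
  have "(\<lambda>x. indicator K x *\<^sub>R (indicator \<Omega> x *\<^sub>R F x)) \<in> borel_measurable lebesgue"
    using K(1) by (intro borel_measurable_scaleR Lp_field_measurable[OF \<Omega> F]) (auto intro!: borel_measurable_indicator simp: compact_imp_closed)
  moreover have "(\<lambda>x. indicator K x *\<^sub>R (indicator \<Omega> x *\<^sub>R F x)) = (\<lambda>x. indicator K x *\<^sub>R F x)"
    using K(2) by (auto simp: indicator_def fun_eq_iff)
  ultimately have meas: "(\<lambda>x. indicator K x *\<^sub>R F x) \<in> borel_measurable lebesgue"
    by simp
  show "set_integrable lebesgue K F"
    unfolding set_integrable_def
  proof (cases "p = \<infinity>")
    case True
    then obtain C where C: "0 \<le> C" "AE x in lebesgue. x \<in> \<Omega> \<longrightarrow> norm (F x) \<le> C"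
      using Lp_field_bounded[OF \<Omega>] F by metis
    show "integrable lebesgue (\<lambda>x. indicator K x *\<^sub>R F x)"
    proof (rule Bochner_Integration.integrable_bound)
      show "integrable lebesgue (\<lambda>x. C * indicator K x)"
        using iK by simp
      show "AE x in lebesgue. norm (indicator K x *\<^sub>R F x) \<le> norm (C * indicator K x)"
        using C(2) by eventually_elim (use K(2) C(1) in \<open>auto simp: indicator_def\<close>)
    qed (rule meas)
  next
    case False
    note 1 = enn2real_ge_one[OF p False]
    show "integrable lebesgue (\<lambda>x. indicator K x *\<^sub>R F x)"
    proof (rule Bochner_Integration.integrable_bound)
      show "integrable lebesgue (\<lambda>x. indicator K x + indicator \<Omega> x * norm (F x) powr enn2real p)"
        using iK Lp_field_integrable_powr[OF \<Omega> F False] by simp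
      have "norm (F x) \<le> 1 + norm (F x) powr enn2real p" for x
      proof (cases "norm (F x) \<le> 1")
        case False
        then have "norm (F x) powr 1 \<le> norm (F x) powr enn2real p"
          using 1 by (intro powr_mono) auto
        then show ?thesis
          by simp
      qed (simp add: add_increasing2)
      then show "AE x in lebesgue. norm (indicator K x *\<^sub>R F x) \<le> norm (indicator K x + indicator \<Omega> x * norm (F x) powr enn2real p)"
        using K(2) by (auto simp: indicator_def)
    qed (rule meas)
  qed
qed

text \<open>A function that is not integrable has integral 0 by convention, and the right-hand side
  is nonnegative; this spares a measurability proof for the integrand containing
  \<open>grad\<close>.\<close>

lemma abs_integral_le_if_AE_bound:
  fixes f g :: "'a \<Rightarrow> real"
  assumes "integrable M g" "AE x in M. \<bar>f x\<bar> \<le> g x"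
  shows "\<bar>\<integral>x. f x \<partial>M\<bar> \<le> (\<integral>x. g x \<partial>M)"
proof (cases "integrable M f")
  case True
  have "\<bar>\<integral>x. f x \<partial>M\<bar> \<le> (\<integral>x. \<bar>f x\<bar> \<partial>M)"
    by (rule integral_abs_bound)
  also have "\<dots> \<le> (\<integral>x. g x \<partial>M)"
    using True assms by (intro integral_mono_AE) auto
  finally show ?thesis .
next
  case False
  have "AE x in M. 0 \<le> g x"
    using assms(2) by eventually_elim (meson abs_ge_zero order_trans)
  then show ?thesis
    using False by (simp add: not_integrable_integral_eq integral_nonneg_AE)
qed

section \<open>Compact sets that carry no divergence\<close>

text \<open>Bounded cutoffs with supports shrinking to \<open>K\<close> converge to its indicator,
  so the mass of \<open>K\<close> is the limit of \<open>T\<close> on them. \<open>T\<close> stays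
  abstract because it stands for \<open>distr_div\<close> in the vanishing results and for
  \<open>normal_trace\<close> in \<open>concentrated_on_frontier\<close>.\<close>

lemma (in signed_measure) compact_zero_if_cutoffs:
  assumes K: "compact K" "K \<subseteq> \<Omega>"
    and div: "\<And>\<phi>. \<phi> \<in> Lip_c \<Omega> \<Longrightarrow> T \<phi> = real_integral \<Omega> \<mu> \<phi>"
    and cutoffs: "\<And>e. 0 < e \<Longrightarrow> \<exists>\<phi>\<in>Lip_c \<Omega>. (\<forall>x. 0 \<le> \<phi> x \<and> \<phi> x \<le> 1) \<and> (\<forall>x\<in>K. \<phi> x = 1) \<and>
      {x. \<phi> x \<noteq> 0} \<subseteq> (\<Union>z\<in>K. cball z e) \<and> \<bar>T \<phi>\<bar> \<le> e"
  shows "\<mu> K = 0"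
proof -
  have "\<forall>n. \<exists>\<phi>. \<phi> \<in> Lip_c \<Omega> \<and> (\<forall>x. 0 \<le> \<phi> x \<and> \<phi> x \<le> 1) \<and> (\<forall>x\<in>K. \<phi> x = 1) \<and>
      {x. \<phi> x \<noteq> 0} \<subseteq> (\<Union>z\<in>K. cball z (inverse (real (Suc n)))) \<and> \<bar>T \<phi>\<bar> \<le> inverse (real (Suc n))"
  proof
    fix n
    have "0 < inverse (real (Suc n))"
      by simp
    from cutoffs[OF this] show "\<exists>\<phi>. \<phi> \<in> Lip_c \<Omega> \<and> (\<forall>x. 0 \<le> \<phi> x \<and> \<phi> x \<le> 1) \<and> (\<forall>x\<in>K. \<phi> x = 1) \<and>
        {x. \<phi> x \<noteq> 0} \<subseteq> (\<Union>z\<in>K. cball z (inverse (real (Suc n)))) \<and> \<bar>T \<phi>\<bar> \<le> inverse (real (Suc n))"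
      by (simp only: Bex_def)
  qed
  from choice[OF this] obtain \<phi> where all: "\<forall>n. \<phi> n \<in> Lip_c \<Omega> \<and> (\<forall>x. 0 \<le> \<phi> n x \<and> \<phi> n x \<le> 1) \<and> (\<forall>x\<in>K. \<phi> n x = 1) \<and>
      {x. \<phi> n x \<noteq> 0} \<subseteq> (\<Union>z\<in>K. cball z (inverse (real (Suc n)))) \<and> \<bar>T (\<phi> n)\<bar> \<le> inverse (real (Suc n))"
    by (elim exE)
  have \<phi>: "\<And>n. \<phi> n \<in> Lip_c \<Omega>" "\<And>n x. 0 \<le> \<phi> n x \<and> \<phi> n x \<le> 1" "\<And>n x. x \<in> K \<Longrightarrow> \<phi> n x = 1"
      "\<And>n. {x. \<phi> n x \<noteq> 0} \<subseteq> (\<Union>z\<in>K. cball z (inverse (real (Suc n))))" "\<And>n. \<bar>T (\<phi> n)\<bar> \<le> inverse (real (Suc n))"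
    using all by simp_all
  have KB: "K \<in> borel_subsets \<Omega>"
    using K by (auto simp: borel_subsets_def intro: borel_compact)
  have "(\<lambda>n. real_integral \<Omega> \<mu> (\<phi> n)) \<longlonglongrightarrow> real_integral \<Omega> \<mu> (indicator K)"
  proof (rule real_integral_LIMSEQ)
    show "\<phi> n \<in> borel_measurable borel" for n
      using \<phi>(1) by (rule Lip_c_measurable)
    show "\<bar>\<phi> n x\<bar> \<le> 1" for n x
      using \<phi>(2)[of n x] by simp
    show "(indicator K :: 'a \<Rightarrow> real) \<in> borel_measurable borel"
      using KB by (auto simp: borel_subsets_def)
    show "(\<lambda>n. \<phi> n x) \<longlonglongrightarrow> indicator K x" for x
    proof (cases "x \<in> K")
      case False
      then obtain d where d: "0 < d" "ball x d \<subseteq> - K"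
        using K(1) compact_imp_closed by (metis ComplI openE open_Compl)
      have "\<forall>\<^sub>F n in sequentially. inverse (real (Suc n)) < d"
        using order_tendstoD(2)[OF LIMSEQ_inverse_real_of_nat d(1)] .
      then have "\<forall>\<^sub>F n in sequentially. \<phi> n x = 0"
      proof eventually_elim
        case (elim n)
        show ?case
        proof (rule ccontr)
          assume "\<phi> n x \<noteq> 0"
          then obtain z where z: "z \<in> K" "dist z x \<le> inverse (real (Suc n))"
            using \<phi>(4)[of n] by auto
          then have "z \<in> ball x d"
            using elim by (simp add: dist_commute)
          then show False
            using d(2) z(1) by blast
        qed
      qed
      then show ?thesis
        using False by (simp add: tendsto_eventually)
    qed (simp add: \<phi>(3))
  qed
  moreover have "(\<lambda>n. real_integral \<Omega> \<mu> (\<phi> n)) \<longlonglongrightarrow> 0"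
    using \<phi>(5) by (intro Lim_null_comparison[OF _ LIMSEQ_inverse_real_of_nat]) (simp flip: div[OF \<phi>(1)])
  ultimately show ?thesis
    using LIMSEQ_unique real_integral_indicator[OF KB] by metis
qed

lemma Lip_c_near_compactI:
  assumes "\<exists>L. L-lipschitz_on UNIV \<phi>" "compact K" "{x. \<phi> x \<noteq> 0} \<subseteq> (\<Union>z\<in>K. cball z e)" "(\<Union>z\<in>K. cball z e) \<subseteq> \<Omega>"
  shows "\<phi> \<in> Lip_c \<Omega>"
proof -
  have c: "compact (\<Union>z\<in>K. cball z e)"
    using assms(2) by (rule compact_minkowski_sum_cball)
  then have sub: "closure {x. \<phi> x \<noteq> 0} \<subseteq> (\<Union>z\<in>K. cball z e)"
    using assms(3) by (intro closure_minimal compact_imp_closed)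
  then have "compact (closure {x. \<phi> x \<noteq> 0})"
    using c by (metis closed_closure compact_Int_closed inf.absorb_iff2)
  then show ?thesis
    using assms(1,4) sub by (auto simp: Lip_c_def compact_support_in_def)
qed

lemma distr_div_bound:
  assumes "integrable lborel g" "AE x in lebesgue. x \<in> \<Omega> \<longrightarrow> \<bar>F x \<bullet> grad \<phi> x\<bar> \<le> g x" "\<And>x. 0 \<le> g x"
  shows "\<bar>distr_div \<Omega> F \<phi>\<bar> \<le> (\<integral>x. g x \<partial>lborel)"
proof -
  have m: "g \<in> borel_measurable lborel"
    using assms(1) by (rule borel_measurable_integrable)
  have "\<bar>distr_div \<Omega> F \<phi>\<bar> = \<bar>\<integral>x. indicator \<Omega> x *\<^sub>R (F x \<bullet> grad \<phi> x) \<partial>lebesgue\<bar>"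
    by (simp add: distr_div_def set_lebesgue_integral_def)
  also have "\<dots> \<le> (\<integral>x. g x \<partial>lebesgue)"
  proof (rule abs_integral_le_if_AE_bound)
    show "integrable lebesgue g"
      using assms(1) by (simp add: integrable_completion[OF m])
    show "AE x in lebesgue. \<bar>indicator \<Omega> x *\<^sub>R (F x \<bullet> grad \<phi> x)\<bar> \<le> g x"
      using assms(2) by eventually_elim (use assms(3) in \<open>auto simp: indicator_def\<close>)
  qed
  also have "\<dots> = (\<integral>x. g x \<partial>lborel)"
    using m by (rule integral_completion)
  finally show ?thesis .
qed

lemma (in signed_measure) compact_zero_bounded_field:
  assumes \<Omega>: "open \<Omega>" and F: "Lp_field \<infinity> \<Omega> F"
    and div: "\<And>\<phi>. \<phi> \<in> Lip_c \<Omega> \<Longrightarrow> distr_div \<Omega> F \<phi> = real_integral \<Omega> \<mu> \<phi>"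
    and K: "compact K" "K \<subseteq> \<Omega>" and H: "hausdorff (real DIM('a) - 1) K = 0"
  shows "\<mu> K = 0"
proof (rule compact_zero_if_cutoffs[OF K div])
  fix e :: real assume "0 < e"
  obtain \<rho> where \<rho>: "\<rho> > 0" "(\<Union>x\<in>K. cball x \<rho>) \<subseteq> \<Omega>"
    using compact_subset_open_imp_cball_epsilon_subset[OF K(1) \<Omega> K(2)] by blast
  obtain C where C: "0 \<le> C" "AE x in lebesgue. x \<in> \<Omega> \<longrightarrow> norm (F x) \<le> C"
    using Lp_field_bounded[OF \<Omega> F] .
  let ?q = "1 :: real"
  define A where "A = unit_ball_vol (real DIM('a)) * 2 ^ DIM('a) * (2 powr (real DIM('a) - ?q) / unit_ball_vol (real DIM('a) - ?q) + 1)"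
  have "0 \<le> A"
    unfolding A_def by (intro mult_nonneg_nonneg add_nonneg_nonneg) auto
  \<comment> \<open>Since the Hausdorff measure of \<open>K\<close> is 0, any positive
    \<open>M\<close> is admissible; this one gives C A M \<le> e, and the summand 1 avoids a zero
    denominator.\<close>
  define M where "M = e / (C * A + 1)"
  have "0 < M"
    unfolding M_def using \<open>0 < e\<close> \<open>0 \<le> A\<close> C(1) by (intro divide_pos_pos) (auto simp: add_nonneg_pos)
  then have HM: "hausdorff (real DIM('a) - ?q) K < ennreal M"
    using H by simp
  have qn: "0 < ?q" "?q \<le> real DIM('a)"
    by (simp_all add: DIM_ge_Suc0[unfolded One_nat_def[symmetric]])
  define \<delta> where "\<delta> = min \<rho> e"
  have "0 < \<delta>"
    using \<rho>(1) \<open>0 < e\<close> by (simp add: \<delta>_def)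
  obtain \<phi> \<psi> :: "'a \<Rightarrow> real" where \<phi>: "\<exists>L. L-lipschitz_on UNIV \<phi>" "\<And>x. 0 \<le> \<phi> x" "\<And>x. \<phi> x \<le> 1"
      "\<And>x. x \<in> K \<Longrightarrow> \<phi> x = 1" "{x. \<phi> x \<noteq> 0} \<subseteq> (\<Union>z\<in>K. cball z \<delta>)" "\<And>x. x \<in> K \<Longrightarrow> grad \<phi> x = 0"
    and \<psi>: "integrable lborel \<psi>" "\<And>x. norm (grad \<phi> x) powr ?q \<le> \<psi> x"
      "(\<integral>x. \<psi> x \<partial>lborel) \<le> unit_ball_vol (real DIM('a)) * 2 ^ DIM('a)
        * ((2 powr (real DIM('a) - ?q) / unit_ball_vol (real DIM('a) - ?q) + 1) * M)"
  proof (rule hausdorff_cutoff[OF K(1) qn HM \<open>0 < \<delta>\<close>], goal_cases)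
    case (1 \<phi> \<psi>)
    from 1(2-) show ?case
      by (rule 1(1))
  qed
  have near: "(\<Union>z\<in>K. cball z \<delta>) \<subseteq> (\<Union>z\<in>K. cball z \<rho>)" "(\<Union>z\<in>K. cball z \<delta>) \<subseteq> (\<Union>z\<in>K. cball z e)"
    by (intro UN_mono subset_cball; simp add: \<delta>_def)+
  have "\<phi> \<in> Lip_c \<Omega>"
    using \<phi>(1) K(1) \<phi>(5) near(1) \<rho>(2) by (intro Lip_c_near_compactI) auto
  moreover have "\<bar>distr_div \<Omega> F \<phi>\<bar> \<le> e"
  proof -
    have \<psi>': "norm (grad \<phi> x) \<le> \<psi> x" for x
      using \<psi>(2)[of x] by simp
    have \<psi>0: "0 \<le> \<psi> x" for x
      using \<psi>'[of x] norm_ge_zero order_trans by blast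
    have "\<bar>distr_div \<Omega> F \<phi>\<bar> \<le> (\<integral>x. C * \<psi> x \<partial>lborel)"
    proof (rule distr_div_bound)
      show "AE x in lebesgue. x \<in> \<Omega> \<longrightarrow> \<bar>F x \<bullet> grad \<phi> x\<bar> \<le> C * \<psi> x"
        using C(2)
      proof eventually_elim
        case (elim x)
        have "norm (F x) * norm (grad \<phi> x) \<le> C * \<psi> x" if "x \<in> \<Omega>"
          using elim that \<psi>' C(1) by (intro mult_mono) auto
        then show ?case
          using Cauchy_Schwarz_ineq2[of "F x" "grad \<phi> x"] by linarith
      qed
    qed (use \<psi>(1) \<psi>0 C(1) in auto)
    also have "\<dots> \<le> C * (A * M)"
      using \<psi>(3) C(1) unfolding A_def by (simp add: mult_left_mono mult.assoc)
    also have "\<dots> = e * ((C * A) / (C * A + 1))"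
      by (simp add: M_def)
    also have "\<dots> \<le> e * 1"
      using \<open>0 < e\<close> \<open>0 \<le> A\<close> C(1) by (intro mult_left_mono) (auto simp: divide_le_eq_1 add_nonneg_pos)
    finally show ?thesis
      by simp
  qed
  ultimately show "\<exists>\<phi>\<in>Lip_c \<Omega>. (\<forall>x. 0 \<le> \<phi> x \<and> \<phi> x \<le> 1) \<and> (\<forall>x\<in>K. \<phi> x = 1) \<and>
      {x. \<phi> x \<noteq> 0} \<subseteq> (\<Union>z\<in>K. cball z e) \<and> \<bar>distr_div \<Omega> F \<phi>\<bar> \<le> e"
    using \<phi> near(2) by (intro bexI[of _ \<phi>]) auto
qed

text \<open>With \<open>K\<close> removed, the closed neighbourhoods shrink to the empty set: as
  \<open>K\<close> is closed, a point off \<open>K\<close> drops out once the radius is below its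
  distance to \<open>K\<close>. Dominated convergence finishes.\<close>

lemma integral_near_compact_tendsto_zero:
  fixes g :: "'a::euclidean_space \<Rightarrow> real"
  assumes g: "integrable lebesgue g" and K: "compact K" and "0 < e"
  shows "\<exists>d>0. \<bar>\<integral>x. indicator ((\<Union>z\<in>K. cball z d) - K) x * g x \<partial>lebesgue\<bar> < e"
proof -
  define N where "N n = (\<Union>z\<in>K. cball z (inverse (real (Suc n)))) - K" for n
  have Ns: "N n \<in> sets lebesgue" for n
    unfolding N_def using compact_minkowski_sum_cball[OF K] K by (auto intro!: sets.Diff simp: compact_imp_closed)
  have "(\<lambda>n. \<integral>x. indicator (N n) x * g x \<partial>lebesgue) \<longlonglongrightarrow> (\<integral>x. 0 \<partial>(lebesgue :: 'a measure))"
  proof (rule integral_dominated_convergence[where w="\<lambda>x. \<bar>g x\<bar>"])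
    show "AE x in lebesgue. (\<lambda>n. indicator (N n) x * g x) \<longlonglongrightarrow> 0"
    proof (rule AE_I2)
      fix x
      show "(\<lambda>n. indicator (N n) x * g x) \<longlonglongrightarrow> 0"
      proof (cases "x \<in> K")
        case False
        then obtain d where d: "0 < d" "ball x d \<subseteq> - K"
          using K compact_imp_closed by (metis ComplI openE open_Compl)
        have "\<forall>\<^sub>F n in sequentially. inverse (real (Suc n)) < d"
          using order_tendstoD(2)[OF LIMSEQ_inverse_real_of_nat d(1)] .
        then have "\<forall>\<^sub>F n in sequentially. indicator (N n) x * g x = 0"
        proof eventually_elim
          case (elim n)
          have "x \<notin> N n"
          proof
            assume "x \<in> N n"
            then obtain z where z: "z \<in> K" "dist z x \<le> inverse (real (Suc n))"
              by (auto simp: N_def)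
            then have "z \<in> ball x d"
              using elim by (simp add: dist_commute)
            then show False
              using d(2) z(1) by blast
          qed
          then show ?case
            by simp
        qed
        then show ?thesis
          by (rule tendsto_eventually)
      qed (simp add: N_def)
    qed
    show "(\<lambda>x. indicator (N n) x * g x) \<in> borel_measurable lebesgue" for n
      using Ns g by (intro borel_measurable_times borel_measurable_indicator) auto
    show "AE x in lebesgue. norm (indicator (N n) x * g x) \<le> \<bar>g x\<bar>" for n
      by (auto simp: indicator_def)
  qed (use g in auto)
  from LIMSEQ_D[OF this \<open>0 < e\<close>] obtain n where "\<bar>\<integral>x. indicator (N n) x * g x \<partial>lebesgue\<bar> < e"
    by auto
  then show ?thesis
    unfolding N_def by (intro exI[of _ "inverse (real (Suc n))"]) simp
qed

text \<open>Young's inequality with weight \<open>\<theta>\<close> bounds |F . grad \<phi>| by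
  \<theta>^(-p) |F|^p + \<theta>^q |grad \<phi>|^q. First \<open>\<theta>\<close> makes the second
  term small, using a bound valid for cutoffs of every scale; then the neighbourhood is shrunk to
  make the first term small despite its large factor.\<close>

lemma (in signed_measure) compact_zero_Lp_field:
  assumes \<Omega>: "open \<Omega>" and F: "Lp_field p \<Omega> F" and p: "p \<noteq> \<infinity>" "1 < enn2real p"
    and q: "q = conjugate_exponent (enn2real p)" "q \<le> real DIM('a)"
    and div: "\<And>\<phi>. \<phi> \<in> Lip_c \<Omega> \<Longrightarrow> distr_div \<Omega> F \<phi> = real_integral \<Omega> \<mu> \<phi>"
    and K: "compact K" "K \<subseteq> \<Omega>" and H: "hausdorff (real DIM('a) - q) K < \<infinity>"
  shows "\<mu> K = 0"
proof (rule compact_zero_if_cutoffs[OF K div])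
  fix e :: real assume "0 < e"
  obtain \<rho> where \<rho>: "\<rho> > 0" "(\<Union>x\<in>K. cball x \<rho>) \<subseteq> \<Omega>"
    using compact_subset_open_imp_cball_epsilon_subset[OF K(1) \<Omega> K(2)] by blast
  let ?p = "enn2real p"
  have pq: "1 < q" "1 / ?p + 1 / q = 1"
    using p(2) by (auto simp: q conjugate_exponent_def field_simps)
  define A where "A = unit_ball_vol (real DIM('a)) * 2 ^ DIM('a) * (2 powr (real DIM('a) - q) / unit_ball_vol (real DIM('a) - q) + 1)"
  have "0 \<le> A"
    unfolding A_def using q(2) by (intro mult_nonneg_nonneg add_nonneg_nonneg) auto
  define M where "M = enn2real (hausdorff (real DIM('a) - q) K) + 1"
  have "0 < M"
    by (simp add: M_def add_nonneg_pos)
  have HM: "hausdorff (real DIM('a) - q) K < ennreal M"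
    using H by (subst ennreal_enn2real[symmetric]) (auto simp: M_def less_top intro!: ennreal_lessI add_nonneg_pos)
  \<comment> \<open>Chosen so that \<theta>^q A M \<le> e/2, where A M bounds the integral of
    \<open>\<psi>\<close>.\<close>
  define \<theta> where "\<theta> = (e / (2 * (A * M + 1))) powr (1 / q)"
  have AM: "0 < A * M + 1"
    using \<open>0 \<le> A\<close> \<open>0 < M\<close> by (simp add: add_nonneg_pos)
  have \<theta>: "0 < \<theta>" "\<theta> powr q = e / (2 * (A * M + 1))"
    using \<open>0 < e\<close> AM pq(1) by (auto simp: \<theta>_def powr_powr)
  \<comment> \<open>The factor \<theta>^(-p) is part of \<open>g\<close>, so the radius
    \<open>d\<close> below is chosen after \<open>\<theta>\<close>.\<close>
  define g where "g x = \<theta> powr (- ?p) * (indicator \<Omega> x * norm (F x) powr ?p)" for x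
  have g: "integrable lebesgue g" "\<And>x. 0 \<le> g x"
    unfolding g_def using Lp_field_integrable_powr[OF \<Omega> F p(1)] by auto
  obtain d where d: "0 < d" "\<bar>\<integral>x. indicator ((\<Union>z\<in>K. cball z d) - K) x * g x \<partial>lebesgue\<bar> < e / 2"
    using integral_near_compact_tendsto_zero[OF g(1) K(1), of "e / 2"] \<open>0 < e\<close> by auto
  define \<delta> where "\<delta> = min d (min \<rho> e)"
  have "0 < \<delta>"
    using \<rho>(1) d(1) \<open>0 < e\<close> by (simp add: \<delta>_def)
  have "0 < q"
    using pq by simp
  obtain \<phi> \<psi> :: "'a \<Rightarrow> real" where \<phi>: "\<exists>L. L-lipschitz_on UNIV \<phi>" "\<And>x. 0 \<le> \<phi> x" "\<And>x. \<phi> x \<le> 1"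
      "\<And>x. x \<in> K \<Longrightarrow> \<phi> x = 1" "{x. \<phi> x \<noteq> 0} \<subseteq> (\<Union>z\<in>K. cball z \<delta>)" "\<And>x. x \<in> K \<Longrightarrow> grad \<phi> x = 0"
    and \<psi>: "integrable lborel \<psi>" "\<And>x. norm (grad \<phi> x) powr q \<le> \<psi> x"
      "(\<integral>x. \<psi> x \<partial>lborel) \<le> unit_ball_vol (real DIM('a)) * 2 ^ DIM('a)
        * ((2 powr (real DIM('a) - q) / unit_ball_vol (real DIM('a) - q) + 1) * M)"
  proof (rule hausdorff_cutoff[OF K(1) \<open>0 < q\<close> q(2) HM \<open>0 < \<delta>\<close>], goal_cases)
    case (1 \<phi> \<psi>)
    from 1(2-) show ?case
      by (rule 1(1))
  qed
  let ?N = "\<lambda>d. \<Union>z\<in>K. cball z d"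
  have near: "?N \<delta> \<subseteq> ?N \<rho>" "?N \<delta> \<subseteq> ?N e" "?N \<delta> \<subseteq> ?N d"
    by (intro UN_mono subset_cball; simp add: \<delta>_def)+
  have "\<phi> \<in> Lip_c \<Omega>"
    using \<phi>(1) K(1) \<phi>(5) near(1) \<rho>(2) by (intro Lip_c_near_compactI) auto
  moreover have "\<bar>distr_div \<Omega> F \<phi>\<bar> \<le> e"
  proof -
    have \<psi>0: "0 \<le> \<psi> x" for x
      using \<psi>(2)[of x] powr_ge_zero order_trans by blast
    have supp: "closure {x. \<phi> x \<noteq> 0} \<subseteq> ?N d"
      using \<phi>(5) near(3) compact_minkowski_sum_cball[OF K(1), of d]
      by (intro closure_minimal) (auto simp: compact_imp_closed)
    \<comment> \<open>On \<open>K\<close> the gradient vanishes because the cutoff is 1 on a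
      neighbourhood, and off the neighbourhood of radius \<open>d\<close> it vanishes because the
      cutoff does; so |F|^p is charged only in between.\<close>
    have bound: "\<bar>indicator \<Omega> x *\<^sub>R (F x \<bullet> grad \<phi> x)\<bar> \<le> indicator (?N d - K) x * g x + \<theta> powr q * \<psi> x" for x
    proof (cases "x \<in> \<Omega> \<and> x \<in> ?N d - K")
      case True
      have "\<bar>F x \<bullet> grad \<phi> x\<bar> \<le> norm (F x) * norm (grad \<phi> x)"
        by (rule Cauchy_Schwarz_ineq2)
      also have "\<dots> = (norm (F x) / \<theta>) * (\<theta> * norm (grad \<phi> x))"
        using \<theta>(1) by simp
      also have "\<dots> \<le> (norm (F x) / \<theta>) powr ?p / ?p + (\<theta> * norm (grad \<phi> x)) powr q / q"
        using p(2) pq \<theta>(1) by (intro Youngs_inequality) auto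
      also have "\<dots> \<le> (norm (F x) / \<theta>) powr ?p + (\<theta> * norm (grad \<phi> x)) powr q"
        using p(2) pq(1) by (intro add_mono) (auto simp: divide_le_eq mult_le_cancel_left1 not_less)
      also have "\<dots> = \<theta> powr (- ?p) * norm (F x) powr ?p + \<theta> powr q * norm (grad \<phi> x) powr q"
        using \<theta>(1) by (simp add: powr_mult powr_minus divide_inverse inverse_powr mult.commute)
      also have "\<dots> \<le> \<theta> powr (- ?p) * norm (F x) powr ?p + \<theta> powr q * \<psi> x"
        using \<psi>(2)[of x] by (intro add_left_mono mult_left_mono) auto
      finally show ?thesis
        using True by (simp add: g_def)
    next
      case False
      then have "x \<notin> \<Omega> \<or> grad \<phi> x = 0"
        using \<phi>(6) grad_outside_support supp by blast
      then have "indicator \<Omega> x *\<^sub>R (F x \<bullet> grad \<phi> x) = 0"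
        by auto
      moreover have "0 \<le> indicator (?N d - K) x * g x + \<theta> powr q * \<psi> x"
        using g(2)[of x] \<psi>0[of x] by (intro add_nonneg_nonneg mult_nonneg_nonneg) auto
      ultimately show ?thesis
        by (simp only: abs_zero)
    qed
    have m: "\<psi> \<in> borel_measurable lborel"
      using \<psi>(1) by (rule borel_measurable_integrable)
    then have i\<psi>: "integrable lebesgue \<psi>" "(\<integral>x. \<psi> x \<partial>lebesgue) = (\<integral>x. \<psi> x \<partial>lborel)"
      using \<psi>(1) by (simp_all add: integrable_completion integral_completion)
    have Nd: "?N d - K \<in> sets lebesgue"
      using compact_minkowski_sum_cball[OF K(1)] K(1) by (auto intro!: sets.Diff simp: compact_imp_closed)
    have ig: "integrable lebesgue (\<lambda>x. indicator (?N d - K) x * g x)"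
      using integrable_mult_indicator[OF Nd g(1)] by simp
    have "\<bar>distr_div \<Omega> F \<phi>\<bar> = \<bar>\<integral>x. indicator \<Omega> x *\<^sub>R (F x \<bullet> grad \<phi> x) \<partial>lebesgue\<bar>"
      by (simp add: distr_div_def set_lebesgue_integral_def)
    also have "\<dots> \<le> (\<integral>x. indicator (?N d - K) x * g x + \<theta> powr q * \<psi> x \<partial>lebesgue)"
      using ig i\<psi>(1) bound by (intro abs_integral_le_if_AE_bound) auto
    also have "\<dots> = (\<integral>x. indicator (?N d - K) x * g x \<partial>lebesgue) + \<theta> powr q * (\<integral>x. \<psi> x \<partial>lborel)"
      using ig i\<psi> by simp
    also have "\<dots> \<le> e / 2 + \<theta> powr q * (A * M)"
      using d(2) \<psi>(3) unfolding A_def by (intro add_mono mult_left_mono) (auto simp: mult.assoc)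
    also have "\<theta> powr q * (A * M) = e / 2 * ((A * M) / (A * M + 1))"
      by (simp add: \<theta>(2))
    also have "\<dots> \<le> e / 2 * 1"
      using \<open>0 < e\<close> AM by (intro mult_left_mono) (auto simp: divide_le_eq_1)
    finally show ?thesis
      by simp
  qed
  ultimately show "\<exists>\<phi>\<in>Lip_c \<Omega>. (\<forall>x. 0 \<le> \<phi> x \<and> \<phi> x \<le> 1) \<and> (\<forall>x\<in>K. \<phi> x = 1) \<and>
      {x. \<phi> x \<noteq> 0} \<subseteq> (\<Union>z\<in>K. cball z e) \<and> \<bar>distr_div \<Omega> F \<phi>\<bar> \<le> e"
    using \<phi> near(2) by (intro bexI[of _ \<phi>]) auto
qed

section \<open>The normal trace\<close>

lemma hausdorff_mono:
  assumes "A \<subseteq> B"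
  shows "hausdorff s A \<le> hausdorff s B"
  unfolding hausdorff_def hausdorff_content_def
proof (intro SUP_mono)
  fix \<delta> :: real assume "\<delta> \<in> {0<..}"
  moreover have "(INF C\<in>{C. A \<subseteq> \<Union> (range C) \<and> (\<forall>i. bounded (C i) \<and> diameter (C i) \<le> \<delta>)}. \<Sum>i. ennreal (hausdorff_weight s (C i)))
      \<le> (INF C\<in>{C. B \<subseteq> \<Union> (range C) \<and> (\<forall>i. bounded (C i) \<and> diameter (C i) \<le> \<delta>)}. \<Sum>i. ennreal (hausdorff_weight s (C i)))"
    using assms by (intro INF_superset_mono) auto
  ultimately show "\<exists>\<delta>'\<in>{0<..}.
      (INF C\<in>{C. A \<subseteq> \<Union> (range C) \<and> (\<forall>i. bounded (C i) \<and> diameter (C i) \<le> \<delta>)}. \<Sum>i. ennreal (hausdorff_weight s (C i)))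
      \<le> (INF C\<in>{C. B \<subseteq> \<Union> (range C) \<and> (\<forall>i. bounded (C i) \<and> diameter (C i) \<le> \<delta>')}. \<Sum>i. ennreal (hausdorff_weight s (C i)))"
    by (rule bexI[rotated])
qed

lemma Lip_c_mono: "U \<subseteq> \<Omega> \<Longrightarrow> Lip_c U \<subseteq> Lip_c \<Omega>"
  by (auto simp: Lip_c_def compact_support_in_def)

lemma Lp_field_indicator:
  assumes \<Omega>: "open \<Omega>" and F: "Lp_field p \<Omega> F" and E: "E \<in> sets borel"
  shows "Lp_field p \<Omega> (\<lambda>x. indicator E x *\<^sub>R F x)"
proof -
  have Fm: "F \<in> borel_measurable (lebesgue_on \<Omega>)"
    using F by (simp add: Lp_field_def)
  have "(indicator E :: 'a \<Rightarrow> real) \<in> borel_measurable lebesgue"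
    using E by (intro borel_measurable_indicator) auto
  then have "(indicator E :: 'a \<Rightarrow> real) \<in> borel_measurable (lebesgue_on \<Omega>)"
    by (rule measurable_restrict_space1)
  then have m: "(\<lambda>x. indicator E x *\<^sub>R F x) \<in> borel_measurable (lebesgue_on \<Omega>)"
    using Fm by (rule borel_measurable_scaleR)
  have le: "norm (indicator E x *\<^sub>R F x) \<le> norm (F x)" for x
    by (simp add: indicator_def)
  show ?thesis
  proof (cases "p = \<infinity>")
    case True
    obtain C where "AE x in lebesgue_on \<Omega>. norm (F x) \<le> C"
      using F True by (auto simp: Lp_field_def)
    then have "AE x in lebesgue_on \<Omega>. norm (indicator E x *\<^sub>R F x) \<le> C"
      by (rule eventually_mono) (meson le order_trans)
    then have "\<exists>C. AE x in lebesgue_on \<Omega>. norm (indicator E x *\<^sub>R F x) \<le> C" ..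
    then show ?thesis
      using m True by (simp only: Lp_field_def if_True simp_thms)
  next
    case False
    have "integrable (lebesgue_on \<Omega>) (\<lambda>x. norm (indicator E x *\<^sub>R F x) powr enn2real p)"
    proof (rule Bochner_Integration.integrable_bound)
      show "integrable (lebesgue_on \<Omega>) (\<lambda>x. norm (F x) powr enn2real p)"
        using F False by (simp add: Lp_field_def)
      show "(\<lambda>x. norm (indicator E x *\<^sub>R F x) powr enn2real p) \<in> borel_measurable (lebesgue_on \<Omega>)"
        using m by measurable
      show "AE x in lebesgue_on \<Omega>. norm (norm (indicator E x *\<^sub>R F x) powr enn2real p)
          \<le> norm (norm (F x) powr enn2real p)"
        using le by (auto intro!: AE_I2 powr_mono2)
    qed
    then show ?thesis
      using m False by (simp add: Lp_field_def)
  qed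
qed

lemma normal_trace_eq:
  assumes \<mu>: "signed_measure \<Omega> (div_measure \<Omega> F)" and E: "E \<in> sets borel" "E \<subseteq> \<Omega>" and \<phi>: "\<phi> \<in> Lip_c \<Omega>"
  shows "normal_trace \<Omega> F E \<phi> =
      real_integral \<Omega> (restrict_real_measure E (div_measure \<Omega> F)) \<phi> - distr_div \<Omega> (\<lambda>x. indicator E x *\<^sub>R F x) \<phi>"
proof -
  obtain C where "\<And>x. \<bar>\<phi> x\<bar> \<le> C"
    using Lip_c_bounded[OF \<phi>] by metis
  then have "real_integral \<Omega> (restrict_real_measure E (div_measure \<Omega> F)) \<phi> =
      real_integral \<Omega> (div_measure \<Omega> F) (\<lambda>x. indicator E x * \<phi> x)"
    using signed_measure.real_integral_restrict[OF \<mu> E(1) Lip_c_measurable[OF \<phi>]] by blast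
  moreover have "(LINT x:E|lebesgue. F x \<bullet> grad \<phi> x) = (LINT x:\<Omega>|lebesgue. (indicator E x *\<^sub>R F x) \<bullet> grad \<phi> x)"
    unfolding set_lebesgue_integral_def
    by (intro Bochner_Integration.integral_cong refl) (use E(2) in \<open>auto simp: indicator_def\<close>)
  ultimately show ?thesis
    by (simp add: normal_trace_def distr_div_def)
qed

text \<open>Off its boundary, the indicator of \<open>E\<close> is locally constant: a segment from \<open>E\<close> to its complement
  crosses \<open>frontier E\<close>, where \<open>\<phi>\<close> vanishes.\<close>

lemma indicator_mult_Lip_c:
  assumes \<phi>: "\<phi> \<in> Lip_c \<Omega>" and disj: "closure {x. \<phi> x \<noteq> 0} \<inter> frontier E = {}"
  shows "(\<lambda>x. indicator E x * \<phi> x) \<in> Lip_c \<Omega>"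
    and "grad (\<lambda>x. indicator E x * \<phi> x) x = indicator E x *\<^sub>R grad \<phi> x"
proof -
  let ?\<psi> = "\<lambda>x. indicator E x * \<phi> x"
  let ?K = "closure {x. \<phi> x \<noteq> 0}"
  obtain L where "Lipschitz_function \<phi> L"
    using \<phi> by (rule Lip_cE)
  then interpret Lipschitz_function \<phi> L .
  have vanish: "\<phi> z = 0" if "z \<in> frontier E" for z
    using that disj closure_subset[of "{x. \<phi> x \<noteq> 0}"] by auto
  have cross: "\<bar>\<phi> x\<bar> \<le> L * norm (x - y)" if "x \<in> E \<longleftrightarrow> y \<notin> E" for x y
  proof -
    have "closed_segment x y \<inter> frontier E \<noteq> {}"
      using that by (intro connected_Int_frontier) auto
    then obtain z where z: "z \<in> closed_segment x y" "z \<in> frontier E"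
      by blast
    have "\<bar>\<phi> x\<bar> \<le> L * norm (x - z)"
      using lip[of x z] vanish[OF z(2)] by simp
    also have "\<dots> \<le> L * norm (x - y)"
      using segment_bound(1)[OF z(1)] L_nonneg by (intro mult_left_mono) (auto simp: norm_minus_commute)
    finally show ?thesis .
  qed
  have "\<bar>?\<psi> x - ?\<psi> y\<bar> \<le> L * norm (x - y)" for x y
    using cross[of x y] cross[of y x] lip[of x y] L_nonneg
    by (cases "x \<in> E"; cases "y \<in> E") (auto simp: norm_minus_commute)
  then have "L-lipschitz_on UNIV ?\<psi>"
    using L_nonneg by (intro lipschitz_onI) (auto simp: dist_norm)
  moreover have sub: "closure {x. ?\<psi> x \<noteq> 0} \<subseteq> ?K"
    by (intro closure_mono) auto
  moreover have "compact (closure {x. ?\<psi> x \<noteq> 0})"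
    using compact_Int_closed[OF Lip_c_support(1)[OF \<phi>] closed_closure[of "{x. ?\<psi> x \<noteq> 0}"]] sub
    by (simp only: Int_absorb1)
  ultimately show "?\<psi> \<in> Lip_c \<Omega>"
    using Lip_c_support(2)[OF \<phi>] by (auto simp: Lip_c_def compact_support_in_def)
  show "grad ?\<psi> x = indicator E x *\<^sub>R grad \<phi> x"
  proof (cases "x \<in> ?K")
    case False
    then have "x \<notin> closure {x. ?\<psi> x \<noteq> 0}"
      using sub by blast
    then have "grad ?\<psi> x = 0"
      by (rule grad_outside_support)
    moreover have "grad \<phi> x = 0"
      using False by (rule grad_outside_support)
    ultimately show ?thesis
      by simp
  next
    case True
    then have "x \<notin> frontier E"
      using disj by blast
    then consider "x \<in> interior E" | "x \<in> - closure E"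
      by (auto simp: frontier_def)
    then show ?thesis
    proof cases
      case 1
      have "grad ?\<psi> x = grad \<phi> x"
        using open_interior 1
      proof (rule grad_cong_local)
        show "?\<psi> y = \<phi> y" if "y \<in> interior E" for y
          using that interior_subset[of E] by (auto simp: indicator_def)
      qed
      then show ?thesis
        using 1 interior_subset[of E] by auto
    next
      case 2
      have "grad ?\<psi> x = 0"
      proof (rule grad_locally_zero)
        show "open (- closure E)"
          by (simp add: open_Compl)
        show "?\<psi> y = 0" if "y \<in> - closure E" for y
          using that closure_subset[of E] by (auto simp: indicator_def)
      qed (rule 2)
      moreover have "x \<notin> E"
        using 2 closure_subset[of E] by auto
      ultimately show ?thesis
        by simp
    qed
  qed
qed

lemma normal_trace_eq_zero:
  assumes div: "\<And>\<phi>. \<phi> \<in> Lip_c \<Omega> \<Longrightarrow> distr_div \<Omega> F \<phi> = real_integral \<Omega> (div_measure \<Omega> F) \<phi>"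
    and E: "E \<subseteq> \<Omega>" and \<phi>: "\<phi> \<in> Lip_c \<Omega>" "closure {x. \<phi> x \<noteq> 0} \<inter> frontier E = {}"
  shows "normal_trace \<Omega> F E \<phi> = 0"
proof -
  let ?\<psi> = "\<lambda>x. indicator E x * \<phi> x"
  have "indicator E x *\<^sub>R (F x \<bullet> grad \<phi> x) = indicator \<Omega> x *\<^sub>R (F x \<bullet> grad ?\<psi> x)" for x
    unfolding indicator_mult_Lip_c(2)[OF \<phi>] using E by (auto simp: indicator_def)
  then have "(LINT x:E|lebesgue. F x \<bullet> grad \<phi> x) = (LINT x:\<Omega>|lebesgue. F x \<bullet> grad ?\<psi> x)"
    unfolding set_lebesgue_integral_def by (simp only:)
  moreover have "distr_div \<Omega> F ?\<psi> = real_integral \<Omega> (div_measure \<Omega> F) ?\<psi>"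
    by (rule div[OF indicator_mult_Lip_c(1)[OF \<phi>]])
  ultimately show ?thesis
    by (simp add: normal_trace_def distr_div_def)
qed

text \<open>The truncated distance to \<open>K\<close> serves here, as no smallness of the gradient
  is wanted. Nonemptiness matters: \<open>infdist\<close> to the empty set is 0, which would make
  the cutoff constantly 1.\<close>

lemma exists_infdist_cutoff:
  fixes K :: "'a::euclidean_space set"
  assumes K: "compact K" "K \<noteq> {}" and "0 < \<delta>"
  shows "\<exists>\<phi> :: 'a \<Rightarrow> real. (\<exists>L. L-lipschitz_on UNIV \<phi>) \<and> (\<forall>x. 0 \<le> \<phi> x \<and> \<phi> x \<le> 1) \<and> (\<forall>x\<in>K. \<phi> x = 1) \<and>
    {x. \<phi> x \<noteq> 0} \<subseteq> (\<Union>z\<in>K. cball z \<delta>)"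
proof -
  define \<phi> :: "'a \<Rightarrow> real" where "\<phi> x = max 0 (1 - infdist x K / \<delta>)" for x
  have "\<bar>\<phi> x - \<phi> y\<bar> \<le> inverse \<delta> * dist x y" for x y
  proof -
    have "\<bar>\<phi> x - \<phi> y\<bar> \<le> \<bar>infdist x K / \<delta> - infdist y K / \<delta>\<bar>"
      unfolding \<phi>_def by linarith
    also have "infdist x K / \<delta> - infdist y K / \<delta> = inverse \<delta> * (infdist x K - infdist y K)"
      by (simp add: divide_inverse algebra_simps)
    also have "\<bar>\<dots>\<bar> \<le> inverse \<delta> * dist x y"
      using infdist_triangle_abs[of x K y] \<open>0 < \<delta>\<close> by (simp add: abs_mult mult_left_mono)
    finally show ?thesis .
  qed
  then have "(inverse \<delta>)-lipschitz_on UNIV \<phi>"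
    using \<open>0 < \<delta>\<close> by (intro lipschitz_onI) (auto simp: dist_real_def)
  moreover have "{x. \<phi> x \<noteq> 0} \<subseteq> (\<Union>z\<in>K. cball z \<delta>)"
  proof
    fix x assume "x \<in> {x. \<phi> x \<noteq> 0}"
    then have "infdist x K / \<delta> \<le> 1"
      by (auto simp: \<phi>_def max_def split: if_splits)
    then have "infdist x K \<le> \<delta>"
      using \<open>0 < \<delta>\<close> by simp
    moreover obtain z where "z \<in> K" "infdist x K = dist x z"
      using infdist_attains_inf[OF compact_imp_closed[OF K(1)] K(2)] by blast
    ultimately show "x \<in> (\<Union>z\<in>K. cball z \<delta>)"
      by (auto simp: dist_commute)
  qed
  moreover have "0 \<le> \<phi> x \<and> \<phi> x \<le> 1" for x
    using \<open>0 < \<delta>\<close> infdist_nonneg[of x K] by (simp add: \<phi>_def)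
  moreover have "\<phi> x = 1" if "x \<in> K" for x
    using that by (simp add: \<phi>_def)
  ultimately show ?thesis
    by (intro exI[of _ \<phi>] conjI exI[of _ "inverse \<delta>"] allI ballI) auto
qed

text \<open>A compact set off the frontier has cutoffs supported off the frontier, on which the
  trace is 0, so its mass is 0. Inner regularity extends this to the whole open set
  \<open>\<Omega> - frontier E\<close>.\<close>

lemma (in signed_measure) concentrated_on_frontier:
  assumes \<Omega>: "open \<Omega>"
    and rep: "\<And>\<phi>. \<phi> \<in> Lip_c \<Omega> \<Longrightarrow> normal_trace \<Omega> F E \<phi> = real_integral \<Omega> \<mu> \<phi>"
    and zero: "\<And>\<phi>. \<phi> \<in> Lip_c \<Omega> \<Longrightarrow> closure {x. \<phi> x \<noteq> 0} \<inter> frontier E = {} \<Longrightarrow> normal_trace \<Omega> F E \<phi> = 0"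
  shows "concentrated_on \<Omega> \<mu> (frontier E \<inter> \<Omega>)"
proof -
  define U where "U = \<Omega> - frontier E"
  have U: "open U" "U \<subseteq> \<Omega>"
    using \<Omega> by (auto simp: U_def open_Diff)
  have "total_variation \<mu> U = 0"
  proof (rule total_variation_zero_if_compact_zero)
    show "U \<in> borel_subsets \<Omega>"
      using U by (auto simp: borel_subsets_def)
    fix K assume K: "compact K" "K \<subseteq> U"
    show "\<mu> K = 0"
    proof (cases "K = {}")
      case False
      obtain \<rho> where \<rho>: "\<rho> > 0" "(\<Union>x\<in>K. cball x \<rho>) \<subseteq> U"
        using compact_subset_open_imp_cball_epsilon_subset[OF K(1) U(1) K(2)] by blast
      show ?thesis
      proof (rule compact_zero_if_cutoffs[OF K(1) _ rep])
        fix e :: real assume "0 < e"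
        then have "0 < min \<rho> e"
          using \<rho>(1) by simp
        from exists_infdist_cutoff[OF K(1) False this] obtain \<phi> :: "'a \<Rightarrow> real" where
          all: "(\<exists>L. L-lipschitz_on UNIV \<phi>) \<and> (\<forall>x. 0 \<le> \<phi> x \<and> \<phi> x \<le> 1) \<and> (\<forall>x\<in>K. \<phi> x = 1) \<and>
            {x. \<phi> x \<noteq> 0} \<subseteq> (\<Union>z\<in>K. cball z (min \<rho> e))"
          by (elim exE)
        note \<phi> = all[THEN conjunct1] all[THEN conjunct2, THEN conjunct1]
          all[THEN conjunct2, THEN conjunct2, THEN conjunct1]
          all[THEN conjunct2, THEN conjunct2, THEN conjunct2]
        have near: "(\<Union>z\<in>K. cball z (min \<rho> e)) \<subseteq> (\<Union>z\<in>K. cball z \<rho>)"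
            "(\<Union>z\<in>K. cball z (min \<rho> e)) \<subseteq> (\<Union>z\<in>K. cball z e)"
          by (intro UN_mono subset_cball; simp)+
        have U_\<phi>: "\<phi> \<in> Lip_c U"
          by (rule Lip_c_near_compactI[OF \<phi>(1) K(1) \<phi>(4) order_trans[OF near(1) \<rho>(2)]])
        then have "\<phi> \<in> Lip_c \<Omega>"
          using Lip_c_mono[OF U(2)] by blast
        moreover have "normal_trace \<Omega> F E \<phi> = 0"
          using Lip_c_support(2)[OF U_\<phi>] by (intro zero[OF calculation]) (auto simp: U_def)
        ultimately show "\<exists>\<phi>\<in>Lip_c \<Omega>. (\<forall>x. 0 \<le> \<phi> x \<and> \<phi> x \<le> 1) \<and> (\<forall>x\<in>K. \<phi> x = 1) \<and>
            {x. \<phi> x \<noteq> 0} \<subseteq> (\<Union>z\<in>K. cball z e) \<and> \<bar>normal_trace \<Omega> F E \<phi>\<bar> \<le> e"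
          using \<phi>(2,3) order_trans[OF \<phi>(4) near(2)] \<open>0 < e\<close>
          by (intro bexI[of _ \<phi>] conjI) simp_all
      qed (use K(2) U(2) in auto)
    qed simp
  qed
  moreover have "\<Omega> - frontier E \<inter> \<Omega> = U"
    by (auto simp: U_def)
  ultimately show ?thesis
    by (simp add: concentrated_on_def)
qed

text \<open>The difference in the last assumption is the divergence of the field cut off to
  \<open>E\<close>, so on a compact K the mass of \<open>\<sigma>\<close> equals
  \<open>\<mu> (K \<inter> E)\<close>. That intersection need not be compact; hence the vanishing of
  \<open>\<mu>\<close> on compact sets is first raised to its total variation on
  \<open>B\<close>.\<close>

lemma total_variation_trace_zero:
  assumes \<sigma>: "signed_measure \<Omega> \<sigma>" and \<mu>: "signed_measure \<Omega> \<mu>"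
    and E: "E \<in> sets borel" and B: "B \<in> borel_subsets \<Omega>"
    and \<mu>0: "\<And>K. compact K \<Longrightarrow> K \<subseteq> B \<Longrightarrow> \<mu> K = 0"
    and \<nu>0: "\<And>K. compact K \<Longrightarrow> K \<subseteq> B \<Longrightarrow> restrict_real_measure E \<mu> K - \<sigma> K = 0"
  shows "total_variation \<sigma> B = 0"
proof (rule signed_measure.total_variation_zero_if_compact_zero[OF \<sigma> B])
  fix K assume K: "compact K" "K \<subseteq> B"
  interpret signed_measure \<Omega> \<mu> by fact
  have "total_variation \<mu> B = 0"
    using B \<mu>0 by (rule total_variation_zero_if_compact_zero)
  moreover have KE: "K \<inter> E \<in> borel_subsets \<Omega>" "K \<inter> E \<subseteq> B"
    using borel_compact[OF K(1)] K(2) E B by (auto simp: borel_subsets_def)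
  ultimately have "\<mu> (K \<inter> E) = 0"
    using total_variation_mono_zero[OF KE(1) B KE(2)] measure_zero_if_total_variation_zero[OF KE(1)] by blast
  then show "\<sigma> K = 0"
    using \<nu>0[OF K] by (simp add: restrict_real_measure_def)
qed

lemma conjugate_exponent_le:
  fixes p :: ennreal and n :: nat
  assumes n: "1 \<le> n" and p: "of_nat n / of_nat (n - 1) \<le> p" "p < \<infinity>"
  shows "1 < enn2real p" "conjugate_exponent (enn2real p) \<le> real n"
proof -
  \<comment> \<open>For n = 1 the lower bound is 1/0, which is \<infinity> in
    \<open>ennreal\<close>, so no finite \<open>p\<close> satisfies it.\<close>
  have "n \<noteq> 1"
    using p by (auto simp: ennreal_divide_zero top_unique)
  then have n2: "0 < real (n - 1)" "real (n - 1) = real n - 1"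
    using n by auto
  have "of_nat n / of_nat (n - 1) = ennreal (real n / real (n - 1))"
    using n2 by (simp only: ennreal_of_nat_eq_real_of_nat) (simp add: divide_ennreal)
  then have "ennreal (real n / real (n - 1)) \<le> ennreal (enn2real p)"
    using p by simp
  then have le: "real n / real (n - 1) \<le> enn2real p"
    by (subst (asm) ennreal_le_iff) auto
  have "1 < real n / real (n - 1)"
    using n2 by simp
  from this le show 1: "1 < enn2real p"
    by (rule order_less_le_trans)
  have "real n \<le> enn2real p * (real n - 1)"
    using le n2 by (simp add: pos_divide_le_eq)
  then show "conjugate_exponent (enn2real p) \<le> real n"
    using 1 by (simp add: conjugate_exponent_def pos_divide_le_eq algebra_simps)
qed

theorem theorem4p1:
  fixes \<Omega> E :: "(real ^ 'n) set" and F :: "real ^ 'n \<Rightarrow> real ^ 'n" and p :: ennreal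
  assumes "open \<Omega>"
    and "1 \<le> p"
    and "F \<in> DM p \<Omega>"
    and "E \<in> sets borel" and "bounded E" and "E \<subseteq> \<Omega>"
  shows
    "(\<forall>\<phi> \<in> Lip_c \<Omega>. normal_trace \<Omega> F E \<phi> =
        real_integral \<Omega> (restrict_real_measure E (div_measure \<Omega> F)) \<phi>
        - distr_div \<Omega> (\<lambda>x. indicator E x *\<^sub>R F x) \<phi>)
     \<and> ((\<exists>\<sigma>. trace_represented_by \<Omega> F E \<sigma>) \<longleftrightarrow>
          div_is_measure \<Omega> (\<lambda>x. indicator E x *\<^sub>R F x))
     \<and> (div_is_measure \<Omega> (\<lambda>x. indicator E x *\<^sub>R F x) \<longleftrightarrow>
          (\<lambda>x. indicator E x *\<^sub>R F x) \<in> DM p \<Omega>)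
     \<and> (\<forall>\<sigma>. trace_represented_by \<Omega> F E \<sigma> \<longrightarrow>
          (p = \<infinity> \<longrightarrow>
             (\<forall>B \<in> borel_subsets \<Omega>. hausdorff (real CARD('n) - 1) (B \<inter> frontier E) = 0 \<longrightarrow>
                total_variation \<sigma> B = 0))
          \<and> (of_nat CARD('n) / of_nat (CARD('n) - 1) \<le> p \<and> p < \<infinity> \<longrightarrow>
             (\<forall>B \<in> sets borel. B \<subseteq> frontier E \<longrightarrow>
                sigma_finite_hausdorff (real CARD('n) - conjugate_exponent (enn2real p)) B \<longrightarrow>
                total_variation \<sigma> (B \<inter> \<Omega>) = 0)))"
proof -
  define \<mu> where "\<mu> = div_measure \<Omega> F"
  define \<chi>F where "\<chi>F = (\<lambda>x. indicator E x *\<^sub>R F x)"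
  let ?n = "real CARD('n)"
  have n: "real DIM(real ^ 'n) = ?n"
    by simp
  have F: "Lp_field p \<Omega> F" and ex: "\<exists>\<mu>. div_represented_by \<Omega> F \<mu>"
    using assms(3) by (auto simp: DM_def div_is_measure_def)
  have rep: "div_represented_by \<Omega> F \<mu>"
    unfolding \<mu>_def div_measure_def using ex by (rule someI_ex)
  have \<Omega>b: "\<Omega> \<in> sets borel"
    using assms(1) by simp
  have signed: "signed_measure \<Omega> \<nu>" if "real_measure \<Omega> \<nu>" for \<nu>
    using \<Omega>b that by unfold_locales
  have \<mu>: "signed_measure \<Omega> \<mu>"
    using rep by (intro signed) (simp add: div_represented_by_def)
  have \<mu>E: "signed_measure \<Omega> (restrict_real_measure E \<mu>)"
    using \<mu> assms(4) by (rule signed_measure_restrict)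
  have \<chi>F: "Lp_field p \<Omega> \<chi>F"
    unfolding \<chi>F_def by (rule Lp_field_indicator[OF assms(1) F assms(4)])
  have div_F: "distr_div \<Omega> F \<phi> = real_integral \<Omega> \<mu> \<phi>" if "\<phi> \<in> Lip_c \<Omega>" for \<phi>
    using div_represented_by_Lip_c[OF assms(1) Lp_field_locally_integrable[OF assms(1) F assms(2)] rep that] .
  have trace: "normal_trace \<Omega> F E \<phi> = real_integral \<Omega> (restrict_real_measure E \<mu>) \<phi> - distr_div \<Omega> \<chi>F \<phi>"
    if "\<phi> \<in> Lip_c \<Omega>" for \<phi>
    using normal_trace_eq[OF _ assms(4,6) that] \<mu> by (simp add: \<mu>_def \<chi>F_def)
  have diff: "real_integral \<Omega> (\<lambda>B. restrict_real_measure E \<mu> B - \<nu> B) \<phi> =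
      real_integral \<Omega> (restrict_real_measure E \<mu>) \<phi> - real_integral \<Omega> \<nu> \<phi>"
    if \<nu>: "signed_measure \<Omega> \<nu>" and \<phi>: "\<phi> \<in> Lip_c \<Omega>" for \<nu> \<phi>
  proof -
    obtain C where "\<And>x. \<bar>\<phi> x\<bar> \<le> C"
      using Lip_c_bounded[OF \<phi>] by metis
    then show ?thesis
      using signed_measure.real_integral_diff_measure[OF \<mu>E \<nu> Lip_c_measurable[OF \<phi>]] by blast
  qed
  \<comment> \<open>The trace formula solved for the divergence of \<open>\<chi>F\<close>. It holds
    on all of \<open>Lip_c\<close>, so the cutoff arguments apply to \<open>\<chi>F\<close> with
    this measure.\<close>
  have div_\<chi>F: "distr_div \<Omega> \<chi>F \<phi> = real_integral \<Omega> (\<lambda>B. restrict_real_measure E \<mu> B - \<sigma> B) \<phi>"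
    if "trace_represented_by \<Omega> F E \<sigma>" "\<phi> \<in> Lip_c \<Omega>" for \<sigma> \<phi>
    using trace[OF that(2)] diff[OF _ that(2)] that signed[of \<sigma>] by (simp add: trace_represented_by_def)
  have iff1: "(\<exists>\<sigma>. trace_represented_by \<Omega> F E \<sigma>) \<longleftrightarrow> div_is_measure \<Omega> \<chi>F"
  proof
    assume "\<exists>\<sigma>. trace_represented_by \<Omega> F E \<sigma>"
    then obtain \<sigma> where \<sigma>: "trace_represented_by \<Omega> F E \<sigma>" ..
    then have "signed_measure \<Omega> \<sigma>"
      by (intro signed) (simp add: trace_represented_by_def)
    then have "real_measure \<Omega> (\<lambda>B. restrict_real_measure E \<mu> B - \<sigma> B)"
      using signed_measure.real_measure[OF signed_measure_diff[OF \<mu>E]] by blast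
    then have "div_represented_by \<Omega> \<chi>F (\<lambda>B. restrict_real_measure E \<mu> B - \<sigma> B)"
      using div_\<chi>F[OF \<sigma>] Cinf_c_subset_Lip_c by (auto simp: div_represented_by_def)
    then show "div_is_measure \<Omega> \<chi>F"
      by (auto simp: div_is_measure_def)
  next
    assume "div_is_measure \<Omega> \<chi>F"
    then obtain \<nu> where \<nu>: "div_represented_by \<Omega> \<chi>F \<nu>"
      by (auto simp: div_is_measure_def)
    then have s\<nu>: "signed_measure \<Omega> \<nu>"
      by (intro signed) (simp add: div_represented_by_def)
    define \<sigma> where "\<sigma> = (\<lambda>B. restrict_real_measure E \<mu> B - \<nu> B)"
    have s\<sigma>: "signed_measure \<Omega> \<sigma>"
      unfolding \<sigma>_def using \<mu>E s\<nu> by (rule signed_measure_diff)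
    \<comment> \<open>Here the divergence of \<open>\<chi>F\<close> is given on smooth functions
      only; the extension to Lipschitz functions supplies what the trace is tested against.\<close>
    have r: "normal_trace \<Omega> F E \<phi> = real_integral \<Omega> \<sigma> \<phi>" if "\<phi> \<in> Lip_c \<Omega>" for \<phi>
      using trace[OF that] diff[OF s\<nu> that]
        div_represented_by_Lip_c[OF assms(1) Lp_field_locally_integrable[OF assms(1) \<chi>F assms(2)] \<nu> that]
      by (simp add: \<sigma>_def)
    have "concentrated_on \<Omega> \<sigma> (frontier E \<inter> \<Omega>)"
    proof (rule signed_measure.concentrated_on_frontier[OF s\<sigma> assms(1) r])
      show "normal_trace \<Omega> F E \<phi> = 0" if "\<phi> \<in> Lip_c \<Omega>" "closure {x. \<phi> x \<noteq> 0} \<inter> frontier E = {}" for \<phi>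
        using div_F[unfolded \<mu>_def] assms(6) that by (rule normal_trace_eq_zero)
    qed
    then have "trace_represented_by \<Omega> F E \<sigma>"
      using r signed_measure.real_measure[OF s\<sigma>] by (simp add: trace_represented_by_def)
    then show "\<exists>\<sigma>. trace_represented_by \<Omega> F E \<sigma>"
      by (rule exI[of _ \<sigma>])
  qed
  have iff2: "div_is_measure \<Omega> \<chi>F \<longleftrightarrow> \<chi>F \<in> DM p \<Omega>"
    using \<chi>F by (simp add: DM_def)
  have inf: "total_variation \<sigma> B = 0"
    if \<sigma>: "trace_represented_by \<Omega> F E \<sigma>" and p: "p = \<infinity>" and B: "B \<in> borel_subsets \<Omega>"
      and H: "hausdorff (?n - 1) (B \<inter> frontier E) = 0" for \<sigma> B
  proof -
    have s\<sigma>: "signed_measure \<Omega> \<sigma>" and conc: "total_variation \<sigma> (\<Omega> - frontier E \<inter> \<Omega>) = 0"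
      using \<sigma> signed by (auto simp: trace_represented_by_def concentrated_on_def)
    have Bf: "B \<inter> frontier E \<in> borel_subsets \<Omega>" "B - frontier E \<in> borel_subsets \<Omega>"
        "\<Omega> - frontier E \<inter> \<Omega> \<in> borel_subsets \<Omega>"
      using B \<Omega>b by (auto simp: borel_subsets_def)
    have HK: "hausdorff (real DIM(real ^ 'n) - 1) K = 0" if "K \<subseteq> B \<inter> frontier E" for K :: "(real ^ 'n) set"
      using hausdorff_mono[OF that, of "?n - 1"] H by simp
    have KO: "K \<subseteq> \<Omega>" if "K \<subseteq> B \<inter> frontier E" for K
      using that B by (auto simp: borel_subsets_def)
    \<comment> \<open>The Hausdorff hypothesis concerns only this part of \<open>B\<close>; the part
      off the frontier is covered by concentration.\<close>
    have "total_variation \<sigma> (B \<inter> frontier E) = 0"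
    proof (rule total_variation_trace_zero[OF s\<sigma> \<mu> assms(4) Bf(1)])
      fix K assume K: "compact K" "K \<subseteq> B \<inter> frontier E"
      show "\<mu> K = 0"
        using signed_measure.compact_zero_bounded_field[OF \<mu> assms(1) F[unfolded p] div_F K(1) KO[OF K(2)] HK[OF K(2)]] .
      show "restrict_real_measure E \<mu> K - \<sigma> K = 0"
        using signed_measure.compact_zero_bounded_field[OF signed_measure_diff[OF \<mu>E s\<sigma>] assms(1) \<chi>F[unfolded p]
            div_\<chi>F[OF \<sigma>] K(1) KO[OF K(2)] HK[OF K(2)]] .
    qed
    moreover have "total_variation \<sigma> (B - frontier E) = 0"
      using B by (intro signed_measure.total_variation_mono_zero[OF s\<sigma> Bf(2,3) _ conc]) (auto simp: borel_subsets_def)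
    \<comment> \<open>The two parts are padded with empty sets so that the statement on countable
      unions applies.\<close>
    ultimately have "total_variation \<sigma> (\<Union>i. binaryset (B \<inter> frontier E) (B - frontier E) i) = 0"
    proof (intro signed_measure.total_variation_UN_zero[OF s\<sigma>])
      show "range (binaryset (B \<inter> frontier E) (B - frontier E)) \<subseteq> borel_subsets \<Omega>"
        using Bf sigma_algebra.axioms(1)[OF sigma_algebra_borel_subsets[OF \<Omega>b]]
        by (auto simp: range_binaryset_eq borel_subsets_def)
      have "total_variation \<sigma> {} = 0"
        using signed_measure.total_variation_zero_if_compact_zero[OF s\<sigma>, of "{}"] signed_measure.empty[OF s\<sigma>]
        by (simp add: borel_subsets_def)
      then show "total_variation \<sigma> (binaryset (B \<inter> frontier E) (B - frontier E) i) = 0" for i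
        using \<open>total_variation \<sigma> (B \<inter> frontier E) = 0\<close> \<open>total_variation \<sigma> (B - frontier E) = 0\<close>
        by (simp add: binaryset_def)
    qed
    then show ?thesis
      by (simp add: UN_binaryset_eq Int_Diff_Un)
  qed
  have fin: "total_variation \<sigma> (B \<inter> \<Omega>) = 0"
    if \<sigma>: "trace_represented_by \<Omega> F E \<sigma>" and p: "of_nat CARD('n) / of_nat (CARD('n) - 1) \<le> p" "p < \<infinity>"
      and B: "B \<in> sets borel" "sigma_finite_hausdorff (?n - conjugate_exponent (enn2real p)) B" for \<sigma> B
  proof -
    have s\<sigma>: "signed_measure \<Omega> \<sigma>"
      using \<sigma> signed by (auto simp: trace_represented_by_def)
    have p': "p \<noteq> \<infinity>" "1 < enn2real p" "conjugate_exponent (enn2real p) \<le> real DIM(real ^ 'n)"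
      using conjugate_exponent_le[OF _ p] p(2) by (auto simp: Suc_leI)
    obtain A :: "nat \<Rightarrow> (real ^ 'n) set" where A: "range A \<subseteq> sets borel" "B = (\<Union>i. A i)"
        "\<And>i. hausdorff (?n - conjugate_exponent (enn2real p)) (A i) < \<infinity>"
      using B(2) by (auto simp: sigma_finite_hausdorff_def)
    have A\<Omega>: "A i \<inter> \<Omega> \<in> borel_subsets \<Omega>" for i
      using A(1) \<Omega>b by (auto simp: borel_subsets_def)
    have HK: "hausdorff (real DIM(real ^ 'n) - conjugate_exponent (enn2real p)) K < \<infinity>" if "K \<subseteq> A i \<inter> \<Omega>" for K :: "(real ^ 'n) set" and i
      using hausdorff_mono[of K "A i" "?n - conjugate_exponent (enn2real p)"] that A(3)[of i] n
      by (metis le_infE order_le_less_trans)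
    \<comment> \<open>The pieces of the sigma-finite set are treated singly: each compact subset of
      a piece has finite Hausdorff measure by monotonicity.\<close>
    have "total_variation \<sigma> (A i \<inter> \<Omega>) = 0" for i
    proof (rule total_variation_trace_zero[OF s\<sigma> \<mu> assms(4) A\<Omega>])
      fix K assume K: "compact K" "K \<subseteq> A i \<inter> \<Omega>"
      then have K\<Omega>: "K \<subseteq> \<Omega>"
        by blast
      show "\<mu> K = 0"
        using signed_measure.compact_zero_Lp_field[OF \<mu> assms(1) F p'(1,2) refl p'(3) div_F K(1) K\<Omega> HK[OF K(2)]] .
      show "restrict_real_measure E \<mu> K - \<sigma> K = 0"
        using signed_measure.compact_zero_Lp_field[OF signed_measure_diff[OF \<mu>E s\<sigma>] assms(1) \<chi>F p'(1,2) refl p'(3)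
            div_\<chi>F[OF \<sigma>] K(1) K\<Omega> HK[OF K(2)]] .
    qed
    then have "total_variation \<sigma> (\<Union>i. A i \<inter> \<Omega>) = 0"
      using A\<Omega> by (intro signed_measure.total_variation_UN_zero[OF s\<sigma>]) auto
    moreover have "(\<Union>i. A i \<inter> \<Omega>) = B \<inter> \<Omega>"
      using A(2) by auto
    ultimately show ?thesis
      by simp
  qed
  show ?thesis
    using trace iff1 iff2 inf fin unfolding \<chi>F_def \<mu>_def by blast
qed

end
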